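(* Let $p$ be a prime and fix a finite set $S\subseteq\mathbb{Z}_{>0}$. (1) The law of a random polynomial $P^S\in\mathscr{P}^S$ is determined by the distributions of the random variables $\mathrm{val}(\mathrm{Res}(P^S,Z))$, $Z\in\mathscr{P}^S$. In particular, if $P_1^S,P_2^S$ are random elements of $\mathscr{P}^S$ such that $\mathrm{val}(\mathrm{Res}(P_1^S,Z))$ and $\mathrm{val}(\mathrm{Res}(P_2^S,Z))$ have the same distribution for every fixed $Z\in\mathscr{P}^S$, then $P_1^S$ and $P_2^S$ have the same law. (2) Let $P_1^S,P_2^S,\ldots$ be random polynomials in $\mathscr{P}^S$. Suppose that for every fixed $Z\in\mathscr{P}^S$ the sequence $\mathrm{val}(\mathrm{Res}(P_n^S,Z))$ converges in distribution as $n\to\infty$, and that $\lim_{D\to\infty}\sup_{n\ge 1}\mathbf{P}(\deg P_n^S>D)=0$. Then there exists a random polynomial $P_\infty^S\in\mathscr{P}^S$ such that $P_n^S\to P_\infty^S$ in distribution. (3) Assume the hypotheses of (2), and let $P_\infty^S$ be the resulting limiting random polynomial. Let $m\ge 1$, let $K_1,\ldots,K_m$ be finite extensions of $\mathbb{Q}_p$, and let $U\subseteq\mathcal{O}_{K_1}^{\mathrm{new}}\times\cdots\times\mathcal{O}_{K_m}^{\mathrm{new}}$ be clopen (in the subspace topology). If $P_\infty^S$ is almost surely squarefree, then $Z_U(P_n^S)\to Z_U(P_\infty^S)$ in distribution. If, in addition, $$\lim_{D\to\infty}\sup_{n\ge 1}\mathbf{E}\left[(\deg P_n^S)^m\mathbf{1}_{\{\deg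 P_n^S>D\}}\right]=0,$$ then $$\lim_{n\to\infty}\mathbf{E}[Z_U(P_n^S)]=\mathbf{E}[Z_U(P_\infty^S)].$$
   Context: Fix an algebraic closure $\overline{\mathbb{Q}}_p$ with valuation $\mathrm{val}$, $\mathrm{val}(p)=1$, $\mathrm{val}(0)=\infty$; all finite extensions of $\mathbb{Q}_p$ are subfields of $\overline{\mathbb{Q}}_p$. Let $F_1=x,F_2,F_3,\ldots$ be a fixed enumeration of all monic irreducible polynomials over $\mathbb{F}_p$. Let $\mathcal{U}_i$ be the set of algebraic integers $\alpha\in\overline{\mathbb{Q}}_p$ whose minimal polynomial over $\mathbb{Q}_p$ reduces modulo $p$ to a power of $F_i$. $\mathscr{P}^S$ is the set of monic polynomials in $\mathbb{Z}_p[x]$ all of whose roots lie in $\bigcup_{i\in S}\mathcal{U}_i$ (including the constant polynomial $1$). It carries the disjoint-union topology of its degree-$d$ components, each a subset of $\mathbb{Z}_p^d$ via non-leading coefficients, with the corresponding Borel structure. Laws and convergence in distribution of random polynomials are with respect to this topology. Convergence in distribution of valuations is in $\mathbb{Z}_{\ge0}\cup\{\infty\}$ with the one-point compactification topology. For nonzero polynomials with leading coefficients $a,b$, degrees $r_1,r_2$ and roots $(x_{1,j}),(x_{2,l})$ counted with multiplicity, $\mathrm{Res}(Z_1,Z_2)=a^{r_2}b^{r_1}\prod_{j,l}(x_{1,j}-x_{2,l})$; a resultant with the polynomial $1$ equals $1$. For a finite extension $K$, $\mathcal{O}_K^{\mathrm{new}}=\{x\in\mathcal{O}_K:\mathbb{Q}_p[x]=K\}$.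 For a nonzero polynomial $P\in\mathbb{Z}_p[x]$, $Z_U(P)$ is the number of tuples $(x_1,\ldots,x_m)\in U$ such that each $x_i$ is a root of $P$ and $x_1,\ldots,x_m$ lie in pairwise distinct orbits of $\mathrm{Gal}(\overline{\mathbb{Q}}_p/\mathbb{Q}_p)$. Squarefree means having no repeated root. *)

theory Defs
  imports
    "HOL-Probability.Probability"
    "HOL-Algebra.Algebraic_Closure_Type"
    "Berlekamp_Zassenhaus.Finite_Field"
begin

section \<open>The field of p-adic numbers\<close>

text \<open>The prime p is the cardinality of the type parameter. The p-adic integers are the inverse
  limit of the rings of integers modulo p^n, each residue class being represented by its
  least nonnegative element.\<close>

typedef (overloaded) ('p::prime_card) padic_int =
  "{f :: nat \<Rightarrow> int. \<forall>n. f n \<in> {0..<int CARD('p) ^ n} \<and> f (Suc n) mod int CARD('p) ^ n = f n}"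
  by (rule exI[of _ "\<lambda>_. 0"]) (auto simp: prime_card prime_gt_0_nat)

setup_lifting type_definition_padic_int

lemma padic_closed_aux:
  fixes h :: "nat \<Rightarrow> int"
  assumes "\<And>n. h (Suc n) mod int CARD('p::prime_card) ^ n = h n mod int CARD('p) ^ n"
  shows "h n mod int CARD('p) ^ n \<in> {0..<int CARD('p) ^ n}
    \<and> (h (Suc n) mod int CARD('p) ^ Suc n) mod int CARD('p) ^ n = h n mod int CARD('p) ^ n"
  using assms[of n] by (simp add: mod_mod_cancel prime_card prime_gt_0_nat)

instantiation padic_int :: (prime_card) comm_ring_1
begin

lift_definition zero_padic_int :: "'a padic_int" is "\<lambda>_. 0"
  by (auto simp: prime_card prime_gt_0_nat)

lift_definition one_padic_int :: "'a padic_int" is "\<lambda>n. 1 mod int CARD('a) ^ n"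
  using padic_closed_aux[where ?'p='a and h = "\<lambda>_. 1"] by auto

lift_definition plus_padic_int :: "'a padic_int \<Rightarrow> 'a padic_int \<Rightarrow> 'a padic_int"
  is "\<lambda>f g n. (f n + g n) mod int CARD('a) ^ n"
proof -
  fix f g :: "nat \<Rightarrow> int" and n
  assume f: "\<And>n. f n \<in> {0..<int CARD('a) ^ n} \<and> f (Suc n) mod int CARD('a) ^ n = f n"
    and g: "\<And>n. g n \<in> {0..<int CARD('a) ^ n} \<and> g (Suc n) mod int CARD('a) ^ n = g n"
  have "(f (Suc n) + g (Suc n)) mod int CARD('a) ^ n = (f n + g n) mod int CARD('a) ^ n" for n
    using f[of n] g[of n] by (metis mod_add_eq)
  then show "(f n + g n) mod int CARD('a) ^ n \<in> {0..<int CARD('a) ^ n} \<and>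
      ((f (Suc n) + g (Suc n)) mod int CARD('a) ^ Suc n) mod int CARD('a) ^ n = (f n + g n) mod int CARD('a) ^ n"
    using padic_closed_aux[where ?'p='a and h = "\<lambda>n. f n + g n"] by blast
qed

lift_definition times_padic_int :: "'a padic_int \<Rightarrow> 'a padic_int \<Rightarrow> 'a padic_int"
  is "\<lambda>f g n. (f n * g n) mod int CARD('a) ^ n"
proof -
  fix f g :: "nat \<Rightarrow> int" and n
  assume f: "\<And>n. f n \<in> {0..<int CARD('a) ^ n} \<and> f (Suc n) mod int CARD('a) ^ n = f n"
    and g: "\<And>n. g n \<in> {0..<int CARD('a) ^ n} \<and> g (Suc n) mod int CARD('a) ^ n = g n"
  have "(f (Suc n) * g (Suc n)) mod int CARD('a) ^ n = (f n * g n) mod int CARD('a) ^ n" for n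
    using f[of n] g[of n] by (metis mod_mult_eq)
  then show "(f n * g n) mod int CARD('a) ^ n \<in> {0..<int CARD('a) ^ n} \<and>
      ((f (Suc n) * g (Suc n)) mod int CARD('a) ^ Suc n) mod int CARD('a) ^ n = (f n * g n) mod int CARD('a) ^ n"
    using padic_closed_aux[where ?'p='a and h = "\<lambda>n. f n * g n"] by blast
qed

lift_definition uminus_padic_int :: "'a padic_int \<Rightarrow> 'a padic_int"
  is "\<lambda>f n. (- f n) mod int CARD('a) ^ n"
proof -
  fix f :: "nat \<Rightarrow> int" and n
  assume f: "\<And>n. f n \<in> {0..<int CARD('a) ^ n} \<and> f (Suc n) mod int CARD('a) ^ n = f n"
  have "(- f (Suc n)) mod int CARD('a) ^ n = (- f n) mod int CARD('a) ^ n" for n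
    using f[of n] by (metis mod_minus_eq)
  then show "(- f n) mod int CARD('a) ^ n \<in> {0..<int CARD('a) ^ n} \<and>
      ((- f (Suc n)) mod int CARD('a) ^ Suc n) mod int CARD('a) ^ n = (- f n) mod int CARD('a) ^ n"
    using padic_closed_aux[where ?'p='a and h = "\<lambda>n. - f n"] by blast
qed

definition minus_padic_int :: "'a padic_int \<Rightarrow> 'a padic_int \<Rightarrow> 'a padic_int"
  where "minus_padic_int x y = x + - y"

instance
proof
  fix a b c :: "'a padic_int"
  show "a + b + c = a + (b + c)" by transfer (auto simp: mod_simps add_ac)
  show "a + b = b + a" by transfer (auto simp: add_ac)
  show "0 + a = a" by transfer auto
  show "- a + a = 0" by transfer (auto simp: mod_simps)
  show "a - b = a + - b" by (simp add: minus_padic_int_def)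
  show "a * b * c = a * (b * c)" by transfer (auto simp: mod_simps mult_ac)
  show "a * b = b * a" by transfer (auto simp: mult_ac)
  show "1 * a = a" by transfer (auto simp: mod_simps)
  show "(a + b) * c = a * c + b * c" by transfer (auto simp: mod_simps distrib_right)
  show "(0 :: 'a padic_int) \<noteq> 1"
  proof (transfer, rule notI)
    assume "(\<lambda>_. 0 :: int) = (\<lambda>n. 1 mod int CARD('a) ^ n)"
    from fun_cong[OF this, of 1] show False
      using prime_gt_1_nat[OF prime_card[where ?'a='a]] by simp
  qed
qed

end

instance padic_int :: (prime_card) idom
proof
  fix a b :: "'a padic_int"
  assume "a \<noteq> 0" "b \<noteq> 0"
  then show "a * b \<noteq> 0"
  proof (transfer, intro notI)
    fix f g :: "nat \<Rightarrow> int"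
    let ?p = "int CARD('a)"
    assume f: "\<forall>n. f n \<in> {0..<?p ^ n} \<and> f (Suc n) mod ?p ^ n = f n"
      and g: "\<forall>n. g n \<in> {0..<?p ^ n} \<and> g (Suc n) mod ?p ^ n = g n"
      and "f \<noteq> (\<lambda>_. 0)" "g \<noteq> (\<lambda>_. 0)"
      and z: "(\<lambda>n. f n * g n mod ?p ^ n) = (\<lambda>_. 0)"
    then obtain i j where i: "f i \<noteq> 0" and j: "g j \<noteq> 0" by blast
    have step: "h (n + k) mod ?p ^ n = h n"
      if h: "\<forall>n. h n \<in> {0..<?p ^ n} \<and> h (Suc n) mod ?p ^ n = h n" for h :: "nat \<Rightarrow> int" and n k
    proof (induction k)
      case 0
      then show ?case using h by auto
    next
      case (Suc k)
      have "h (n + Suc k) mod ?p ^ n = h (Suc (n + k)) mod ?p ^ (n + k) mod ?p ^ n"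
        by (simp add: mod_mod_cancel le_imp_power_dvd)
      then show ?case using h Suc by simp
    qed
    have "f (i + j) mod ?p ^ i = f i" "g (i + j) mod ?p ^ j = g j"
      using step[OF f, of i j] step[OF g, of j i] by (simp_all add: add.commute)
    then have nd: "\<not> ?p ^ i dvd f (i + j)" "\<not> ?p ^ j dvd g (i + j)" using i j by auto
    have "f (i + j) * g (i + j) mod ?p ^ (i + j) = 0" using fun_cong[OF z, of "i + j"] by simp
    then have "?p ^ (i + j) dvd f (i + j) * g (i + j)" by auto
    moreover have "prime_elem ?p" using prime_card_int by auto
    ultimately obtain k l where kl: "k + l = i + j" "?p ^ k dvd f (i + j)" "?p ^ l dvd g (i + j)"
      using prime_elem_power_dvd_prod by metis
    then consider "i \<le> k" | "j \<le> l" by linarith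
    then show False
    proof cases
      case 1
      show False using nd(1) dvd_trans[OF le_imp_power_dvd[OF 1] kl(2)] by blast
    next
      case 2
      show False using nd(2) dvd_trans[OF le_imp_power_dvd[OF 2] kl(3)] by blast
    qed
  qed
qed

type_synonym 'p padic = "'p padic_int fract"
type_synonym 'p padic_closure = "'p padic alg_closure"

lift_definition residue_mod_p :: "'p::prime_card padic_int \<Rightarrow> 'p mod_ring"
  is "\<lambda>f. of_int_mod_ring (f 1)" .

abbreviation lift_padic_poly :: "'p::prime_card padic poly \<Rightarrow> 'p padic_closure poly"
  where "lift_padic_poly \<equiv> map_poly to_ac"

abbreviation lift_poly :: "'p::prime_card padic_int poly \<Rightarrow> 'p padic_closure poly"
  where "lift_poly P \<equiv> lift_padic_poly (map_poly to_fract P)"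

section \<open>The algebraic closure and its valuation\<close>

text \<open>The supremum of the exponents k such that q lies in p^k times the ring of p-adic
  integers; for q = 0 every k qualifies and the value is infinite.\<close>

definition padic_val :: "'p::prime_card padic \<Rightarrow> ereal" where
  "padic_val q = (SUP k \<in> {k::int. \<exists>a. q = of_nat CARD('p) powi k * to_fract a}. ereal (of_int k))"

definition min_poly :: "'p::prime_card padic_closure \<Rightarrow> 'p padic poly" where
  "min_poly x = (THE m. Polynomial.lead_coeff m = 1 \<and> Factorial_Ring.irreducible m \<and>
     poly (lift_padic_poly m) x = 0)"

text \<open>The unique extension of the valuation: up to sign, the constant coefficient of the
  minimal polynomial of x is the norm of x from the field generated by x.\<close>

definition val :: "'p::prime_card padic_closure \<Rightarrow> ereal" where
  "val x = padic_val (Polynomial.coeff (min_poly x) 0) /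
     ereal (real (Polynomial.degree (min_poly x)))"

definition algebraic_integers :: "'p::prime_card padic_closure set" where
  "algebraic_integers = {x. \<exists>Q. Polynomial.lead_coeff Q = 1 \<and> poly (lift_poly Q) x = 0}"

definition galois_group :: "('p::prime_card padic_closure \<Rightarrow> 'p padic_closure) set" where
  "galois_group = {\<sigma>. bij \<sigma> \<and> (\<forall>x y. \<sigma> (x + y) = \<sigma> x + \<sigma> y) \<and> (\<forall>x y. \<sigma> (x * y) = \<sigma> x * \<sigma> y)
     \<and> (\<forall>a. \<sigma> (to_ac a) = to_ac a)}"

definition finite_extension :: "'p::prime_card padic_closure set \<Rightarrow> bool" where
  "finite_extension K \<longleftrightarrow>
     range to_ac \<subseteq> K \<and>
     (\<forall>x\<in>K. \<forall>y\<in>K. x - y \<in> K \<and> x * y \<in> K) \<and> (\<forall>x\<in>K. inverse x \<in> K) \<and>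
     (\<exists>B. finite B \<and> Modules.module.span (\<lambda>c x. to_ac c * x) B = K)"

text \<open>Integral elements x of K such that the ring generated by x over the p-adic field is K.\<close>

definition new_integers :: "'p::prime_card padic_closure set \<Rightarrow> 'p padic_closure set" where
  "new_integers K =
     {x \<in> K \<inter> algebraic_integers. range (\<lambda>q. poly (lift_padic_poly q) x) = K}"

definition padic_closure_topology :: "'p::prime_card padic_closure topology" where
  "padic_closure_topology =
     topology (\<lambda>V. \<forall>x\<in>V. \<exists>r::real. {y. ereal r < val (y - x)} \<subseteq> V)"

lemma openin_padic_closure_topology:
  "openin padic_closure_topology V \<longleftrightarrow> (\<forall>x\<in>V. \<exists>r::real. {y. ereal r < val (y - x)} \<subseteq> V)"
proof -
  have "istopology (\<lambda>V :: 'a padic_closure set. \<forall>x\<in>V. \<exists>r::real. {y. ereal r < val (y - x)} \<subseteq> V)"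
    unfolding istopology_def
  proof (intro conjI allI impI ballI)
    fix S T :: "'a padic_closure set" and x
    assume S: "\<forall>x\<in>S. \<exists>r::real. {y. ereal r < val (y - x)} \<subseteq> S"
      and T: "\<forall>x\<in>T. \<exists>r::real. {y. ereal r < val (y - x)} \<subseteq> T" and x: "x \<in> S \<inter> T"
    obtain r s :: real where "{y. ereal r < val (y - x)} \<subseteq> S" "{y. ereal s < val (y - x)} \<subseteq> T"
      using S T x by (meson IntE)
    moreover have "ereal r < c \<and> ereal s < c" if "ereal (max r s) < c" for c
      using that by (cases c) auto
    ultimately have "{y. ereal (max r s) < val (y - x)} \<subseteq> S \<inter> T" by blast
    then show "\<exists>r::real. {y. ereal r < val (y - x)} \<subseteq> S \<inter> T" by blast
  next
    fix \<K> :: "'a padic_closure set set" and x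
    assume "\<forall>K\<in>\<K>. \<forall>x\<in>K. \<exists>r::real. {y. ereal r < val (y - x)} \<subseteq> K" and "x \<in> \<Union>\<K>"
    then show "\<exists>r::real. {y. ereal r < val (y - x)} \<subseteq> \<Union>\<K>"
      by (meson Sup_upper UnionE subset_trans)
  qed
  then show ?thesis by (simp add: padic_closure_topology_def topology_inverse')
qed

section \<open>The space of polynomials\<close>

definition U_set :: "'p::prime_card mod_ring poly \<Rightarrow> 'p padic_closure set" where
  "U_set f = {\<alpha> \<in> algebraic_integers.
     \<exists>Q. map_poly to_fract Q = min_poly \<alpha> \<and> (\<exists>k. map_poly residue_mod_p Q = f ^ k)}"

definition poly_space ::
  "(nat \<Rightarrow> 'p::prime_card mod_ring poly) \<Rightarrow> nat set \<Rightarrow> 'p padic_int poly set" where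
  "poly_space F S = {P. Polynomial.lead_coeff P = 1 \<and>
     (\<forall>\<alpha>. poly (lift_poly P) \<alpha> = 0 \<longrightarrow> \<alpha> \<in> (\<Union>i\<in>S. U_set (F i)))}"

definition padic_int_topology :: "'p::prime_card padic_int topology" where
  "padic_int_topology = topology (\<lambda>V. \<forall>x\<in>V. \<exists>n. {y. of_nat CARD('p) ^ n dvd y - x} \<subseteq> V)"

lemma openin_padic_int_topology:
  "openin (padic_int_topology :: 'p::prime_card padic_int topology) V \<longleftrightarrow>
     (\<forall>x\<in>V. \<exists>n. {y. of_nat CARD('p) ^ n dvd y - x} \<subseteq> V)"
proof -
  let ?B = "\<lambda>x n. {y :: 'p padic_int. of_nat CARD('p) ^ n dvd y - x}"
  have "istopology (\<lambda>V. \<forall>x\<in>V. \<exists>n. ?B x n \<subseteq> V)"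
    unfolding istopology_def
  proof (intro conjI allI impI ballI)
    fix S T x
    assume S: "\<forall>x\<in>S. \<exists>n. ?B x n \<subseteq> S" and T: "\<forall>x\<in>T. \<exists>n. ?B x n \<subseteq> T" and x: "x \<in> S \<inter> T"
    obtain n k where nk: "?B x n \<subseteq> S" "?B x k \<subseteq> T"
      using S T x by (meson IntE)
    have "?B x (max n k) \<subseteq> ?B x i" if "i \<le> max n k" for i
    proof
      fix y assume "y \<in> ?B x (max n k)"
      then have "of_nat CARD('p) ^ max n k dvd y - x" by (rule CollectD)
      then show "y \<in> ?B x i" by (intro CollectI dvd_trans[OF le_imp_power_dvd[OF that]])
    qed
    then have "?B x (max n k) \<subseteq> ?B x n" "?B x (max n k) \<subseteq> ?B x k"
      using max.cobounded1[of n k] max.cobounded2[of k n] by simp_all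
    then have "?B x (max n k) \<subseteq> S \<inter> T" using nk by blast
    then show "\<exists>n. ?B x n \<subseteq> S \<inter> T" by blast
  next
    fix \<K> x
    assume "\<forall>K\<in>\<K>. \<forall>x\<in>K. \<exists>n. ?B x n \<subseteq> K" and "x \<in> \<Union>\<K>"
    then show "\<exists>n. ?B x n \<subseteq> \<Union>\<K>"
      by (meson Sup_upper UnionE subset_trans)
  qed
  then show ?thesis by (simp add: padic_int_topology_def topology_inverse')
qed

text \<open>The polynomials of degree d, as a subspace of the d-fold product of the p-adic integers
  via the non-leading coefficients.\<close>

definition degree_component ::
  "(nat \<Rightarrow> 'p::prime_card mod_ring poly) \<Rightarrow> nat set \<Rightarrow> nat \<Rightarrow> 'p padic_int poly topology" where
  "degree_component F S d =
     pullback_topology {P \<in> poly_space F S. Polynomial.degree P = d}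
       (\<lambda>P. restrict (Polynomial.coeff P) {..<d})
       (product_topology (\<lambda>_. padic_int_topology) {..<d})"

definition poly_topology ::
  "(nat \<Rightarrow> 'p::prime_card mod_ring poly) \<Rightarrow> nat set \<Rightarrow> 'p padic_int poly topology" where
  "poly_topology F S = topology (\<lambda>V. V \<subseteq> poly_space F S \<and>
     (\<forall>d. openin (degree_component F S d) {P \<in> V. Polynomial.degree P = d}))"

lemma openin_poly_topology:
  "openin (poly_topology F S) V \<longleftrightarrow> V \<subseteq> poly_space F S \<and>
     (\<forall>d. openin (degree_component F S d) {P \<in> V. Polynomial.degree P = d})"
proof -
  have "istopology (\<lambda>V. V \<subseteq> poly_space F S \<and>
     (\<forall>d. openin (degree_component F S d) {P \<in> V. Polynomial.degree P = d}))" (is "istopology ?L")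
    unfolding istopology_def
  proof (rule conjI; intro allI impI)
    fix A B assume "?L A" "?L B"
    moreover have "{P \<in> A \<inter> B. Polynomial.degree P = d} =
      {P \<in> A. Polynomial.degree P = d} \<inter> {P \<in> B. Polynomial.degree P = d}" for d
      by auto
    ultimately show "?L (A \<inter> B)" by auto
  next
    fix \<K> assume *: "\<forall>K\<in>\<K>. ?L K"
    have "{P \<in> \<Union>\<K>. Polynomial.degree P = d} = (\<Union>K\<in>\<K>. {P \<in> K. Polynomial.degree P = d})" for d
      by auto
    with * show "?L (\<Union>\<K>)" by (auto intro!: openin_Union)
  qed
  then show ?thesis by (simp add: poly_topology_def topology_inverse')
qed

definition Res :: "'a::idom poly \<Rightarrow> 'a poly \<Rightarrow> 'a" where
  "Res P Q = Polynomial.lead_coeff P ^ Polynomial.degree Q *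
     Polynomial.lead_coeff Q ^ Polynomial.degree P *
     (\<Prod>x\<in>#proots P. \<Prod>y\<in>#proots Q. x - y)"

definition val_Res :: "'p::prime_card padic_int poly \<Rightarrow> 'p padic_int poly \<Rightarrow> ereal" where
  "val_Res P Z = val (Res (lift_poly P) (lift_poly Z))"

text \<open>Tuples are extensional functions on the index set \<open>{..<m}\<close>.\<close>

definition root_tuple_count ::
  "nat \<Rightarrow> (nat \<Rightarrow> 'p::prime_card padic_closure) set \<Rightarrow> 'p padic_int poly \<Rightarrow> nat" where
  "root_tuple_count m U P = card {x \<in> U. (\<forall>i<m. poly (lift_poly P) (x i) = 0) \<and>
     (\<forall>i<m. \<forall>j<m. i \<noteq> j \<longrightarrow> (\<forall>\<sigma>\<in>galois_group. \<sigma> (x i) \<noteq> x j))}"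

section \<open>Random elements of topological spaces\<close>

definition borel_of :: "'a topology \<Rightarrow> 'a measure" where
  "borel_of T = sigma (topspace T) {V. openin T V}"

definition random_element :: "'w measure \<Rightarrow> 'a topology \<Rightarrow> ('w \<Rightarrow> 'a) \<Rightarrow> bool" where
  "random_element M T Y \<longleftrightarrow> prob_space M \<and> Y \<in> measurable M (borel_of T)"

definition law :: "'w measure \<Rightarrow> 'a topology \<Rightarrow> ('w \<Rightarrow> 'a) \<Rightarrow> 'a measure" where
  "law M T Y = distr M (borel_of T) Y"

text \<open>Each random element may live on a probability space of its own.\<close>

definition converges_in_distribution ::
  "'a topology \<Rightarrow> (nat \<Rightarrow> 'v measure) \<Rightarrow> (nat \<Rightarrow> 'v \<Rightarrow> 'a) \<Rightarrow> 'w measure \<Rightarrow> ('w \<Rightarrow> 'a) \<Rightarrow> bool" where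
  "converges_in_distribution T M Y N L \<longleftrightarrow>
     (\<forall>n. random_element (M n) T (Y n)) \<and> random_element N T L \<and>
     (\<forall>f :: 'a \<Rightarrow> real. continuous_map T euclideanreal f \<and> bounded (f ` topspace T) \<longrightarrow>
        (\<lambda>n. \<integral>\<omega>. f (Y n \<omega>) \<partial>M n) \<longlonglongrightarrow> (\<integral>\<omega>. f (L \<omega>) \<partial>N))"

definition nat_infinity_topology :: "ereal topology" where
  "nat_infinity_topology = top_of_set (range ereal_of_enat)"

text \<open>This is the one-point compactification of the discrete space of natural numbers.\<close>

lemma openin_nat_infinity_topology:
  "openin nat_infinity_topology V \<longleftrightarrow>
     V \<subseteq> range ereal_of_enat \<and> (\<infinity> \<in> V \<longrightarrow> finite (range ereal_of_enat - V))"
proof safe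
  fix x
  assume V: "openin nat_infinity_topology V" and "x \<in> V"
  then show "x \<in> range ereal_of_enat"
    using openin_subset unfolding nat_infinity_topology_def by fastforce
next
  assume V: "openin nat_infinity_topology V" and inf: "\<infinity> \<in> V"
  then obtain T where T: "open T" "V = range ereal_of_enat \<inter> T"
    by (auto simp: nat_infinity_topology_def openin_open)
  then obtain r where r: "{ereal r<..} \<subseteq> T"
    using inf open_PInfty by blast
  have "range ereal_of_enat - V \<subseteq> (\<lambda>n. ereal_of_enat (enat n)) ` {..nat \<lfloor>r\<rfloor>}"
  proof
    fix x assume "x \<in> range ereal_of_enat - V"
    then obtain e where e: "x = ereal_of_enat e" "x \<notin> T" using T by auto
    show "x \<in> (\<lambda>n. ereal_of_enat (enat n)) ` {..nat \<lfloor>r\<rfloor>}"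
    proof (cases e)
      case (enat n)
      then have "ereal (real n) \<notin> T" using e by simp
      then have "ereal (real n) \<notin> {ereal r<..}" using r by blast
      then have "\<not> r < real n" by simp
      then have "n \<in> {..nat \<lfloor>r\<rfloor>}" by (simp add: le_nat_floor)
      then show ?thesis unfolding e(1) enat by (rule imageI)
    next
      case infinity
      then show ?thesis using e T inf by auto
    qed
  qed
  then show "finite (range ereal_of_enat - V)" by (rule finite_subset) simp
next
  assume V: "V \<subseteq> range ereal_of_enat" and "\<infinity> \<notin> V"
  have "openin nat_infinity_topology {x}" if "x \<in> V" for x
  proof -
    from V that obtain e where e: "x = ereal_of_enat e" by blast
    with that \<open>\<infinity> \<notin> V\<close> obtain n where n: "x = ereal (real n)" by (cases e) auto
    have "{x} = range ereal_of_enat \<inter> {ereal (real n - 1/2)<..<ereal (real n + 1/2)}"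
    proof safe
      show "x \<in> range ereal_of_enat" using V that by blast
    next
      show "x \<in> {ereal (real n - 1/2)<..<ereal (real n + 1/2)}" using n by simp
    next
      fix e' assume *: "ereal_of_enat e' \<in> {ereal (real n - 1/2)<..<ereal (real n + 1/2)}"
      show "ereal_of_enat e' = x"
      proof (cases e')
        case (enat k)
        then have "real n - 1/2 < real k" "real k < real n + 1/2" using * by auto
        then have "k = n" by linarith
        then show ?thesis using enat n by simp
      qed (use * in auto)
    qed
    then show ?thesis unfolding nat_infinity_topology_def openin_open
      by (intro exI conjI) auto
  qed
  then have "openin nat_infinity_topology (\<Union>x\<in>V. {x})" by (intro openin_Union) auto
  then show "openin nat_infinity_topology V" by simp
next
  assume V: "V \<subseteq> range ereal_of_enat" and "finite (range ereal_of_enat - V)"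
  then have "open (- (range ereal_of_enat - V))" by (intro open_Compl finite_imp_closed)
  moreover have "V = range ereal_of_enat \<inter> - (range ereal_of_enat - V)" using V by blast
  ultimately show "openin nat_infinity_topology V"
    unfolding nat_infinity_topology_def openin_open by (intro exI conjI)
qed

end

theory Submission
  imports Defs "Jordan_Normal_Form.Char_Poly"
begin

text \<open>For a fixed Z, the normalized absolute value of Res(P, Z) is a continuous function of P with
  values in [0,1]. It is multiplicative in Z, and these functions separate points: if G is the
  greatest common divisor of two polynomials GA and GB, then for Z = A + p^k with k large the
  resultants with Z differ. In the manner of Stone and Weierstrass, on the compact sets of
  polynomials of bounded degree the functions span a dense algebra. Hence their integrals determine
  a law, and with tightness their convergence gives weak convergence.

  By Krasner's lemma, the number of distinct roots of P does not drop under small perturbations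
  of P, and as long as it stays the same each root moves continuously within the field that it
  generates. So the count of root tuples is Borel, and it is locally constant at squarefree
  polynomials. It is at most the m-th power of the degree, so the moment condition provides the
  uniform integrability that the convergence of expectations needs.\<close>

hide_const (open) up_ring.coeff up_ring.monom module.smult Divisibility.irreducible
  Polynomials.lead_coeff Polynomials.degree Coset.order

section \<open>p-adic integers\<close>

text \<open>\<open>val\<close> is read off the constant coefficient of a minimal polynomial, which
  says nothing directly about sums and products. The way around is integrality: b val x \<ge> a
  holds exactly when x^b / p^a is integral, and the integral elements form a ring that contains x or
  1/x for every x. Multiplicativity of the absolute value and the ultrametric inequality follow from
  this; conjugates enter only as roots of minimal polynomials. On the side of probability, the
  resultant of two monic polynomials over Z_p lies in Z_p, so its norm is 0 or a power of 1/p.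
  Nonzero values are therefore isolated, their level sets are open and closed, and the density
  argument becomes one about indicators of such sets. Convergence of the measures of these sets is
  the central statement: Caratheodory's theorem turns it into a limit law, and applied to a sequence
  that alternates between two laws it gives uniqueness. The count of root tuples may jump where
  roots collide. The space is therefore stratified by the number of distinct roots, and squarefree
  polynomials form the strata where this number is as large as the degree allows.\<close>

abbreviation padic_p :: "'p::prime_card padic_int"
  where "padic_p \<equiv> of_nat CARD('p)"

lemma card_pos: "0 < int CARD('p::prime_card)"
  and card_gt_1: "1 < int CARD('p)"
  using prime_gt_1_nat[OF prime_card[where ?'a='p]] by simp_all

lemma digit_bounds: "0 \<le> Rep_padic_int x n" "Rep_padic_int x n < int CARD('p) ^ n"
  for x :: "'p::prime_card padic_int"
  using Rep_padic_int[of x] by auto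

lemma digit_mod:
  fixes x :: "'p::prime_card padic_int"
  shows "k \<le> n \<Longrightarrow> Rep_padic_int x n mod int CARD('p) ^ k = Rep_padic_int x k"
proof (induction n)
  case 0
  then show ?case using digit_bounds[of x 0] by simp
next
  case (Suc n)
  show ?case
  proof (cases "k = Suc n")
    case True
    then show ?thesis using digit_bounds[of x k] by (metis mod_pos_pos_trivial)
  next
    case False
    have "Rep_padic_int x (Suc n) mod int CARD('p) ^ n = Rep_padic_int x n"
      using Rep_padic_int[of x] by auto
    moreover have "int CARD('p) ^ k dvd int CARD('p) ^ n"
      using False Suc.prems by (intro le_imp_power_dvd) auto
    ultimately show ?thesis using Suc False by (metis le_Suc_eq mod_mod_cancel)
  qed
qed

lemma digit_of_nat:
  "Rep_padic_int (of_nat m :: 'p::prime_card padic_int) n = int m mod int CARD('p) ^ n"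
  by (induction m)
    (simp_all add: zero_padic_int.rep_eq one_padic_int.rep_eq plus_padic_int.rep_eq mod_simps add.commute)

lemma digit_p_power:
  "Rep_padic_int (padic_p ^ k :: 'p::prime_card padic_int) n = int CARD('p) ^ k mod int CARD('p) ^ n"
  by (metis digit_of_nat of_nat_power)

section \<open>Divisibility by powers of p, completeness and units\<close>

lemma digit_diff_eq_0_iff:
  fixes x y :: "'p::prime_card padic_int"
  shows "Rep_padic_int (x - y) n = 0 \<longleftrightarrow> Rep_padic_int x n = Rep_padic_int y n"
proof -
  have "Rep_padic_int (x - y) n = (Rep_padic_int x n - Rep_padic_int y n) mod int CARD('p) ^ n"
    by (simp only: minus_padic_int_def plus_padic_int.rep_eq uminus_padic_int.rep_eq mod_add_right_eq
        diff_conv_add_uminus)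
  also have "\<dots> = 0 \<longleftrightarrow> Rep_padic_int x n mod int CARD('p) ^ n = Rep_padic_int y n mod int CARD('p) ^ n"
    by (simp add: mod_eq_dvd_iff mod_eq_0_iff_dvd)
  finally show ?thesis by (simp add: digit_mod)
qed

text \<open>For the converse the quotient is written down residue by residue: its n-th residue is
  the (n + k)-th residue of x divided by p^k, the shift by k making up for the precision lost in the
  division.\<close>

lemma p_power_dvd_iff:
  fixes x :: "'p::prime_card padic_int"
  shows "padic_p ^ k dvd x \<longleftrightarrow> Rep_padic_int x k = 0"
proof
  assume "padic_p ^ k dvd x"
  then obtain y where "x = padic_p ^ k * y" by (elim dvdE)
  then show "Rep_padic_int x k = 0" by (simp add: times_padic_int.rep_eq digit_p_power)
next
  let ?p = "int CARD('p)"
  assume z: "Rep_padic_int x k = 0"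
  define h where "h n = Rep_padic_int x (n + k) div ?p ^ k" for n
  have h: "Rep_padic_int x (n + k) = ?p ^ k * h n" for n
    using digit_mod[of k "n + k" x] z unfolding h_def by (simp add: mod_eq_0_iff_dvd)
  have pk: "0 < ?p ^ k" using card_pos[where ?'p='p] by simp
  have "h n \<in> {0..<?p ^ n}" for n
    using digit_bounds[of x "n + k"] pk unfolding h power_add
    by (simp add: zero_le_mult_iff mult.commute)
  moreover have "h (Suc n) mod ?p ^ n = h n" for n
  proof -
    have "?p ^ k * (h (Suc n) mod ?p ^ n) = (?p ^ k * h (Suc n)) mod ?p ^ (n + k)"
      by (simp only: mult_mod_right power_add mult.commute)
    also have "\<dots> = ?p ^ k * h n" unfolding h[symmetric] by (rule digit_mod) simp
    finally have "?p ^ k * (h (Suc n) mod ?p ^ n) = ?p ^ k * h n" .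
    then show ?thesis using pk by simp
  qed
  ultimately have R: "Rep_padic_int (Abs_padic_int h :: 'p padic_int) = h"
    by (intro Abs_padic_int_inverse) auto
  have "x = (padic_p ^ k * Abs_padic_int h :: 'p padic_int)"
  proof (rule iffD1[OF Rep_padic_int_inject], rule ext)
    fix n
    have "Rep_padic_int x n = (?p ^ k * h n) mod ?p ^ n" using digit_mod[of n "n + k" x] h by simp
    then show "Rep_padic_int x n = Rep_padic_int (padic_p ^ k * Abs_padic_int h :: 'p padic_int) n"
      unfolding times_padic_int.rep_eq digit_p_power R mod_mult_left_eq by simp
  qed
  then show "padic_p ^ k dvd x" by simp
qed

lemma p_power_dvd_diff_iff:
  fixes x y :: "'p::prime_card padic_int"
  shows "padic_p ^ k dvd x - y \<longleftrightarrow> Rep_padic_int x k = Rep_padic_int y k"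
  by (simp add: p_power_dvd_iff digit_diff_eq_0_iff)

lemma p_power_dvd_all_imp_0:
  fixes x :: "'p::prime_card padic_int"
  assumes "\<And>k. padic_p ^ k dvd x"
  shows "x = 0"
  using assms unfolding p_power_dvd_iff
  by (intro iffD1[OF Rep_padic_int_inject]) (simp add: zero_padic_int.rep_eq fun_eq_iff)

text \<open>All terms from the n-th on agree modulo p^n, so the n-th residue of the limit can be
  read off \<open>s n\<close>.\<close>

lemma padic_int_complete:
  fixes s :: "nat \<Rightarrow> 'p::prime_card padic_int"
  assumes "\<And>n. padic_p ^ n dvd s (Suc n) - s n"
  obtains x where "\<And>n. padic_p ^ n dvd x - s n"
proof
  define h where "h n = Rep_padic_int (s n) n" for n
  have "h (Suc n) mod int CARD('p) ^ n = h n" for n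
    using digit_mod[of n "Suc n" "s (Suc n)"] assms[of n] by (simp add: p_power_dvd_diff_iff h_def)
  then have "Rep_padic_int (Abs_padic_int h :: 'p padic_int) = h"
    by (intro Abs_padic_int_inverse) (auto simp: h_def digit_bounds)
  then show "padic_p ^ n dvd Abs_padic_int h - s n" for n
    by (simp add: p_power_dvd_diff_iff h_def)
qed

lemma p_not_dvd_1: "\<not> padic_p dvd (1 :: 'p::prime_card padic_int)"
  using p_power_dvd_iff[of 1 "1 :: 'p padic_int"] card_gt_1[where ?'p='p]
  by (simp add: one_padic_int.rep_eq)

lemma p_power_neq_0: "padic_p ^ k \<noteq> (0 :: 'p::prime_card padic_int)"
proof
  assume "padic_p ^ k = (0 :: 'p padic_int)"
  then have "int CARD('p) ^ k mod int CARD('p) ^ Suc k = 0"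
    by (metis digit_p_power zero_padic_int.rep_eq)
  then show False using card_gt_1[where ?'p='p] by (simp add: mod_pos_pos_trivial)
qed

text \<open>The inverse of 1 - p w is the limit of the geometric series.\<close>

lemma p_not_dvd_imp_unit:
  fixes x :: "'p::prime_card padic_int"
  assumes "\<not> padic_p dvd x"
  shows "x dvd 1"
proof -
  let ?p = "int CARD('p)"
  have "Rep_padic_int x 1 \<noteq> 0" using assms p_power_dvd_iff[of 1 x] by simp
  then have "\<not> ?p dvd Rep_padic_int x 1" using digit_bounds[of x 1] zdvd_not_zless by fastforce
  then have "coprime (Rep_padic_int x 1) ?p"
    using prime_card_int[where ?'a='p] prime_imp_coprime coprime_commute by blast
  then obtain z where z: "[Rep_padic_int x 1 * z = 1] (mod ?p)"
    using cong_solve_coprime_int by blast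
  \<comment> \<open>An inverse of x modulo p brings x into the form 1 - p w.\<close>
  define y :: "'p padic_int" where "y = of_nat (nat (z mod ?p))"
  have "Rep_padic_int y 1 = z mod ?p" unfolding y_def digit_of_nat using card_pos[where ?'p='p] by simp
  then have "Rep_padic_int (x * y) 1 = Rep_padic_int 1 1"
    using z by (simp add: times_padic_int.rep_eq one_padic_int.rep_eq cong_def mod_simps)
  then have "padic_p dvd 1 - x * y" using p_power_dvd_diff_iff[of 1 1 "x * y"] by (metis power_one_right)
  then obtain w where w: "1 - x * y = padic_p * w" by (elim dvdE)
  define s where "s n = (\<Sum>i<n. (padic_p * w) ^ i)" for n
  obtain t where t: "\<And>n. padic_p ^ n dvd t - s n"
    by (rule padic_int_complete[of s]) (auto simp: s_def power_mult_distrib)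
  have "x * y * t - 1 = 0"
  proof (rule p_power_dvd_all_imp_0)
    fix k
    have "(1 - padic_p * w) * s k = 1 - (padic_p * w) ^ k"
      unfolding s_def by (metis one_diff_power_eq)
    moreover have "1 - padic_p * w = x * y" using w by (metis add_diff_cancel_left' diff_add_cancel diff_diff_eq2)
    ultimately have "x * y * s k = 1 - (padic_p * w) ^ k" by simp
    then have "x * y * t - 1 = (x * y) * (t - s k) - (padic_p * w) ^ k"
      by (simp add: right_diff_distrib)
    then show "padic_p ^ k dvd x * y * t - 1" using t[of k] by (simp add: power_mult_distrib)
  qed
  then show ?thesis by (intro dvdI[of _ _ "y * t"]) (simp add: mult.assoc)
qed

lemma padic_int_decompose:
  fixes x :: "'p::prime_card padic_int"
  assumes "x \<noteq> 0"
  obtains k u where "x = padic_p ^ k * u" "u dvd 1"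
proof -
  define n where "n = (LEAST n. \<not> padic_p ^ n dvd x)"
  have ex: "\<exists>n. \<not> padic_p ^ n dvd x" using p_power_dvd_all_imp_0 assms by blast
  have n: "\<not> padic_p ^ n dvd x" unfolding n_def using ex by (rule LeastI_ex)
  have "n \<noteq> 0" using n by (intro notI) simp
  then obtain k where k: "n = Suc k" by (cases n) auto
  then have "padic_p ^ k dvd x" using not_less_Least[of k "\<lambda>n. \<not> padic_p ^ n dvd x"] n_def by auto
  then obtain u where u: "x = padic_p ^ k * u" by (elim dvdE)
  with n k have "\<not> padic_p dvd u" by (auto simp: mult.commute mult_dvd_mono)
  then show thesis using that u p_not_dvd_imp_unit by blast
qed

lemma unit_imp_not_p_dvd: "u dvd 1 \<Longrightarrow> \<not> padic_p dvd (u :: 'p::prime_card padic_int)"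
  using p_not_dvd_1 dvd_trans by blast

section \<open>The residue map as a ring homomorphism\<close>

lemma residue_mod_p_eq_iff:
  fixes x y :: "'p::prime_card padic_int"
  shows "residue_mod_p x = residue_mod_p y \<longleftrightarrow> padic_p dvd x - y"
proof -
  have "Rep_padic_int z 1 = to_int_mod_ring (residue_mod_p z)" for z :: "'p padic_int"
    using digit_bounds[of z 1] by (simp add: residue_mod_p.rep_eq)
  then have "residue_mod_p x = residue_mod_p y \<longleftrightarrow> Rep_padic_int x 1 = Rep_padic_int y 1"
    by (metis of_int_mod_ring_to_int_mod_ring)
  then show ?thesis using p_power_dvd_diff_iff[of 1 x y] by simp
qed

lemma residue_mod_p_eq_0_iff: "residue_mod_p x = 0 \<longleftrightarrow> padic_p dvd (x :: 'p::prime_card padic_int)"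
proof -
  have "residue_mod_p (0 :: 'p padic_int) = 0"
    by (simp add: residue_mod_p.rep_eq zero_padic_int.rep_eq)
  then show ?thesis using residue_mod_p_eq_iff[of x 0] by simp
qed

lemma of_int_mod_ring_mod [simp]: "of_int_mod_ring (z mod int CARD('p)) = (of_int_mod_ring z :: 'p::prime_card mod_ring)"
  unfolding of_int_of_int_mod_ring[symmetric]
  by (metis mod_mod_trivial of_int_mod_ring.rep_eq of_int_of_int_mod_ring Rep_mod_ring_inject)

interpretation residue_mod_p: comm_ring_hom "residue_mod_p :: 'p::prime_card padic_int \<Rightarrow> 'p mod_ring"
proof
  fix x y :: "'p padic_int"
  show "residue_mod_p 0 = (0 :: 'p mod_ring)" by (simp add: residue_mod_p_eq_0_iff)
  show "residue_mod_p 1 = (1 :: 'p mod_ring)"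
    unfolding residue_mod_p.rep_eq one_padic_int.rep_eq power_one_right of_int_mod_ring_mod
    by (simp flip: of_int_of_int_mod_ring)
  show "residue_mod_p (x + y) = residue_mod_p x + residue_mod_p y"
    unfolding residue_mod_p.rep_eq plus_padic_int.rep_eq power_one_right of_int_mod_ring_mod
    by (simp flip: of_int_of_int_mod_ring)
  show "residue_mod_p (x * y) = residue_mod_p x * residue_mod_p y"
    unfolding residue_mod_p.rep_eq times_padic_int.rep_eq power_one_right of_int_mod_ring_mod
    by (simp flip: of_int_of_int_mod_ring)
qed

lemma residue_mod_p_surj: "\<exists>x. residue_mod_p x = (a :: 'p::prime_card mod_ring)"
proof
  have "Rep_padic_int (of_nat (nat (to_int_mod_ring a)) :: 'p padic_int) 1 = to_int_mod_ring a"
  proof -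
    have "to_int_mod_ring a \<in> {0..<int CARD('p)}" using range_to_int_mod_ring[where ?'a='p] by blast
    then show ?thesis unfolding digit_of_nat by simp
  qed
  then show "residue_mod_p (of_nat (nat (to_int_mod_ring a))) = a"
    by (simp add: residue_mod_p.rep_eq)
qed

section \<open>Integral elements of the algebraic closure\<close>

text \<open>Degree bounds are expressed by vanishing coefficients: this covers the zero polynomial
  without a case distinction, and it is a condition that survives p-adic limits.\<close>

lemma monic_division:
  fixes f g :: "'a::comm_ring_1 poly"
  assumes g: "coeff g s = 1" "\<And>i. i > s \<Longrightarrow> coeff g i = 0"
    and f: "\<And>i. i \<ge> n + s \<Longrightarrow> coeff f i = 0"
  obtains q r where "f = g * q + r" "\<And>i. i \<ge> n \<Longrightarrow> coeff q i = 0" "\<And>i. i \<ge> s \<Longrightarrow> coeff r i = 0"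
  using f
proof (induction n arbitrary: f thesis)
  case 0
  show ?case by (rule "0.prems"(1)[of 0 f]) (use "0.prems"(2) in auto)
next
  case (Suc n)
  define f' where "f' = f - monom (coeff f (n + s)) n * g"
  have "coeff f' i = 0" if "i \<ge> n + s" for i
  proof (cases "i = n + s")
    case True
    then show ?thesis using g by (simp add: f'_def coeff_monom_mult)
  next
    case False
    then have "coeff g (i - n) = 0" "coeff f i = 0" using that g Suc.prems(2)[of i] by auto
    then show ?thesis by (simp add: f'_def coeff_monom_mult)
  qed
  then obtain q r where qr: "f' = g * q + r" "\<And>i. i \<ge> n \<Longrightarrow> coeff q i = 0"
    "\<And>i. i \<ge> s \<Longrightarrow> coeff r i = 0" using Suc.IH[of f'] by blast
  show ?case
  proof (rule Suc.prems(1))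
    show "f = g * (q + monom (coeff f (n + s)) n) + r"
      using qr(1) by (simp add: f'_def algebra_simps)
  qed (use qr in auto)
qed

text \<open>The common bound n makes the coefficientwise limit a polynomial again.\<close>

lemma padic_poly_complete:
  fixes P :: "nat \<Rightarrow> 'p::prime_card padic_int poly"
  assumes P: "\<And>k. [:padic_p ^ k:] dvd P (Suc k) - P k" and n: "\<And>k i. i \<ge> n \<Longrightarrow> coeff (P k) i = 0"
  obtains L where "\<And>k. [:padic_p ^ k:] dvd L - P k" "\<And>i. i \<ge> n \<Longrightarrow> coeff L i = 0"
proof -
  have "\<exists>l. \<forall>k. padic_p ^ k dvd l - coeff (P k) i" for i
    using padic_int_complete[of "\<lambda>k. coeff (P k) i"] P by (metis coeff_diff const_poly_dvd_iff)
  then obtain l where l: "\<And>i k. padic_p ^ k dvd l i - coeff (P k) i" by metis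
  define L where "L = (\<Sum>i<n. monom (l i) i)"
  have L: "coeff L i = (if i < n then l i else 0)" for i
    by (simp add: L_def coeff_sum coeff_monom if_distrib sum.delta cong: if_cong)
  show thesis
  proof
    show "[:padic_p ^ k:] dvd L - P k" for k
      unfolding const_poly_dvd_iff using l n by (auto simp: L)
  qed (simp add: L)
qed

lemma dvd_p_power_const_poly_all_imp_0:
  fixes f :: "'p::prime_card padic_int poly"
  assumes "\<And>k. [:padic_p ^ k:] dvd f"
  shows "f = 0"
proof (rule poly_eqI)
  have "padic_p ^ k dvd coeff f n" for k n using assms[of k] unfolding const_poly_dvd_iff by blast
  then show "coeff f n = coeff 0 n" for n using p_power_dvd_all_imp_0[of "coeff f n"] by simp
qed

text \<open>The factor g is the limit of an iteration that replaces (g, q) by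
  (g + r / u, q + a), where f - g q = g a + r and u is the constant to which q reduces.\<close>

lemma weierstrass_factor:
  fixes f :: "'p::prime_card padic_int poly"
  assumes fs: "\<not> padic_p dvd coeff f s" and gt: "\<And>i. i > s \<Longrightarrow> padic_p dvd coeff f i"
  obtains g q where "f = g * q" "lead_coeff g = 1" "\<not> padic_p dvd coeff q 0"
proof -
  define u where "u = coeff f s"
  obtain v where v: "u * v = 1" using p_not_dvd_imp_unit[OF fs] unfolding u_def by (metis dvdE)
  define n where "n = Suc (degree f)"
  have n: "coeff f i = 0" if "i \<ge> n + s" for i using that by (intro coeff_eq_0) (simp add: n_def)
  define I where "I k gq \<longleftrightarrow> coeff (fst gq) s = 1 \<and> (\<forall>i>s. coeff (fst gq) i = 0) \<and>
    (\<forall>i\<ge>n. coeff (snd gq) i = 0) \<and> [:padic_p:] dvd snd gq - [:u:] \<and>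
    [:padic_p ^ Suc k:] dvd f - fst gq * snd gq" for k gq
  \<comment> \<open>Modulo p, f is its own truncation after degree s. Scaling by v, the inverse of
    the coefficient u, makes the truncation monic, with the constant u as cofactor.\<close>
  have base: "\<exists>gq. I 0 gq"
  proof
    have "v * u = 1" using v by (simp add: mult.commute)
    moreover have "padic_p dvd coeff f i - coeff (poly_cutoff (Suc s) (smult v f)) i * u" for i
    proof (cases "i \<le> s")
      case True
      have "v * coeff f i * u = coeff f i" using v by (metis mult.assoc mult.commute mult.right_neutral)
      moreover have "coeff (poly_cutoff (Suc s) (smult v f)) i = v * coeff f i"
        using True by (simp add: coeff_poly_cutoff)
      ultimately show ?thesis by (metis diff_self dvd_0_right)
    qed (use gt in \<open>simp add: coeff_poly_cutoff\<close>)
    then have "[:padic_p:] dvd f - poly_cutoff (Suc s) (smult v f) * [:u:]"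
      unfolding const_poly_dvd_iff by (simp add: mult.commute)
    ultimately show "I 0 (poly_cutoff (Suc s) (smult v f), [:u:])"
      by (auto simp: I_def coeff_poly_cutoff n_def coeff_pCons u_def split: nat.splits)
  qed
  have step: "\<exists>gq'. I (Suc k) gq' \<and> [:padic_p ^ Suc k:] dvd fst gq' - fst gq \<and>
      [:padic_p ^ Suc k:] dvd snd gq' - snd gq" if "I k gq" for k gq
  proof -
    obtain g q where gq: "gq = (g, q)" by (cases gq)
    have g: "coeff g s = 1" "\<And>i. i > s \<Longrightarrow> coeff g i = 0" and q: "\<And>i. i \<ge> n \<Longrightarrow> coeff q i = 0"
      and qu: "[:padic_p:] dvd q - [:u:]" and dvd: "[:padic_p ^ Suc k:] dvd f - g * q"
      using that by (auto simp: I_def gq)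
    define P where "P = (padic_p ^ Suc k :: 'p padic_int)"
    obtain e where "f - g * q = [:P:] * e" using dvd by (auto simp: P_def elim: dvdE)
    then have e: "f = g * q + smult P e" by (simp add: algebra_simps)
    have "coeff e i = 0" if "i \<ge> n + s" for i
    proof -
      have "degree g \<le> s" "degree q \<le> n - 1" using g q by (auto intro!: degree_le simp: n_def)
      then have "degree (g * q) < i" using degree_mult_le[of g q] that by (simp add: n_def)
      then have "coeff (smult P e) i = 0" using n[OF that] e by (metis coeff_add coeff_eq_0 add_0)
      moreover have "P \<noteq> 0" unfolding P_def by (rule p_power_neq_0)
      ultimately show ?thesis by simp
    qed
    then obtain a r where ar: "e = g * a + r" "\<And>i. i \<ge> n \<Longrightarrow> coeff a i = 0"
      "\<And>i. i \<ge> s \<Longrightarrow> coeff r i = 0"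
      using monic_division[OF g, of n e] by metis
    define g' where "g' = g + smult (P * v) r"
    define q' where "q' = q + smult P a"
    obtain w where w: "q - [:u:] = [:padic_p:] * w" using qu by (elim dvdE)
    then have w': "q = [:u:] + smult padic_p w" by (simp add: algebra_simps)
    \<comment> \<open>Both terms gain a factor p over P: the first because q reduces to the constant
      u, so that 1 - v q is divisible by p, the second because P itself is a positive power of
      p.\<close>
    have "f - g' * q' = smult P (r * (1 - smult v q)) - smult (P * P) (smult v (r * a))"
    proof -
      have "g * q + C * (g * a + r) - (g + C * V * r) * (q + C * a)
        = C * (r * (1 - V * q)) - C * C * (V * (r * a))" for C V
        by (simp add: algebra_simps)
      note id = this
      have conv: "[:c:] * x = smult c x" for c and x :: "'p padic_int poly" by simp
      show ?thesis unfolding e ar(1) g'_def q'_def smult_smult[symmetric]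
        using id[of "[:P:]" "[:v:]"] unfolding mult.assoc unfolding conv by blast
    qed
    also have "1 - smult v q = smult padic_p (- smult v w)"
    proof -
      have "smult v [:u:] = 1" using v by (simp add: mult.commute one_pCons)
      then show ?thesis unfolding w' by (simp add: smult_add_right mult.commute)
    qed
    finally have "f - g' * q' = [:P * padic_p:] * (- (r * smult v w) - [:padic_p ^ k:] * smult v (r * a))"
      by (simp add: algebra_simps P_def smult_diff_right)
    then have "[:P * padic_p:] dvd f - g' * q'" by (metis dvd_triv_left)
    then have 1: "[:padic_p ^ Suc (Suc k):] dvd f - g' * q'" by (simp add: P_def mult.commute)
    have "q' - [:u:] = [:padic_p:] * (w + [:padic_p ^ k:] * a)"
      using w by (simp add: q'_def P_def algebra_simps smult_add_right)
    then have 2: "[:padic_p:] dvd q' - [:u:]" by (metis dvd_triv_left)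
    have "I (Suc k) (g', q')"
      using 1 2 g q ar(2,3) by (simp add: I_def g'_def q'_def)
    moreover have "[:P:] dvd g' - g" "[:P:] dvd q' - q"
      by (simp_all add: g'_def q'_def const_poly_dvd_iff)
    ultimately show ?thesis by (intro exI[of _ "(g', q')"]) (simp add: gq P_def)
  qed
  obtain h where h: "\<And>k. I k (h k)" "\<And>k. [:padic_p ^ Suc k:] dvd fst (h (Suc k)) - fst (h k)"
      "\<And>k. [:padic_p ^ Suc k:] dvd snd (h (Suc k)) - snd (h k)"
    using dependent_nat_choice[of I "\<lambda>k gq gq'. [:padic_p ^ Suc k:] dvd fst gq' - fst gq \<and>
      [:padic_p ^ Suc k:] dvd snd gq' - snd gq"] base step by blast
  have weaken: "[:padic_p ^ k:] dvd x" if "[:padic_p ^ Suc k:] dvd x" for x :: "'p padic_int poly" and k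
    using that unfolding const_poly_dvd_iff by (metis dvd_mult_right power_Suc)
  obtain g where g: "\<And>k. [:padic_p ^ k:] dvd g - fst (h k)" "\<And>i. i \<ge> Suc s \<Longrightarrow> coeff g i = 0"
    by (rule padic_poly_complete[of "\<lambda>k. fst (h k)" "Suc s"]) (use h weaken in \<open>auto simp: I_def\<close>)
  obtain q where q: "\<And>k. [:padic_p ^ k:] dvd q - snd (h k)" "\<And>i. i \<ge> n \<Longrightarrow> coeff q i = 0"
    by (rule padic_poly_complete[of "\<lambda>k. snd (h k)" n]) (use h weaken in \<open>auto simp: I_def\<close>)
  have "f - g * q = 0"
  proof (rule dvd_p_power_const_poly_all_imp_0)
    fix k
    have "f - g * q = (f - fst (h k) * snd (h k)) - (g - fst (h k)) * q - fst (h k) * (q - snd (h k))"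
      by (simp add: algebra_simps)
    moreover have "[:padic_p ^ k:] dvd f - fst (h k) * snd (h k)"
      using h(1)[of k] weaken unfolding I_def by blast
    ultimately show "[:padic_p ^ k:] dvd f - g * q"
      using dvd_diff[OF dvd_diff[OF _ dvd_mult2[OF g(1)]] dvd_mult[OF q(1)]] by metis
  qed
  moreover have "coeff g s - 1 = 0"
  proof (rule p_power_dvd_all_imp_0)
    show "padic_p ^ k dvd coeff g s - 1" for k
      using g(1)[of k] h(1)[of k] unfolding const_poly_dvd_iff I_def by (metis coeff_diff)
  qed
  then have "lead_coeff g = 1"
  proof -
    have "degree g \<le> s" using g(2) by (intro degree_le) auto
    moreover have "s \<le> degree g" using \<open>coeff g s - 1 = 0\<close> by (intro le_degree) auto
    ultimately show ?thesis using \<open>coeff g s - 1 = 0\<close> by simp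
  qed
  moreover have "\<not> padic_p dvd coeff q 0"
  proof
    assume "padic_p dvd coeff q 0"
    moreover have "padic_p dvd coeff q 0 - coeff (snd (h 1)) 0"
      using q(1)[of 1] unfolding const_poly_dvd_iff by (metis coeff_diff power_one_right)
    moreover have "padic_p dvd coeff (snd (h 1)) 0 - u"
      using h(1)[of 1] unfolding const_poly_dvd_iff I_def by (metis coeff_diff coeff_pCons_0)
    ultimately have "padic_p dvd coeff q 0 - (coeff q 0 - coeff (snd (h 1)) 0) - (coeff (snd (h 1)) 0 - u)"
      by (meson dvd_diff)
    then show False using fs by (simp add: u_def)
  qed
  ultimately show thesis using that[of g q] by simp
qed

section \<open>The inclusion of Z_p and the valuation ring property\<close>

interpretation to_fract: inj_idom_hom "to_fract :: 'a::idom \<Rightarrow> 'a fract"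
  by unfold_locales simp_all

interpretation map_poly_to_fract: map_poly_inj_idom_hom "to_fract :: 'a::idom \<Rightarrow> 'a fract" ..

interpretation to_ac: field_hom "to_ac :: 'a::field \<Rightarrow> 'a alg_closure"
  by unfold_locales simp_all

interpretation map_poly_to_ac: map_poly_inj_idom_hom "to_ac :: 'a::field \<Rightarrow> 'a alg_closure" ..

definition embed :: "'p::prime_card padic_int \<Rightarrow> 'p padic_closure"
  where "embed z = to_ac (to_fract z)"

interpretation embed: inj_idom_hom "embed :: 'p::prime_card padic_int \<Rightarrow> 'p padic_closure"
  by unfold_locales (simp_all add: embed_def)

interpretation map_poly_embed: map_poly_inj_idom_hom "embed :: 'p::prime_card padic_int \<Rightarrow> 'p padic_closure" ..

lemma lift_poly_embed: "lift_poly P = map_poly embed P"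
  by (intro poly_eqI) (simp add: embed_def coeff_map_poly)

lemma integral_iff: "x \<in> algebraic_integers \<longleftrightarrow> (\<exists>Q. lead_coeff Q = 1 \<and> poly (map_poly embed Q) x = 0)"
  by (simp add: algebraic_integers_def lift_poly_embed)

text \<open>A denominator is a power of p times a unit, and the unit can be moved to the
  numerator.\<close>

lemma to_fract_decompose:
  fixes q :: "'p::prime_card padic"
  obtains k a where "to_fract padic_p ^ k * q = to_fract a"
proof -
  obtain a b where ab: "q = to_fract a / to_fract b" "b \<noteq> 0"
    by (metis Fract_conv_to_fract Fract_cases)
  obtain k u where ku: "b = padic_p ^ k * u" "u dvd 1" using padic_int_decompose[OF ab(2)] .
  obtain w where w: "u * w = 1" using ku(2) by (metis dvdE)
  have "to_fract padic_p ^ k * q * to_fract u = to_fract a"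
  proof -
    have "to_fract padic_p ^ k \<noteq> (0 :: 'p padic)" "to_fract u \<noteq> 0"
      using ab(2) unfolding ku(1) by (auto simp flip: to_fract.hom_power)
    moreover have "A * (x / (A * U)) * U = x" if "A \<noteq> 0" "U \<noteq> 0" for A x U :: "'p padic"
      using that by (simp add: field_simps)
    ultimately show ?thesis unfolding ab(1) ku(1) to_fract.hom_mult to_fract.hom_power by blast
  qed
  then have "to_fract padic_p ^ k * q * (to_fract u * to_fract w) = to_fract (a * w)"
    by (simp add: mult.assoc[symmetric])
  then show thesis using that[of k "a * w"] w by (metis to_fract.hom_mult to_fract.hom_one mult.right_neutral)
qed

lemma clear_denominators:
  fixes P :: "'p::prime_card padic poly"
  obtains k f where "smult (to_fract padic_p ^ k) P = map_poly to_fract f"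
proof (induction P arbitrary: thesis)
  case 0
  show ?case by (rule 0[of 0 0]) simp
next
  case (pCons q P)
  obtain k f where kf: "smult (to_fract padic_p ^ k) P = map_poly to_fract f" using pCons.IH by blast
  obtain l a where la: "to_fract padic_p ^ l * q = to_fract a" using to_fract_decompose .
  show ?case
  proof (rule pCons.prems)
    have "smult (to_fract padic_p ^ (k + l)) (pCons q P)
      = pCons (to_fract padic_p ^ k * (to_fract padic_p ^ l * q))
          (smult (to_fract padic_p ^ l) (smult (to_fract padic_p ^ k) P))"
      by (simp add: power_add mult_ac)
    also have "\<dots> = map_poly to_fract (pCons (padic_p ^ k * a) (smult (padic_p ^ l) f))"
      unfolding kf la by (simp add: to_fract.map_poly_pCons_hom to_fract.map_poly_hom_smult to_fract.hom_power to_fract.hom_mult)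
    finally show "smult (to_fract padic_p ^ (k + l)) (pCons q P) =
      map_poly to_fract (pCons (padic_p ^ k * a) (smult (padic_p ^ l) f))" .
  qed
qed

lemma primitive_part:
  fixes f :: "'p::prime_card padic_int poly"
  assumes "f \<noteq> 0"
  obtains k g where "f = smult (padic_p ^ k) g" "\<not> [:padic_p:] dvd g"
proof -
  define n where "n = (LEAST n. \<not> [:padic_p ^ n:] dvd f)"
  have ex: "\<exists>n. \<not> [:padic_p ^ n:] dvd f" using dvd_p_power_const_poly_all_imp_0 assms by blast
  have n: "\<not> [:padic_p ^ n:] dvd f" unfolding n_def using ex by (rule LeastI_ex)
  have "n \<noteq> 0" using n by (intro notI) (simp add: one_pCons[symmetric])
  then obtain k where k: "n = Suc k" by (cases n) auto
  then have "[:padic_p ^ k:] dvd f" using not_less_Least[of k "\<lambda>n. \<not> [:padic_p ^ n:] dvd f"] n_def by auto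
  then obtain g where g: "f = [:padic_p ^ k:] * g" by (elim dvdE)
  have "\<not> [:padic_p:] dvd g"
  proof
    assume "[:padic_p:] dvd g"
    then obtain h where "g = [:padic_p:] * h" by (elim dvdE)
    then have "f = [:padic_p ^ n:] * h" using g k by (simp add: mult.commute)
    then show False using n by (metis dvd_triv_left)
  qed
  then show thesis using that[of k g] g by simp
qed

lemma map_poly_embed_reflect:
  "map_poly embed (reflect_poly q) = reflect_poly (map_poly embed q)"
  by (intro poly_eqI) (simp add: coeff_reflect_poly)

text \<open>This makes the integral elements a valuation ring, and it takes the place of Hensel's
  lemma. A primitive polynomial with root x is factored at its last coefficient prime to p: either x
  is a root of the monic factor, or it is a root of the factor with unit constant term, whose
  reversal, scaled by a unit, is monic and vanishes at 1/x.\<close>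

theorem integral_or_inverse_integral:
  fixes x :: "'p::prime_card padic_closure"
  shows "x \<in> algebraic_integers \<or> inverse x \<in> algebraic_integers"
proof (cases "x = 0")
  case True
  then show ?thesis unfolding integral_iff
    by (intro disjI1 exI[of _ "[:0, 1:]"]) (simp add: embed.map_poly_pCons_hom)
next
  case x0: False
  obtain P :: "'p padic poly" where P: "P \<noteq> 0" "poly (map_poly to_ac P) x = 0"
    using alg_closure_algebraic .
  obtain k f where kf: "smult (to_fract padic_p ^ k) P = map_poly to_fract f"
    using clear_denominators .
  have pk: "to_fract (padic_p :: 'p padic_int) ^ k \<noteq> 0"
    using p_power_neq_0[of k] by (metis to_fract.hom_power to_fract_eq_0_iff)
  have "f \<noteq> 0" using P(1) kf pk by auto
  then obtain l g where lg: "f = smult (padic_p ^ l) g" "\<not> [:padic_p:] dvd g"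
    using primitive_part by blast
  have "poly (map_poly embed f) x = 0"
  proof -
    have "map_poly embed f = smult (to_ac (to_fract padic_p ^ k)) (map_poly to_ac P)"
      unfolding lift_poly_embed[symmetric] kf[symmetric] by (simp add: to_ac.map_poly_hom_smult)
    then show ?thesis using P(2) by simp
  qed
  then have gx: "poly (map_poly embed g) x = 0"
  proof -
    have "embed (padic_p ^ l) \<noteq> (0 :: 'p padic_closure)" using p_power_neq_0 embed.hom_0_iff by blast
    then show "poly (map_poly embed f) x = 0 \<Longrightarrow> ?thesis"
      unfolding lg embed.map_poly_hom_smult poly_smult by (metis mult_eq_0_iff)
  qed
  define s where "s = Max {i. \<not> padic_p dvd coeff g i}"
  have "{i. \<not> padic_p dvd coeff g i} \<subseteq> {..degree g}" by (auto intro: le_degree)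
  then have fin: "finite {i. \<not> padic_p dvd coeff g i}" using finite_subset by blast
  have ne: "{i. \<not> padic_p dvd coeff g i} \<noteq> {}" using lg(2) by (auto simp: const_poly_dvd_iff)
  have s: "\<not> padic_p dvd coeff g s" using Max_in[OF fin ne] by (simp add: s_def)
  have "padic_p dvd coeff g i" if "i > s" for i
    using Max_ge[OF fin, of i] that unfolding s_def by fastforce
  then obtain h q where hq: "g = h * q" "lead_coeff h = 1" "\<not> padic_p dvd coeff q 0"
    using weierstrass_factor[OF s] by blast
  have "poly (map_poly embed h) x = 0 \<or> poly (map_poly embed q) x = 0"
    using gx by (simp add: hq(1) map_poly_embed.hom_mult)
  then show ?thesis
  proof
    assume "poly (map_poly embed h) x = 0"
    then show ?thesis using hq(2) unfolding integral_iff by blast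
  next
    assume qx: "poly (map_poly embed q) x = 0"
    obtain w where w: "coeff q 0 * w = 1" using p_not_dvd_imp_unit[OF hq(3)] by (metis dvdE)
    have c0: "coeff q 0 \<noteq> 0" using hq(3) by auto
    have "lead_coeff (smult w (reflect_poly q)) = 1"
    proof -
      have "lead_coeff (reflect_poly q) = coeff q 0" using c0 by (simp add: coeff_reflect_poly)
      then show ?thesis using w unfolding lead_coeff_smult by (simp add: mult.commute)
    qed
    moreover have "poly (map_poly embed (smult w (reflect_poly q))) (inverse x) = 0"
      using qx x0 by (simp add: embed.map_poly_hom_smult map_poly_embed_reflect poly_reflect_poly_nz)
    ultimately show ?thesis unfolding integral_iff by blast
  qed
qed

section \<open>The ring of integral elements\<close>

definition int_span :: "'p::prime_card padic_closure set \<Rightarrow> 'p padic_closure set"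
  where "int_span B = range (\<lambda>c. \<Sum>b\<in>B. embed (c b) * b)"

lemma int_span_add: "x \<in> int_span B \<Longrightarrow> y \<in> int_span B \<Longrightarrow> x + y \<in> int_span B"
proof -
  assume "x \<in> int_span B" "y \<in> int_span B"
  then obtain c d where "x = (\<Sum>b\<in>B. embed (c b) * b)" "y = (\<Sum>b\<in>B. embed (d b) * b)"
    by (auto simp: int_span_def)
  then have "x + y = (\<Sum>b\<in>B. embed (c b + d b) * b)"
    by (simp add: sum.distrib embed.hom_add distrib_right)
  then show ?thesis unfolding int_span_def by (intro range_eqI[of _ _ "\<lambda>b. c b + d b"]) simp
qed

lemma int_span_scale: "x \<in> int_span B \<Longrightarrow> embed a * x \<in> int_span B"
proof -
  assume "x \<in> int_span B"
  then obtain c where "x = (\<Sum>b\<in>B. embed (c b) * b)" by (auto simp: int_span_def)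
  then have "embed a * x = (\<Sum>b\<in>B. embed (a * c b) * b)"
    by (simp add: sum_distrib_left embed.hom_mult mult.assoc)
  then show ?thesis unfolding int_span_def by (intro range_eqI[of _ _ "\<lambda>b. a * c b"]) simp
qed

lemma int_span_0: "0 \<in> int_span B"
  unfolding int_span_def by (rule range_eqI[of _ _ "\<lambda>_. 0"]) simp

lemma int_span_base: "finite B \<Longrightarrow> b \<in> B \<Longrightarrow> b \<in> int_span B"
  unfolding int_span_def
  by (rule range_eqI[of _ _ "\<lambda>b'. if b' = b then 1 else 0"])
    (simp add: if_distrib[of embed] if_distrib[of "\<lambda>x. x * _"] sum.delta cong: if_cong)

lemma int_span_sum: "(\<And>i. i \<in> I \<Longrightarrow> f i \<in> int_span B) \<Longrightarrow> sum f I \<in> int_span B"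
  by (induction I rule: infinite_finite_induct) (auto intro: int_span_0 int_span_add)

lemma int_span_mult_closed:
  assumes "\<And>b. b \<in> B \<Longrightarrow> u * b \<in> int_span B" and "x \<in> int_span B"
  shows "u * x \<in> int_span B"
proof -
  obtain c where "x = (\<Sum>b\<in>B. embed (c b) * b)" using assms(2) by (auto simp: int_span_def)
  then have "u * x = (\<Sum>b\<in>B. embed (c b) * (u * b))"
    by (simp add: sum_distrib_left mult_ac)
  then show ?thesis using assms(1) by (auto intro!: int_span_sum int_span_scale)
qed

text \<open>The determinant trick: multiplication by u acts on B through a matrix over Z_p, the
  vector of all elements of B is an eigenvector for u, and u is a root of the monic characteristic
  polynomial. The element b0 keeps this vector from being zero.\<close>

lemma integral_if_int_span_stable:
  fixes u :: "'p::prime_card padic_closure"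
  assumes B: "finite B" "b0 \<in> B" "b0 \<noteq> 0" and u: "\<And>b. b \<in> B \<Longrightarrow> u * b \<in> int_span B"
  shows "u \<in> algebraic_integers"
proof -
  define N where "N = card B"
  obtain w where w: "bij_betw w {0..<N} B" using ex_bij_betw_nat_finite[OF B(1)] by (auto simp: N_def)
  have "\<forall>b\<in>B. \<exists>c. u * b = (\<Sum>b'\<in>B. embed (c b') * b')" using u by (auto simp: int_span_def)
  from bchoice[OF this] obtain C where C: "\<And>b. b \<in> B \<Longrightarrow> u * b = (\<Sum>b'\<in>B. embed (C b b') * b')"
    by blast
  define A where "A = mat N N (\<lambda>(i, j). C (w i) (w j))"
  define v where "v = vec N w"
  have A: "A \<in> carrier_mat N N" by (simp add: A_def)
  have A': "map_mat embed A \<in> carrier_mat N N" by (simp add: A_def)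
  have "map_mat embed A *\<^sub>v v = u \<cdot>\<^sub>v v"
  proof (rule eq_vecI)
    fix i assume "i < dim_vec (u \<cdot>\<^sub>v v)"
    then have i: "i < N" by (simp add: v_def)
    then have wi: "w i \<in> B" using w by (auto simp: bij_betw_def)
    have "(map_mat embed A *\<^sub>v v) $ i = (\<Sum>j = 0..<N. embed (C (w i) (w j)) * w j)"
      using i by (simp add: A_def v_def scalar_prod_def)
    also have "\<dots> = (\<Sum>b'\<in>B. embed (C (w i) b') * b')"
      by (rule sum.reindex_bij_betw[OF w])
    also have "\<dots> = (u \<cdot>\<^sub>v v) $ i" using C[OF wi] i by (simp add: v_def)
    finally show "(map_mat embed A *\<^sub>v v) $ i = (u \<cdot>\<^sub>v v) $ i" .
  qed (simp add: A_def v_def)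
  moreover have "v \<noteq> 0\<^sub>v N"
  proof
    assume 0: "v = 0\<^sub>v N"
    obtain i where i: "i < N" "w i = b0" using w B(2) by (auto simp: bij_betw_def)
    then have "v $ i = b0" by (simp add: v_def)
    then show False using 0 B(3) i by simp
  qed
  ultimately have "eigenvector (map_mat embed A) v u"
    by (simp add: eigenvector_def v_def A_def)
  then have "eigenvalue (map_mat embed A) u" by (auto simp: eigenvalue_def)
  then have "poly (char_poly (map_mat embed A)) u = 0"
    using eigenvalue_root_char_poly[OF A'] by blast
  then have "poly (map_poly embed (char_poly A)) u = 0"
    using embed.char_poly_hom[OF A] by simp
  moreover have "lead_coeff (char_poly A) = 1" using degree_monic_char_poly[OF A] by simp
  ultimately show ?thesis unfolding integral_iff by blast
qed

lemma integral_power_reduction: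
  assumes "lead_coeff f = 1" "poly (map_poly embed f) x = 0"
  shows "x ^ degree f = (\<Sum>i<degree f. embed (- coeff f i) * x ^ i)"
proof -
  have "(\<Sum>i<degree f. embed (coeff f i) * x ^ i) + x ^ degree f = 0"
    using assms by (simp add: poly_altdef lessThan_Suc_atMost[symmetric])
  then have "x ^ degree f = - (\<Sum>i<degree f. embed (coeff f i) * x ^ i)"
    by (rule iffD1[OF add_eq_0_iff])
  then show ?thesis by (simp add: sum_negf embed.hom_uminus)
qed

lemma integral_power_span:
  assumes "lead_coeff f = 1" "poly (map_poly embed f) x = 0" "i < degree f"
    and B: "finite B" "\<And>i. i < degree f \<Longrightarrow> x ^ i * z \<in> B"
  shows "x * (x ^ i * z) \<in> int_span B"
proof (cases "Suc i < degree f")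
  case True
  then show ?thesis using int_span_base[OF B(1) B(2)[of "Suc i"]] by (simp add: mult_ac)
next
  case False
  then have "x * (x ^ i * z) = x ^ degree f * z" using assms(3)
    by (metis Suc_lessI mult.assoc power_Suc)
  also have "\<dots> = (\<Sum>i<degree f. embed (- coeff f i) * (x ^ i * z))"
    unfolding integral_power_reduction[OF assms(1,2)] by (simp add: sum_distrib_right mult.assoc)
  also have "\<dots> \<in> int_span B" using B by (intro int_span_sum int_span_scale int_span_base) auto
  finally show ?thesis .
qed

text \<open>The monomials x^i y^j with exponents below the degrees of two monic equations span a
  module stable under x and under y, hence under x + y and x y.\<close>

lemma integral_add_mult:
  fixes x y :: "'p::prime_card padic_closure"
  assumes "x \<in> algebraic_integers" "y \<in> algebraic_integers"
  shows "x + y \<in> algebraic_integers" "x * y \<in> algebraic_integers"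
proof -
  obtain f where f: "lead_coeff f = 1" "poly (map_poly embed f) x = 0"
    using assms(1) unfolding integral_iff by blast
  obtain g where g: "lead_coeff g = 1" "poly (map_poly embed g) y = 0"
    using assms(2) unfolding integral_iff by blast
  \<comment> \<open>Positive degrees put 1 = x^0 y^0 into B.\<close>
  have pos: "degree h > 0" if "lead_coeff h = 1" "poly (map_poly embed h) z = 0" for h and z :: "'p padic_closure"
  proof (rule ccontr)
    assume "\<not> degree h > 0"
    then have "h = 1" using that(1) by (metis monic_degree_0 neq0_conv)
    then show False using that(2) by simp
  qed
  define B where "B = (\<lambda>(i, j). x ^ i * y ^ j) ` ({..<degree f} \<times> {..<degree g})"
  have B: "finite B" "1 \<in> B"
    using pos[OF f] pos[OF g] by (auto simp: B_def intro!: image_eqI[of _ _ "(0, 0)"])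
  have BI: "x ^ i * y ^ j \<in> B" if "i < degree f" "j < degree g" for i j
    using that by (auto simp: B_def)
  have x: "x * b \<in> int_span B" if b: "b \<in> B" for b
  proof -
    obtain i j where "b = x ^ i * y ^ j" "i < degree f" "j < degree g" using b by (auto simp: B_def)
    then show ?thesis using integral_power_span[OF f _ B(1), of i "y ^ j"] BI by auto
  qed
  have y: "y * b \<in> int_span B" if b: "b \<in> B" for b
  proof -
    obtain i j where "b = y ^ j * x ^ i" "i < degree f" "j < degree g"
      using b by (auto simp: B_def mult.commute)
    moreover from this have "\<And>j. j < degree g \<Longrightarrow> y ^ j * x ^ i \<in> B" using BI by (simp add: mult.commute)
    ultimately show ?thesis using integral_power_span[OF g _ B(1), of j "x ^ i"] by auto
  qed
  show "x + y \<in> algebraic_integers"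
    by (rule integral_if_int_span_stable[OF B]) (auto simp: distrib_right intro!: int_span_add x y)
  have "x * y * b \<in> int_span B" if "b \<in> B" for b
    using int_span_mult_closed[OF x y[OF that]] by (simp add: mult.assoc)
  then show "x * y \<in> algebraic_integers"
    by (intro integral_if_int_span_stable[OF B]) auto
qed

lemma integral_embed: "embed z \<in> algebraic_integers"
  unfolding integral_iff
  by (intro exI[of _ "[:-z, 1:]"]) (simp add: embed.map_poly_pCons_hom embed.hom_uminus)

lemma integral_0: "0 \<in> algebraic_integers" and integral_1: "1 \<in> algebraic_integers"
  using integral_embed[of 0] integral_embed[of 1] by simp_all

lemma integral_uminus: "x \<in> algebraic_integers \<Longrightarrow> - x \<in> algebraic_integers"
  using integral_add_mult(2)[OF integral_embed[of "-1"], of x] by (simp add: embed.hom_uminus)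

lemma integral_diff: "x \<in> algebraic_integers \<Longrightarrow> y \<in> algebraic_integers \<Longrightarrow> x - y \<in> algebraic_integers"
  using integral_add_mult(1)[of x "-y"] integral_uminus[of y] by simp

lemma integral_power: "x \<in> algebraic_integers \<Longrightarrow> x ^ n \<in> algebraic_integers"
  by (induction n) (auto intro: integral_1 integral_add_mult)

lemma integral_prod_mset: "(\<And>x. x \<in># A \<Longrightarrow> x \<in> algebraic_integers) \<Longrightarrow> prod_mset A \<in> algebraic_integers"
  by (induction A) (auto intro: integral_1 integral_add_mult)

lemma integral_sum: "(\<And>x. x \<in> A \<Longrightarrow> f x \<in> algebraic_integers) \<Longrightarrow> sum f A \<in> algebraic_integers"
  by (induction A rule: infinite_finite_induct) (auto intro: integral_0 integral_add_mult)

lemma integral_poly: "x \<in> algebraic_integers \<Longrightarrow> poly (map_poly embed Q) x \<in> algebraic_integers"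
  unfolding poly_altdef by (intro integral_sum integral_add_mult integral_power) (auto intro: integral_embed)

text \<open>Z_p is integrally closed. If q had a denominator, multiplying a monic equation of q by a
  power of 1/q = p z would leave 1 as the leading term and a multiple of p in every other
  term.\<close>

lemma integral_to_ac:
  fixes q :: "'p::prime_card padic"
  assumes "to_ac q \<in> algebraic_integers"
  obtains z where "q = to_fract z"
proof -
  obtain k a where ka: "to_fract padic_p ^ k * q = to_fract a" using to_fract_decompose .
  show thesis
  proof (cases "a = 0")
    case True
    then have "q = 0" using ka p_power_neq_0[of k, where ?'p='p]
      by (metis mult_eq_0_iff to_fract.hom_power to_fract_0 to_fract_eq_0_iff)
    then show thesis using that[of 0] by simp
  next
    case False
    obtain l u where lu: "a = padic_p ^ l * u" "u dvd 1" using padic_int_decompose[OF False] .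
    obtain w where w: "u * w = 1" using lu(2) by (metis dvdE)
    show thesis
    proof (cases "k \<le> l")
      case True
      have "a = padic_p ^ k * (padic_p ^ (l - k) * u)"
        using True unfolding lu(1) by (metis le_add_diff_inverse mult.assoc power_add)
      then have "to_fract padic_p ^ k * q = to_fract padic_p ^ k * to_fract (padic_p ^ (l - k) * u)"
        using ka by (metis to_fract.hom_mult to_fract.hom_power)
      then show thesis using that p_power_neq_0[of k, where ?'p='p]
        by (metis mult_cancel_left to_fract.hom_power to_fract_eq_0_iff)
    next
      case False
      define m where "m = k - l - 1"
      have k: "k = l + Suc m" using False by (simp add: m_def)
      text \<open>Here q is not integral: the inverse of q is p z with z integral.\<close>
      define z where "z = padic_p ^ m * w"
      have "to_fract padic_p ^ l * (to_fract padic_p ^ Suc m * q) = to_fract padic_p ^ l * to_fract u"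
        using ka unfolding lu(1) k by (simp add: power_add mult_ac to_fract.hom_mult to_fract.hom_power)
      then have "to_fract padic_p ^ Suc m * q = to_fract u"
        using p_power_neq_0[of l, where ?'p='p] by (metis mult_cancel_left to_fract.hom_power to_fract_eq_0_iff)
      then have "to_fract padic_p ^ Suc m * q * to_fract w = 1"
        using w by (metis to_fract.hom_mult to_fract.hom_one)
      then have "to_fract (padic_p * z) * q = 1"
        by (simp add: z_def to_fract.hom_mult to_fract.hom_power mult_ac)
      then have zq: "embed (padic_p * z) * to_ac q = 1"
        unfolding embed_def by (metis to_ac_1 to_ac_mult)
      obtain Q where Q: "lead_coeff Q = 1" "poly (map_poly embed Q) (to_ac q) = 0"
        using assms unfolding integral_iff by blast
      have "0 = embed (padic_p * z) ^ degree Q * poly (map_poly embed Q) (to_ac q)" using Q by simp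
      also have "\<dots> = (\<Sum>i\<le>degree Q. embed (coeff Q i * (padic_p * z) ^ (degree Q - i)))"
      proof -
        have "embed (padic_p * z) ^ degree Q * to_ac q ^ i = embed ((padic_p * z) ^ (degree Q - i))"
          if "i \<le> degree Q" for i
        proof -
          have "embed (padic_p * z) ^ degree Q * to_ac q ^ i
            = embed (padic_p * z) ^ (degree Q - i) * (embed (padic_p * z) * to_ac q) ^ i"
            using that by (simp add: power_mult_distrib mult.assoc[symmetric] power_add[symmetric])
          then show ?thesis by (simp only: zq embed.hom_power) simp
        qed
        then show ?thesis unfolding poly_altdef sum_distrib_left
          by (intro sum.cong) (simp_all add: embed.hom_mult mult.left_commute)
      qed
      also have "\<dots> = embed (\<Sum>i\<le>degree Q. coeff Q i * (padic_p * z) ^ (degree Q - i))"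
        by (simp add: embed.hom_sum)
      finally have "(\<Sum>i\<le>degree Q. coeff Q i * (padic_p * z) ^ (degree Q - i)) = 0"
        by (metis embed.hom_0_iff)
      then have "(\<Sum>i<degree Q. coeff Q i * (padic_p * z) ^ (degree Q - i)) + 1 = 0"
        using Q(1) by (simp add: lessThan_Suc_atMost[symmetric])
      moreover have "padic_p dvd (\<Sum>i<degree Q. coeff Q i * (padic_p * z) ^ (degree Q - i))"
      proof (intro dvd_sum dvd_mult)
        fix i assume "i \<in> {..<degree Q}"
        then have "padic_p * z dvd (padic_p * z) ^ (degree Q - i)" by (intro dvd_power) simp
        then show "padic_p dvd (padic_p * z) ^ (degree Q - i)" by (rule dvd_mult_left)
      qed
      moreover have "padic_p dvd (1 :: 'p padic_int)" if "s + 1 = 0" "padic_p dvd s" for s :: "'p padic_int"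
        using that by (metis dvd_0_right dvd_add_right_iff)
      ultimately have "padic_p dvd (1 :: 'p padic_int)" by blast
      then show thesis using p_not_dvd_1 by blast
    qed
  qed
qed

section \<open>Minimal polynomials and conjugates\<close>

lemma min_poly_exists:
  fixes x :: "'p::prime_card padic_closure"
  obtains m where "lead_coeff m = 1" "irreducible m" "poly (lift_padic_poly m) x = 0"
    "\<And>h. poly (lift_padic_poly h) x = 0 \<Longrightarrow> m dvd h"
proof -
  obtain h0 :: "'p padic poly" where h0: "h0 \<noteq> 0" "poly (lift_padic_poly h0) x = 0"
    using alg_closure_algebraic .
  define A where "A h \<longleftrightarrow> h \<noteq> 0 \<and> poly (lift_padic_poly h) x = 0" for h :: "'p padic poly"
  define g where "g = arg_min degree A"
  have g: "A g" "\<And>h. A h \<Longrightarrow> degree g \<le> degree h"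
    using arg_min_nat_lemma[of A h0 degree] h0 by (auto simp: A_def g_def)
  define m where "m = smult (inverse (lead_coeff g)) g"
  have m0: "m \<noteq> 0" and deg: "degree m = degree g" and m1: "lead_coeff m = 1"
    using g(1) by (auto simp: m_def A_def)
  have mx: "poly (lift_padic_poly m) x = 0"
    using g(1) by (simp add: m_def A_def to_ac.map_poly_hom_smult)
  have dvd: "m dvd h" if "poly (lift_padic_poly h) x = 0" for h
  proof (rule ccontr)
    assume "\<not> m dvd h"
    then have "h mod m \<noteq> 0" by auto
    moreover have "lift_padic_poly h = lift_padic_poly (h div m) * lift_padic_poly m + lift_padic_poly (h mod m)"
      by (metis div_mult_mod_eq map_poly_to_ac.hom_add map_poly_to_ac.hom_mult)
    then have "poly (lift_padic_poly (h mod m)) x = 0" using that mx by simp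
    ultimately have "degree m \<le> degree (h mod m)" using g(2) deg by (simp add: A_def)
    then show False using degree_mod_less[OF m0, of h] \<open>h mod m \<noteq> 0\<close> by simp
  qed
  have nu: "\<not> h dvd 1" if "poly (lift_padic_poly h) x = 0" for h :: "'p padic poly"
  proof
    assume "h dvd 1"
    then obtain k where "1 = h * k" by (elim dvdE)
    then have "(1 :: 'p padic_closure poly) = lift_padic_poly h * lift_padic_poly k"
      by (metis map_poly_to_ac.hom_mult map_poly_to_ac.hom_one)
    then have "poly (1 :: 'p padic_closure poly) x = 0" using that by (metis mult_zero_left poly_mult)
    then show False by simp
  qed
  have irr: "irreducible m"
  proof (rule Factorial_Ring.irreducibleI[OF m0 nu[OF mx]])
    fix a b assume ab: "m = a * b"
    then have a0: "a \<noteq> 0" "b \<noteq> 0" using m0 by auto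
    then have "degree m = degree a + degree b" unfolding ab by (rule degree_mult_eq)
    moreover have "poly (lift_padic_poly a) x = 0 \<or> poly (lift_padic_poly b) x = 0"
      using mx unfolding ab by (simp add: map_poly_to_ac.hom_mult)
    then have "degree m \<le> degree a \<or> degree m \<le> degree b" using a0 g(2) deg by (auto simp: A_def)
    ultimately have "degree a = 0 \<or> degree b = 0" by auto
    then show "a dvd 1 \<or> b dvd 1" using a0 by (simp add: is_unit_iff_degree)
  qed
  show thesis using that[OF m1 irr mx dvd] .
qed

lemma min_poly_eqI:
  fixes x :: "'p::prime_card padic_closure"
  assumes "lead_coeff m = 1" "irreducible m" "poly (lift_padic_poly m) x = 0"
  shows "min_poly x = m"
proof -
  obtain g where g: "lead_coeff g = 1" "irreducible g" "poly (lift_padic_poly g) x = 0"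
    "\<And>h. poly (lift_padic_poly h) x = 0 \<Longrightarrow> g dvd h" using min_poly_exists[of x] by blast
  have uniq: "h = g" if h: "lead_coeff h = 1" "irreducible h" "poly (lift_padic_poly h) x = 0" for h
  proof -
    obtain c where c: "h = g * c" using g(4)[OF h(3)] by (elim dvdE)
    have "c dvd 1" using Factorial_Ring.irreducibleD[OF h(2) c] g(2) by (auto simp: Factorial_Ring.irreducible_def)
    then obtain k where "c = [:k:]" by (metis is_unit_poly_iff)
    moreover have "lead_coeff c = 1" using h(1) g(1) unfolding c lead_coeff_mult by simp
    ultimately show ?thesis using c by (simp add: one_pCons[symmetric])
  qed
  have "min_poly x = g" unfolding min_poly_def
  proof (rule the_equality)
    show "lead_coeff g = 1 \<and> irreducible g \<and> poly (lift_padic_poly g) x = 0" using g by simp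
  qed (use uniq in blast)
  then show ?thesis using uniq[OF assms] by simp
qed

lemma min_poly:
  fixes x :: "'p::prime_card padic_closure"
  shows "lead_coeff (min_poly x) = 1" "irreducible (min_poly x)" "poly (lift_padic_poly (min_poly x)) x = 0"
    and min_poly_dvd: "poly (lift_padic_poly h) x = 0 \<Longrightarrow> min_poly x dvd h"
proof -
  obtain g where g: "lead_coeff g = 1" "irreducible g" "poly (lift_padic_poly g) x = 0"
    "\<And>h. poly (lift_padic_poly h) x = 0 \<Longrightarrow> g dvd h" using min_poly_exists[of x] by blast
  have "min_poly x = g" using min_poly_eqI g by blast
  then show "lead_coeff (min_poly x) = 1" "irreducible (min_poly x)" "poly (lift_padic_poly (min_poly x)) x = 0"
    "poly (lift_padic_poly h) x = 0 \<Longrightarrow> min_poly x dvd h" using g by auto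
qed

text \<open>Conjugates are roots of the minimal polynomial, not images under
  \<open>galois_group\<close>, so no automorphism has to be constructed. Counting them with
  multiplicity makes their product the norm.\<close>

abbreviation conjugates :: "'p::prime_card padic_closure \<Rightarrow> 'p padic_closure multiset"
  where "conjugates x \<equiv> proots (lift_padic_poly (min_poly x))"

lemma lift_min_poly_monic: "lead_coeff (lift_padic_poly (min_poly x)) = 1"
  by (simp add: min_poly(1))

lemma monic_neq_0: "lead_coeff P = 1 \<Longrightarrow> P \<noteq> (0 :: 'a::comm_ring_1 poly)"
  by auto

lemma in_conjugates_iff: "y \<in># conjugates x \<longleftrightarrow> poly (lift_padic_poly (min_poly x)) y = 0"
  using monic_neq_0[OF lift_min_poly_monic[of x]] by simp

lemma self_in_conjugates: "x \<in># conjugates x"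
  unfolding in_conjugates_iff by (rule min_poly(3))

lemma min_poly_conjugate: "y \<in># conjugates x \<Longrightarrow> min_poly y = min_poly x"
  unfolding in_conjugates_iff by (intro min_poly_eqI min_poly)

lemma conjugate_root:
  assumes "y \<in># conjugates x" "poly (lift_padic_poly h) x = 0"
  shows "poly (lift_padic_poly h) y = 0"
proof -
  obtain k where "h = min_poly x * k" using min_poly_dvd[OF assms(2)] by (elim dvdE)
  then show ?thesis using assms(1) unfolding in_conjugates_iff by (simp add: map_poly_to_ac.hom_mult)
qed

lemma lift_poly_pcompose:
  "poly (lift_poly Q) (poly (lift_padic_poly h) x) = poly (lift_padic_poly (pcompose (map_poly to_fract Q) h)) x"
  by (simp add: to_ac.map_poly_pcompose poly_pcompose)

lemma conjugate_integral:
  assumes "y \<in># conjugates x" "poly (lift_padic_poly h) x \<in> algebraic_integers"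
  shows "poly (lift_padic_poly h) y \<in> algebraic_integers"
proof -
  obtain Q where "lead_coeff Q = 1" "poly (lift_poly Q) (poly (lift_padic_poly h) x) = 0"
    using assms(2) unfolding algebraic_integers_def by blast
  moreover from this(2) have "poly (lift_poly Q) (poly (lift_padic_poly h) y) = 0"
    unfolding lift_poly_pcompose by (rule conjugate_root[OF assms(1)])
  ultimately show ?thesis unfolding algebraic_integers_def by blast
qed

text \<open>Since the absolute value depends on the minimal polynomial alone, a polynomial over Q_p
  takes values of equal absolute value at conjugate points.\<close>

lemma min_poly_poly_conjugate:
  assumes "y \<in># conjugates x"
  shows "min_poly (poly (lift_padic_poly h) y) = min_poly (poly (lift_padic_poly h) x)"
proof (rule min_poly_eqI)
  let ?m = "min_poly (poly (lift_padic_poly h) x)"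
  have "poly (lift_padic_poly (pcompose ?m h)) x = 0"
    by (simp add: to_ac.map_poly_pcompose poly_pcompose min_poly(3))
  then have "poly (lift_padic_poly (pcompose ?m h)) y = 0" by (rule conjugate_root[OF assms])
  then show "poly (lift_padic_poly ?m) (poly (lift_padic_poly h) y) = 0"
    by (simp add: to_ac.map_poly_pcompose poly_pcompose)
qed (rule min_poly)+

lemma coeff_0_min_poly: "coeff (min_poly x) 0 = 0 \<longleftrightarrow> x = 0"
proof
  assume c0: "coeff (min_poly x) 0 = 0"
  obtain m where m: "min_poly x = pCons 0 m" using c0 by (metis coeff_pCons_0 pCons_cases)
  have m0: "m \<noteq> 0" using m min_poly(1)[of x] by auto
  show "x = 0"
  proof (rule ccontr)
    assume "x \<noteq> 0"
    then have "poly (lift_padic_poly m) x = 0"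
      using min_poly(3)[of x] unfolding m by (simp add: to_ac.map_poly_pCons_hom)
    then have "pCons 0 m dvd m" using min_poly_dvd m by metis
    then have "degree (pCons 0 m) \<le> degree m" using m0 by (rule dvd_imp_degree_le)
    then show False using m0 by simp
  qed
next
  assume "x = 0"
  then show "coeff (min_poly x) 0 = 0"
    using min_poly(3)[of x] by (simp add: poly_0_coeff_0)
qed

lemma degree_min_poly_pos: "degree (min_poly x) > 0"
proof (rule ccontr)
  assume "\<not> degree (min_poly x) > 0"
  then have "min_poly x = 1" using min_poly(1)[of x] by (metis monic_degree_0 neq0_conv)
  then show False using min_poly(2)[of x] by (simp add: Factorial_Ring.irreducible_def)
qed

text \<open>Write the minimal polynomial as c + y m(y). Then 1/y = - m(y) / c for every conjugate y
  with the same coefficients, so statements about values of polynomials at conjugates extend to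
  inverses.\<close>

lemma inverse_as_poly:
  fixes x :: "'p::prime_card padic_closure"
  assumes "x \<noteq> 0"
  obtains h where "\<And>y. y \<in># conjugates x \<Longrightarrow> poly (lift_padic_poly h) y = inverse y"
proof -
  obtain c m where m: "min_poly x = pCons c m" by (metis pCons_cases)
  have c: "c \<noteq> 0" using coeff_0_min_poly[of x] assms m by simp
  show thesis
  proof
    fix y assume "y \<in># conjugates x"
    then have y: "to_ac c + y * poly (lift_padic_poly m) y = 0"
      unfolding in_conjugates_iff unfolding m by (simp add: to_ac.map_poly_pCons_hom)
    then have y0: "y \<noteq> 0" using c by auto
    have "poly (lift_padic_poly m) y = - to_ac c * inverse y"
      using y y0 by (simp add: field_simps eq_neg_iff_add_eq_0)
    then show "poly (lift_padic_poly (smult (- inverse c) m)) y = inverse y"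
    proof -
      have "to_ac (- inverse c) * - to_ac c = 1" using c by (simp flip: to_ac_mult)
      then show ?thesis
        unfolding to_ac.map_poly_hom_smult poly_smult \<open>poly (lift_padic_poly m) y = _\<close>
        by (metis mult.assoc mult.left_neutral)
    qed
  qed
qed

lemma proots_prod_linear: "proots (\<Prod>x\<in>#A. [:- x, 1:]) = (A :: 'a::idom multiset)"
proof (induction A)
  case (add a A)
  have "(\<Prod>x\<in>#A. [:- x, 1:]) \<noteq> 0" by (auto simp: prod_mset_zero_iff)
  then show ?case using add by (simp add: proots_mult del: mult_pCons_left)
qed simp

lemma monic_eq_prod_proots:
  fixes P :: "'a::alg_closed_field poly"
  assumes "lead_coeff P = 1"
  shows "P = (\<Prod>x\<in>#proots P. [:- x, 1:])" "size (proots P) = degree P"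
proof -
  obtain A where A: "size A = degree P" "P = smult (lead_coeff P) (\<Prod>x\<in>#A. [:- x, 1:])"
    using alg_closed_imp_factorization[OF monic_neq_0[OF assms]] by blast
  then have PA: "P = (\<Prod>x\<in>#A. [:- x, 1:])" using assms by simp
  have "proots P = A" unfolding PA by (rule proots_prod_linear)
  then show "P = (\<Prod>x\<in>#proots P. [:- x, 1:])" "size (proots P) = degree P" using PA A by auto
qed

lemma poly_prod_mset: "poly (\<Prod>x\<in>#A. f x) y = (\<Prod>x\<in>#A. poly (f x) y)"
  by (induction A) auto

lemma poly_eq_prod_proots:
  fixes P :: "'a::alg_closed_field poly"
  assumes "lead_coeff P = 1"
  shows "poly P y = (\<Prod>x\<in>#proots P. y - x)"
  by (subst monic_eq_prod_proots(1)[OF assms]) (simp add: poly_prod_mset)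

section \<open>The valuation on the algebraic closure\<close>

text \<open>Each value divides the product over all conjugates with an integral quotient. If the
  inverse of the product is integral as well, every factor is a unit of the ring of integral
  elements.\<close>

lemma conjugates_norm:
  fixes x :: "'p::prime_card padic_closure"
  defines "N \<equiv> \<lambda>k. \<Prod>y\<in>#conjugates x. poly (lift_padic_poly k) y"
  assumes w: "poly (lift_padic_poly k) x \<in> algebraic_integers"
  shows "N k \<in> algebraic_integers"
    and "inverse (N k) \<in> algebraic_integers \<Longrightarrow> inverse (poly (lift_padic_poly k) x) \<in> algebraic_integers"
proof -
  have int: "poly (lift_padic_poly k) y \<in> algebraic_integers" if "y \<in># conjugates x" for y
    using conjugate_integral[OF that w] .
  show "N k \<in> algebraic_integers"
    unfolding N_def by (rule integral_prod_mset) (use int in auto)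
  assume inv: "inverse (N k) \<in> algebraic_integers"
  define A where "A = conjugates x - {#x#}"
  define R where "R = (\<Prod>y\<in>#A. poly (lift_padic_poly k) y)"
  have "conjugates x = add_mset x A" using self_in_conjugates[of x] by (simp add: A_def)
  then have N: "N k = poly (lift_padic_poly k) x * R" by (simp add: N_def R_def)
  have R: "R \<in> algebraic_integers"
    unfolding R_def by (rule integral_prod_mset) (use int in \<open>auto simp: A_def dest: in_diffD\<close>)
  show "inverse (poly (lift_padic_poly k) x) \<in> algebraic_integers"
  proof (cases "R = 0 \<or> poly (lift_padic_poly k) x = 0")
    case False
    then have "inverse (poly (lift_padic_poly k) x) = R * inverse (N k)" by (simp add: N)
    then show ?thesis using R inv integral_add_mult by metis
  next
    \<comment> \<open>As \<open>inverse 0 = 0\<close>, the hypothesis is void when the product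
      vanishes. But a zero at one conjugate forces a zero at x, whose inverse is again the integral
      element 0.\<close>
    case R0: True
    show ?thesis
    proof (cases "poly (lift_padic_poly k) x = 0")
      case True
      then show ?thesis by (simp add: integral_0)
    next
      case False
      then obtain y where y: "y \<in># A" "poly (lift_padic_poly k) y = 0"
        using R0 by (auto simp: R_def prod_mset_zero_iff)
      then have yx: "y \<in># conjugates x" by (auto simp: A_def dest: in_diffD)
      then have "x \<in># conjugates y" using min_poly_conjugate[OF yx] self_in_conjugates[of x] by simp
      then show ?thesis using conjugate_root y(2) False by blast
    qed
  qed
qed

abbreviation padic_q :: "'p::prime_card padic"
  where "padic_q \<equiv> of_nat CARD('p)"

lemma padic_q_neq_0: "padic_q \<noteq> (0 :: 'p::prime_card padic)"
  using p_power_neq_0[of 1, where ?'p='p] by (metis power_one_right to_fract.hom_of_nat to_fract_eq_0_iff)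

lemma to_fract_p_power: "to_fract (padic_p ^ k) = (padic_q ^ k :: 'p::prime_card padic)"
  by (simp add: to_fract.hom_power to_fract.hom_of_nat)

lemma padic_decompose:
  fixes q :: "'p::prime_card padic"
  assumes "q \<noteq> 0"
  obtains e :: int and u where "q = padic_q powi e * to_fract u" "u dvd 1"
proof -
  obtain k a where ka: "to_fract padic_p ^ k * q = to_fract a" using to_fract_decompose .
  have pk: "padic_q ^ k \<noteq> (0 :: 'p padic)" using padic_q_neq_0 by (rule power_not_zero)
  have ka': "padic_q ^ k * q = to_fract a" using ka by (simp add: to_fract.hom_of_nat)
  then have "a \<noteq> 0" using assms pk by (metis mult_eq_0_iff to_fract_0)
  then obtain l u where lu: "a = padic_p ^ l * u" "u dvd 1" using padic_int_decompose by blast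
  have "q = padic_q powi (int l - int k) * to_fract u"
  proof -
    have "padic_q ^ k * q = padic_q ^ l * to_fract u" using ka' lu by (simp only: to_fract.hom_mult to_fract_p_power)
    moreover have "padic_q ^ k * padic_q powi (int l - int k) = (padic_q ^ l :: 'p padic)"
      using padic_q_neq_0[where ?'p='p] by (simp add: power_int_diff)
    ultimately have "padic_q ^ k * q = padic_q ^ k * (padic_q powi (int l - int k) * to_fract u)"
      by (simp only: mult.assoc[symmetric])
    then show ?thesis by (rule mult_left_cancel[THEN iffD1, OF pk])
  qed
  then show thesis using that lu(2) by blast
qed

lemma p_powi_unit_integral:
  fixes u z :: "'p::prime_card padic_int"
  assumes "padic_q powi n * to_fract u = to_fract z" "u dvd 1"
  shows "n \<ge> 0"
proof (rule ccontr)
  assume "\<not> n \<ge> 0"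
  define m where "m = nat (- n) - 1"
  have m: "n = - int (Suc m)" using \<open>\<not> n \<ge> 0\<close> by (simp add: m_def)
  have "padic_q ^ Suc m \<noteq> (0 :: 'p padic)" using padic_q_neq_0 by (rule power_not_zero)
  then have "to_fract u = padic_q ^ Suc m * (padic_q powi n * to_fract u)"
    unfolding m power_int_minus power_int_of_nat by (metis mult.assoc mult.left_neutral right_inverse)
  then have "to_fract u = to_fract (padic_p ^ Suc m * z)" 
    unfolding assms(1) by (simp only: to_fract.hom_mult to_fract_p_power)
  then have "u = padic_p * (padic_p ^ m * z)" by (simp only: to_fract_eq_iff power_Suc mult.assoc)
  then show False using unit_imp_not_p_dvd[OF assms(2)] by simp
qed

lemma padic_val_0: "padic_val (0 :: 'p::prime_card padic) = \<infinity>"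
  unfolding padic_val_def
proof (rule SUP_PInfty)
  fix n :: nat
  have "int n \<in> {k::int. \<exists>a. (0 :: 'p padic) = padic_q powi k * to_fract a}"
    by (auto intro!: exI[of _ 0])
  then show "\<exists>i\<in>{k::int. \<exists>a. (0 :: 'p padic) = padic_q powi k * to_fract a}. ereal (real n) \<le> ereal (of_int i)"
    by (intro bexI[of _ "int n"]) auto
qed

lemma padic_val_decompose:
  fixes u :: "'p::prime_card padic_int"
  assumes "u dvd 1"
  shows "padic_val (padic_q powi e * to_fract u) = ereal (of_int e)"
  unfolding padic_val_def
proof (rule SUP_eqI)
  fix k assume "k \<in> {k. \<exists>a. padic_q powi e * to_fract u = padic_q powi k * to_fract a}"
  then obtain a where a: "padic_q powi e * to_fract u = padic_q powi k * to_fract a" by blast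
  have "padic_q powi (e - k) * to_fract u = inverse (padic_q powi k) * (padic_q powi e * to_fract u)"
    using padic_q_neq_0[where ?'p='p] by (simp add: power_int_diff divide_inverse mult_ac)
  also have "\<dots> = to_fract a" unfolding a using padic_q_neq_0[where ?'p='p] by simp
  finally have "e - k \<ge> 0" using p_powi_unit_integral assms by blast
  then show "ereal (of_int k) \<le> ereal (of_int e)" by simp
next
  fix y assume "\<And>i. i \<in> {k. \<exists>a. padic_q powi e * to_fract u = padic_q powi k * to_fract a} \<Longrightarrow> ereal (of_int i) \<le> y"
  then show "ereal (of_int e) \<le> y" by blast
qed

abbreviation padic_w :: "'p::prime_card padic_closure"
  where "padic_w \<equiv> of_nat CARD('p)"

lemma padic_w_neq_0: "padic_w \<noteq> (0 :: 'p::prime_card padic_closure)"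
  using padic_q_neq_0[where ?'p='p] by (metis to_ac_eq_0_iff to_ac_of_nat)

lemma to_ac_powi: "to_ac (q powi n) = to_ac q powi n"
  by (cases n rule: int_cases2) (simp_all add: power_int_minus)

lemma prod_mset_power: "(\<Prod>y\<in>#A. f y ^ b) = (\<Prod>y\<in>#A. f y) ^ b"
  for f :: "'b \<Rightarrow> 'a::comm_semiring_1"
  by (induction A) (auto simp: power_mult_distrib)

lemma prod_mset_uminus: "(\<Prod>y\<in>#A. - y) = (- 1) ^ size A * (\<Prod>y\<in>#A. y)"
  for A :: "'a::comm_ring_1 multiset"
  by (induction A) auto

lemma prod_mset_inverse: "(\<Prod>y\<in>#A. inverse (f y)) = inverse (\<Prod>y\<in>#A. f y)"
  for f :: "'b \<Rightarrow> 'a::field"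
  by (induction A) auto

lemma prod_conjugates: "(\<Prod>y\<in>#conjugates x. y) = (- 1) ^ degree (min_poly x) * to_ac (coeff (min_poly x) 0)"
proof -
  have "to_ac (coeff (min_poly x) 0) = poly (lift_padic_poly (min_poly x)) 0"
    by (simp add: poly_0_coeff_0)
  also have "\<dots> = (\<Prod>y\<in>#conjugates x. - y)"
    using poly_eq_prod_proots[OF lift_min_poly_monic[of x], of 0] by simp
  also have "\<dots> = (- 1) ^ size (conjugates x) * (\<Prod>y\<in>#conjugates x. y)"
    by (rule prod_mset_uminus)
  finally show ?thesis using monic_eq_prod_proots(2)[OF lift_min_poly_monic[of x]]
    by (simp add: mult.assoc[symmetric] power_mult_distrib[symmetric])
qed

text \<open>The integrality of x^b / p^a is decided by the product of its conjugates, which is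
  plus or minus p^(e b - a d) times a unit.\<close>

lemma integral_power_quotient:
  fixes x :: "'p::prime_card padic_closure"
  assumes x0: "x \<noteq> 0" and c: "coeff (min_poly x) 0 = padic_q powi e * to_fract u" "u dvd 1"
  defines "d \<equiv> int (degree (min_poly x))"
  shows "x ^ b * padic_w powi (- a) \<in> algebraic_integers \<longleftrightarrow> a * d \<le> e * int b"
    and "inverse (x ^ b * padic_w powi (- a)) \<in> algebraic_integers \<longleftrightarrow> e * int b \<le> a * d"
proof -
  obtain h where h: "\<And>y. y \<in># conjugates x \<Longrightarrow> poly (lift_padic_poly h) y = inverse y"
    using inverse_as_poly[OF x0] by blast
  \<comment> \<open>P and Y take the values y^b / p^a and its inverse at every conjugate y of x, so
    both directions of the norm criterion become available.\<close>
  define P where "P = (smult (padic_q powi (- a)) (monom 1 b) :: 'p padic poly)"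
  define Y where "Y = smult (padic_q powi a) (h ^ b)"
  have P: "poly (lift_padic_poly P) y = y ^ b * padic_w powi (- a)" for y
    by (simp add: P_def to_ac.map_poly_hom_smult poly_monom to_ac_powi)
  have Y: "poly (lift_padic_poly Y) y = inverse (y ^ b * padic_w powi (- a))" if "y \<in># conjugates x" for y
    using h[OF that]
    by (simp add: Y_def to_ac.map_poly_hom_smult map_poly_to_ac.hom_power to_ac_powi power_int_minus power_inverse)
  define N where "N = (\<Prod>y\<in>#conjugates x. poly (lift_padic_poly P) y)"
  have N: "N = (- 1) ^ (degree (min_poly x) * b) * to_ac (padic_q powi (e * int b - a * d) * to_fract (u ^ b))"
  proof -
    have "N = (\<Prod>y\<in>#conjugates x. y) ^ b * (padic_w powi (- a)) ^ degree (min_poly x)"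
      unfolding N_def P using monic_eq_prod_proots(2)[OF lift_min_poly_monic[of x]]
      by (simp add: prod_mset.distrib prod_mset_power prod_mset_constant)
    also have "(padic_w powi (- a)) ^ degree (min_poly x) = (to_ac (padic_q powi (- (a * d))) :: 'p padic_closure)"
      unfolding to_ac_powi d_def by (simp add: power_int_mult[symmetric] power_int_power')
    also have "(\<Prod>y\<in>#conjugates x. y) ^ b =
        (- 1) ^ (degree (min_poly x) * b) * to_ac (padic_q powi (e * int b) * to_fract (u ^ b))"
      unfolding prod_conjugates c
      by (simp add: power_mult_distrib power_mult to_fract.hom_power power_int_power' to_ac_powi)
    finally show ?thesis using padic_q_neq_0[where ?'p='p]
      by (simp add: mult_ac power_int_diff power_int_minus divide_inverse)
  qed
  have NY: "(\<Prod>y\<in>#conjugates x. poly (lift_padic_poly Y) y) = inverse N"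
  proof -
    have "(\<Prod>y\<in>#conjugates x. poly (lift_padic_poly Y) y)
      = (\<Prod>y\<in>#conjugates x. inverse (poly (lift_padic_poly P) y))"
      using Y P by (intro arg_cong[of _ _ prod_mset] image_mset_cong) auto
    also have "\<dots> = inverse N" unfolding N_def by (rule prod_mset_inverse)
    finally show ?thesis .
  qed
  have sgn: "(- 1) ^ n * z \<in> algebraic_integers \<longleftrightarrow> z \<in> algebraic_integers" for n and z :: "'p padic_closure"
    using integral_uminus[of z] integral_uminus[of "- z"] by (cases "even n") auto
  obtain v where v: "u * v = 1" using c(2) by (metis dvdE)
  have uvb: "u ^ b * v ^ b = 1" using v by (simp flip: power_mult_distrib)
  then have uv: "to_fract (u ^ b) * to_fract (v ^ b) = 1" "u ^ b dvd 1" "v ^ b dvd 1"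
    by (metis to_fract.hom_mult to_fract.hom_one, metis dvd_triv_left, metis dvd_triv_right)
  have pow: "to_ac (padic_q powi n * to_fract w) \<in> algebraic_integers \<longleftrightarrow> n \<ge> 0" if "w dvd 1" for n and w :: "'p padic_int"
  proof
    assume "to_ac (padic_q powi n * to_fract w) \<in> algebraic_integers"
    then show "n \<ge> 0" using integral_to_ac p_powi_unit_integral that by metis
  next
    assume "n \<ge> 0"
    then have "to_ac (padic_q powi n * to_fract w) = embed (padic_p ^ nat n * w)"
      unfolding embed_def to_fract.hom_mult to_fract_p_power by (simp add: power_int_def)
    then show "to_ac (padic_q powi n * to_fract w) \<in> algebraic_integers" by (simp add: integral_embed)
  qed
  have N_int: "N \<in> algebraic_integers \<longleftrightarrow> a * d \<le> e * int b"
    unfolding N sgn using pow[OF uv(2), of "e * int b - a * d"] by simp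
  have "inverse N = (- 1) ^ (degree (min_poly x) * b) *
      to_ac (padic_q powi (a * d - e * int b) * to_fract (v ^ b))"
  proof -
    have "inverse (to_fract (u ^ b)) = to_fract (v ^ b)" using uv(1) by (rule inverse_unique)
    moreover have "inverse ((- 1) ^ n) = ((- 1) ^ n :: 'p padic_closure)" for n by (cases "even n") auto
    moreover have "inverse (padic_q powi (e * int b - a * d)) = (padic_q powi (a * d - e * int b) :: 'p padic)"
      by (simp flip: power_int_minus)
    ultimately show ?thesis unfolding N by (simp only: inverse_mult_distrib to_ac_inverse[symmetric])
  qed
  then have N_inv: "inverse N \<in> algebraic_integers \<longleftrightarrow> e * int b \<le> a * d"
    using sgn pow[OF uv(3), of "a * d - e * int b"] by simp
  let ?w = "x ^ b * padic_w powi (- a)"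
  have Px: "poly (lift_padic_poly P) x = ?w" by (rule P)
  have Yx: "poly (lift_padic_poly Y) x = inverse ?w" by (rule Y[OF self_in_conjugates])
  have nP: "?w \<in> algebraic_integers \<Longrightarrow> N \<in> algebraic_integers"
    "?w \<in> algebraic_integers \<Longrightarrow> inverse N \<in> algebraic_integers \<Longrightarrow> inverse ?w \<in> algebraic_integers"
    using conjugates_norm[where k = P and x = x] unfolding Px N_def by blast+
  have nY: "inverse ?w \<in> algebraic_integers \<Longrightarrow> inverse N \<in> algebraic_integers"
    "inverse ?w \<in> algebraic_integers \<Longrightarrow> N \<in> algebraic_integers \<Longrightarrow> ?w \<in> algebraic_integers"
    using conjugates_norm[where k = Y and x = x] unfolding Yx NY inverse_inverse_eq by blast+
  \<comment> \<open>For the converse, suppose that only the inverse of x^b / p^a is integral. Then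
    the inverse of N is integral too, and if N is also integral the criterion for Y makes x^b / p^a
    integral.\<close>
  show "x ^ b * padic_w powi (- a) \<in> algebraic_integers \<longleftrightarrow> a * d \<le> e * int b"
    using nP(1) nY(2) N_int integral_or_inverse_integral[of ?w] by blast
  show "inverse (x ^ b * padic_w powi (- a)) \<in> algebraic_integers \<longleftrightarrow> e * int b \<le> a * d"
    using nY(1) nP(2) N_inv integral_or_inverse_integral[of ?w] by blast
qed

lemma val_0: "val (0 :: 'p::prime_card padic_closure) = \<infinity>"
  using degree_min_poly_pos[of "0 :: 'p padic_closure"] coeff_0_min_poly[of "0 :: 'p padic_closure"]
  by (simp add: val_def padic_val_0)

abbreviation rval :: "'p::prime_card padic_closure \<Rightarrow> real"
  where "rval x \<equiv> real_of_ereal (val x)"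

text \<open>This translates \<open>val\<close> into integrality in both directions. The last claim
  provides exponents b for which b val x is an integer, so that both inequalities can be attained at
  once.\<close>

lemma rval_bounds:
  fixes x :: "'p::prime_card padic_closure"
  assumes x0: "x \<noteq> 0"
  shows "val x = ereal (rval x)"
    and "x ^ b * padic_w powi (- a) \<in> algebraic_integers \<longleftrightarrow> of_int a \<le> real b * rval x"
    and "inverse (x ^ b * padic_w powi (- a)) \<in> algebraic_integers \<longleftrightarrow> real b * rval x \<le> of_int a"
    and "\<exists>e. rval x = of_int e / real (degree (min_poly x))"
proof -
  define d where "d = real (degree (min_poly x))"
  have d: "d > 0" using degree_min_poly_pos[of x] by (simp add: d_def)
  have "coeff (min_poly x) 0 \<noteq> 0" using coeff_0_min_poly x0 by blast
  then obtain e u where c: "coeff (min_poly x) 0 = padic_q powi e * to_fract u" "u dvd 1"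
    using padic_decompose by blast
  have v: "val x = ereal (of_int e / d)"
    unfolding val_def c(1) padic_val_decompose[OF c(2)] d_def using d by (simp add: d_def)
  then show "val x = ereal (rval x)" by simp
  have rv: "rval x = of_int e / d" using v by simp
  then show "\<exists>e. rval x = of_int e / real (degree (min_poly x))" unfolding d_def by blast
  have "a * int (degree (min_poly x)) \<le> e * int b \<longleftrightarrow>
      real_of_int (a * int (degree (min_poly x))) \<le> real_of_int (e * int b)"
    by (simp only: of_int_le_iff)
  also have "\<dots> \<longleftrightarrow> of_int a * d \<le> of_int e * real b" by (simp add: d_def)
  also have "\<dots> \<longleftrightarrow> of_int a \<le> real b * rval x" unfolding rv using d by (simp add: field_simps)
  finally show "x ^ b * padic_w powi (- a) \<in> algebraic_integers \<longleftrightarrow> of_int a \<le> real b * rval x"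
    using integral_power_quotient(1)[OF x0 c] by simp
  have "e * int b \<le> a * int (degree (min_poly x)) \<longleftrightarrow>
      real_of_int (e * int b) \<le> real_of_int (a * int (degree (min_poly x)))"
    by (simp only: of_int_le_iff)
  also have "\<dots> \<longleftrightarrow> of_int e * real b \<le> of_int a * d" by (simp add: d_def)
  also have "\<dots> \<longleftrightarrow> real b * rval x \<le> of_int a" unfolding rv using d by (simp add: field_simps)
  finally show "inverse (x ^ b * padic_w powi (- a)) \<in> algebraic_integers \<longleftrightarrow> real b * rval x \<le> of_int a"
    using integral_power_quotient(2)[OF x0 c] by simp
qed

text \<open>With b clearing both denominators, x^b / p^r and y^b / p^s are units of the ring of
  integral elements. Their product is a unit, which pins down the valuation of x y.\<close>

lemma rval_mult:
  fixes x y :: "'p::prime_card padic_closure"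
  assumes "x \<noteq> 0" "y \<noteq> 0"
  shows "rval (x * y) = rval x + rval y"
proof -
  obtain e where e: "rval x = of_int e / real (degree (min_poly x))" using rval_bounds(4)[OF assms(1)] by blast
  obtain f where f: "rval y = of_int f / real (degree (min_poly y))" using rval_bounds(4)[OF assms(2)] by blast
  define b where "b = degree (min_poly x) * degree (min_poly y)"
  define r where "r = e * int (degree (min_poly y))"
  define s where "s = f * int (degree (min_poly x))"
  have pos: "degree (min_poly x) > 0" "degree (min_poly y) > 0" by (rule degree_min_poly_pos)+
  have bx: "real b * rval x = of_int r" using pos unfolding e b_def r_def by (simp add: field_simps)
  have by': "real b * rval y = of_int s" using pos unfolding f b_def s_def by (simp add: field_simps)
  have "(x * y) ^ b * padic_w powi (- (r + s)) = (x ^ b * padic_w powi (- r)) * (y ^ b * padic_w powi (- s))"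
  proof -
    have "(padic_w :: 'p padic_closure) powi (- (r + s)) = padic_w powi (- r) * padic_w powi (- s)"
      by (metis minus_add_distrib power_int_add padic_w_neq_0)
    then show ?thesis by (simp only: power_mult_distrib mult_ac)
  qed
  moreover have "x ^ b * padic_w powi (- r) \<in> algebraic_integers" "y ^ b * padic_w powi (- s) \<in> algebraic_integers"
      "inverse (x ^ b * padic_w powi (- r)) \<in> algebraic_integers" "inverse (y ^ b * padic_w powi (- s)) \<in> algebraic_integers"
    using rval_bounds(2,3)[OF assms(1)] rval_bounds(2,3)[OF assms(2)] bx by' by auto
  ultimately have "(x * y) ^ b * padic_w powi (- (r + s)) \<in> algebraic_integers"
      "inverse ((x * y) ^ b * padic_w powi (- (r + s))) \<in> algebraic_integers"
    using integral_add_mult(2) by (simp_all only: inverse_mult_distrib)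
  then have "of_int (r + s) \<le> real b * rval (x * y)" "real b * rval (x * y) \<le> of_int (r + s)"
  proof -
    have nz: "x * y \<noteq> 0" using assms by simp
    show "of_int (r + s) \<le> real b * rval (x * y)" "real b * rval (x * y) \<le> of_int (r + s)"
      if "(x * y) ^ b * padic_w powi (- (r + s)) \<in> algebraic_integers"
        "inverse ((x * y) ^ b * padic_w powi (- (r + s))) \<in> algebraic_integers"
      using that rval_bounds(2,3)[OF nz] by blast+
  qed
  then have "real b * rval (x * y) = real b * (rval x + rval y)" using bx by' by (simp add: distrib_left)
  moreover have "real b \<noteq> 0" using pos by (simp add: b_def)
  ultimately show ?thesis using mult_left_cancel by blast
qed

section \<open>The ultrametric absolute value\<close>

text \<open>The absolute value normalised by |p| = 1/p. Being real, with value 0 at 0, it spares all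
  arithmetic with the infinite value of \<open>val\<close>.\<close>

definition nrm :: "'p::prime_card padic_closure \<Rightarrow> real"
  where "nrm x = (if x = 0 then 0 else real CARD('p) powr (- rval x))"

lemma real_card_gt_1: "1 < real CARD('p::prime_card)"
  using card_gt_1[where ?'p='p] by simp

lemma nrm_0 [simp]: "nrm 0 = 0"
  by (simp add: nrm_def)

lemma nrm_eq_0_iff [simp]: "nrm x = 0 \<longleftrightarrow> x = 0"
  using real_card_gt_1[where ?'p='a] by (simp add: nrm_def)

lemma nrm_nonneg [simp]: "0 \<le> nrm x"
  by (simp add: nrm_def)

lemma nrm_pos_iff [simp]: "0 < nrm x \<longleftrightarrow> x \<noteq> 0"
  using nrm_nonneg[of x] nrm_eq_0_iff[of x] by linarith

lemma nrm_mult: "nrm (x * y) = nrm x * nrm y"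
  by (auto simp: nrm_def rval_mult powr_add[symmetric])

lemma nrm_le_1_iff: "nrm x \<le> 1 \<longleftrightarrow> x \<in> algebraic_integers"
proof (cases "x = 0")
  case False
  then have "x \<in> algebraic_integers \<longleftrightarrow> 0 \<le> rval x" using rval_bounds(2)[of x 1 0] by simp
  then show ?thesis using False real_card_gt_1[where ?'p='a]
      powr_le_cancel_iff[of "real CARD('a)" "- rval x" 0] by (simp add: nrm_def)
qed (simp add: integral_0)

lemma nrm_1 [simp]: "nrm 1 = 1"
  using nrm_mult[of 1 1] nrm_eq_0_iff[of 1] by (metis mult.right_neutral mult_cancel_left zero_neq_one)

lemma nrm_power: "nrm (x ^ n) = nrm x ^ n"
  by (induction n) (simp_all add: nrm_mult)

lemma nrm_minus [simp]: "nrm (- x) = nrm x"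
proof -
  have "nrm (- 1 :: 'a padic_closure) ^ 2 = 1" unfolding nrm_power[symmetric] by simp
  then have "nrm (- 1 :: 'a padic_closure) = 1" using nrm_nonneg[of "- 1 :: 'a padic_closure"]
    by (metis abs_of_nonneg power2_eq_1_iff real_sqrt_abs real_sqrt_one)
  then show ?thesis using nrm_mult[of "- 1" x] by simp
qed

lemma nrm_minus_commute: "nrm (x - y) = nrm (y - x)"
  using nrm_minus[of "x - y"] by simp

text \<open>Divide by the larger summand y: the quotient x / y is integral, and so is 1 + x / y
  because the integral elements form a ring.\<close>

lemma nrm_add: "nrm (x + y) \<le> max (nrm x) (nrm y)"
proof -
  have *: "nrm (x + y) \<le> nrm y" if "nrm x \<le> nrm y" "y \<noteq> 0" for x y :: "'a padic_closure"
  proof -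
    have "nrm (x / y) * nrm y = nrm x" using that by (simp flip: nrm_mult)
    then have "nrm (x / y) * nrm y \<le> 1 * nrm y" using that by simp
    then have "nrm (x / y) \<le> 1" by (rule mult_right_le_imp_le) (use that in simp)
    then have "nrm (1 + x / y) \<le> 1" unfolding nrm_le_1_iff by (intro integral_add_mult integral_1)
    moreover have "x + y = (1 + x / y) * y" using that by (simp add: field_simps)
    then have "nrm (x + y) = nrm (1 + x / y) * nrm y" by (metis nrm_mult)
    ultimately show ?thesis by (simp add: mult_left_le_one_le)
  qed
  show ?thesis
  proof (cases "x = 0 \<or> y = 0")
    case False
    then show ?thesis using *[of x y] *[of y x] by (cases "nrm x \<le> nrm y") (auto simp: add.commute)
  qed auto
qed

lemma nrm_add_le: "nrm x \<le> c \<Longrightarrow> nrm y \<le> c \<Longrightarrow> nrm (x + y) \<le> c"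
  using nrm_add[of x y] by linarith

lemma nrm_add_less: "nrm x < c \<Longrightarrow> nrm y < c \<Longrightarrow> nrm (x + y) < c"
  using nrm_add[of x y] by linarith

lemma nrm_diff_less: "nrm x < c \<Longrightarrow> nrm y < c \<Longrightarrow> nrm (x - y) < c"
  using nrm_add_less[of x c "- y"] by simp

lemma nrm_triangle: "nrm (x - z) \<le> max (nrm (x - y)) (nrm (y - z))"
  using nrm_add[of "x - y" "y - z"] by simp

lemma nrm_triangle_less: "nrm (x - y) < c \<Longrightarrow> nrm (y - z) < c \<Longrightarrow> nrm (x - z) < c"
  using nrm_triangle[of x z y] by linarith

lemma nrm_mult_le: "nrm x \<le> 1 \<Longrightarrow> nrm y \<le> c \<Longrightarrow> nrm (x * y) \<le> c"
  using mult_mono[of "nrm x" 1 "nrm y" c] by (simp add: nrm_mult)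

lemma nrm_prod_mset: "nrm (\<Prod>y\<in>#A. f y) = (\<Prod>y\<in>#A. nrm (f y))"
  by (induction A) (simp_all add: nrm_mult)

lemma val_less_iff: "ereal r < val y \<longleftrightarrow> nrm y < real CARD('p) powr (- r)"
  for y :: "'p::prime_card padic_closure"
proof (cases "y = 0")
  case True
  then show ?thesis using real_card_gt_1[where ?'p='p] by (simp add: val_0)
next
  case False
  have "ereal r < val y \<longleftrightarrow> r < rval y" using rval_bounds(1)[OF False] by (metis less_ereal.simps(1))
  also have "\<dots> \<longleftrightarrow> nrm y < real CARD('p) powr (- r)"
    using False real_card_gt_1[where ?'p='p] by (simp add: nrm_def)
  finally show ?thesis .
qed

lemma nrm_min_poly: "min_poly x = min_poly y \<Longrightarrow> nrm x = nrm y"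
  unfolding nrm_def val_def using coeff_0_min_poly[of x] coeff_0_min_poly[of y] by simp

lemma nrm_padic_w: "nrm (padic_w :: 'p::prime_card padic_closure) = 1 / real CARD('p)"
proof -
  have "rval (padic_w :: 'p padic_closure) = 1"
  proof -
    have "(padic_w :: 'p padic_closure) ^ 1 * padic_w powi (- 1) = 1"
      using padic_w_neq_0[where ?'p='p] by (simp add: power_int_minus)
    then show ?thesis
      using rval_bounds(2,3)[OF padic_w_neq_0[where ?'p='p], of 1 1] by (simp add: integral_1)
  qed
  then show ?thesis using padic_w_neq_0[where ?'p='p] real_card_gt_1[where ?'p='p]
    by (simp add: nrm_def powr_minus divide_inverse)
qed

lemma embed_p_power: "embed (padic_p ^ k) = (padic_w ^ k :: 'p::prime_card padic_closure)"
  by (simp add: embed.hom_power embed.hom_of_nat)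

lemma nrm_embed_p_power: "nrm (embed (padic_p ^ k) :: 'p::prime_card padic_closure) = (1 / real CARD('p)) ^ k"
  unfolding embed_p_power nrm_power nrm_padic_w ..

lemma nrm_embed_unit: "u dvd 1 \<Longrightarrow> nrm (embed u) = 1"
proof -
  assume "u dvd 1"
  then obtain v where "u * v = 1" by (metis dvdE)
  then have "nrm (embed u) * nrm (embed v) = 1" by (metis embed.hom_mult embed.hom_one nrm_1 nrm_mult)
  moreover have "nrm (embed u) \<le> 1" "nrm (embed v) \<le> 1" using integral_embed nrm_le_1_iff by blast+
  ultimately show ?thesis
    by (metis mult_left_le nrm_nonneg order_antisym)
qed

lemma nrm_embed_neq_0:
  assumes "z \<noteq> 0"
  obtains k where "nrm (embed z :: 'p::prime_card padic_closure) = (1 / real CARD('p)) ^ k"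
proof -
  obtain k u where "z = padic_p ^ k * u" "u dvd 1" using padic_int_decompose[OF assms] .
  then have "nrm (embed z :: 'p padic_closure) = (1 / real CARD('p)) ^ k"
    by (simp only: embed.hom_mult nrm_mult nrm_embed_p_power nrm_embed_unit mult.right_neutral)
  then show thesis by (rule that)
qed

section \<open>Roots of monic polynomials\<close>

abbreviation ipoly :: "'p::prime_card padic_int poly \<Rightarrow> 'p padic_closure \<Rightarrow> 'p padic_closure"
  where "ipoly P \<equiv> poly (map_poly embed P)"

abbreviation iroots :: "'p::prime_card padic_int poly \<Rightarrow> 'p padic_closure multiset"
  where "iroots P \<equiv> proots (map_poly embed P)"

lemma in_iroots_iff: "lead_coeff P = 1 \<Longrightarrow> x \<in># iroots P \<longleftrightarrow> ipoly P x = 0"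
  using monic_neq_0[of P] by simp

lemma iroot_integral: "lead_coeff P = 1 \<Longrightarrow> ipoly P x = 0 \<Longrightarrow> x \<in> algebraic_integers"
  unfolding integral_iff by blast

lemma ipoly_eq_prod: "lead_coeff P = 1 \<Longrightarrow> ipoly P y = (\<Prod>x\<in>#iroots P. y - x)"
  by (rule poly_eq_prod_proots) simp

lemma size_iroots: "lead_coeff P = 1 \<Longrightarrow> size (iroots P) = degree P"
  using monic_eq_prod_proots(2)[of "map_poly embed P"] by simp

lemma nrm_ipoly_cong:
  fixes P P' :: "'p::prime_card padic_int poly"
  assumes "[:padic_p ^ k:] dvd P - P'" "y \<in> algebraic_integers"
  shows "nrm (ipoly P y - ipoly P' y) \<le> (1 / real CARD('p)) ^ k"
proof -
  obtain R where "P - P' = [:padic_p ^ k:] * R" using assms(1) by (elim dvdE)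
  then have "map_poly embed P - map_poly embed P' = map_poly embed (smult (padic_p ^ k) R)"
    by (simp flip: map_poly_embed.hom_minus)
  then have "ipoly P y - ipoly P' y = embed (padic_p ^ k) * ipoly R y"
    by (metis embed.map_poly_hom_smult poly_diff poly_smult)
  moreover have "nrm (ipoly R y) \<le> 1" using integral_poly[OF assms(2)] nrm_le_1_iff by blast
  ultimately show ?thesis by (simp only: nrm_mult nrm_embed_p_power) (simp add: mult_left_le)
qed

lemma nrm_ipoly_diff:
  assumes "x \<in> algebraic_integers" "y \<in> algebraic_integers"
  shows "nrm (ipoly Q x - ipoly Q y) \<le> nrm (x - y)"
proof (induction Q)
  case (pCons a Q)
  have "ipoly (pCons a Q) x - ipoly (pCons a Q) y = (x - y) * ipoly Q x + y * (ipoly Q x - ipoly Q y)"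
    by (simp add: embed.map_poly_pCons_hom algebra_simps)
  moreover have "nrm ((x - y) * ipoly Q x) \<le> nrm (x - y)"
    using integral_poly[OF assms(1)] by (simp add: nrm_mult mult_left_le nrm_le_1_iff)
  moreover have "nrm (y * (ipoly Q x - ipoly Q y)) \<le> nrm (x - y)"
    using pCons.IH assms(2) by (intro nrm_mult_le) (simp_all add: nrm_le_1_iff)
  ultimately show ?case by (simp only: nrm_add_le)
qed simp

lemma prod_mset_ge_power: "(\<And>x. x \<in># A \<Longrightarrow> s \<le> f x) \<Longrightarrow> 0 \<le> s \<Longrightarrow> s ^ size A \<le> (\<Prod>x\<in>#A. f x)"
  for s :: real
proof (induction A)
  case (add a A)
  have "s * s ^ size A \<le> f a * (\<Prod>x\<in>#A. f x)"
    using add by (intro mult_mono) (auto intro: order_trans)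
  then show ?case by simp
qed simp

text \<open>|P(y)| is the product of the distances from y to the deg P roots, so they cannot all be
  at least s. All continuity of roots below comes from this estimate.\<close>

lemma near_root:
  assumes P: "lead_coeff P = 1" and s: "0 \<le> s" "nrm (ipoly P y) < s ^ degree P"
  obtains x where "ipoly P x = 0" "nrm (y - x) < s"
proof (rule ccontr)
  assume "\<not> thesis"
  then have "\<And>x. x \<in># iroots P \<Longrightarrow> s \<le> nrm (y - x)" using that in_iroots_iff[OF P] by (meson not_less)
  then have "s ^ degree P \<le> nrm (ipoly P y)"
    unfolding ipoly_eq_prod[OF P] nrm_prod_mset size_iroots[OF P, symmetric]
    using s(1) by (intro prod_mset_ge_power) auto
  then show False using s by simp
qed

lemma poly_with_coeffs:
  fixes m :: "'a::zero poly" and c :: "nat \<Rightarrow> 'b::comm_monoid_add"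
  obtains Q where "\<And>i. coeff Q i = (if i \<le> n then c i else 0)"
proof
  show "coeff (\<Sum>i\<le>n. monom (c i) i) i = (if i \<le> n then c i else 0)" for i
    by (simp add: coeff_sum coeff_monom)
qed

text \<open>The conjugates of an integral element are integral, hence so are the coefficients of the
  product of their linear factors; lying in Q_p, these are in Z_p.\<close>

lemma integral_min_poly:
  fixes x :: "'p::prime_card padic_closure"
  assumes "x \<in> algebraic_integers"
  obtains Q where "map_poly to_fract Q = min_poly x" "lead_coeff Q = 1"
proof -
  have int: "coeff (\<Prod>a\<in>#A. [:- a, 1:]) i \<in> algebraic_integers"
    if "\<And>a. a \<in># A \<Longrightarrow> a \<in> algebraic_integers" for A :: "'p padic_closure multiset" and i
    using that
  proof (induction A arbitrary: i)
    case empty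
    then show ?case by (simp add: integral_0 integral_1)
  next
    case (add a A)
    define P where "P = (\<Prod>a\<in>#A. [:- a, 1:])"
    have P: "coeff P j \<in> algebraic_integers" for j using add unfolding P_def by simp
    have "a \<in> algebraic_integers" using add.prems by simp
    then have "coeff (smult (- a) P + pCons 0 P) i \<in> algebraic_integers"
      using P by (cases i) (auto intro!: integral_add_mult integral_diff integral_uminus)
    then show ?case by (simp add: P_def)
  qed
  have conj: "y \<in> algebraic_integers" if "y \<in># conjugates x" for y
    using conjugate_integral[OF that, of "[:0, 1:]"] assms by (simp add: to_ac.map_poly_pCons_hom)
  have "to_ac (coeff (min_poly x) i) \<in> algebraic_integers" for i
    using int[of "conjugates x" i] conj monic_eq_prod_proots(1)[OF lift_min_poly_monic[of x]] by simp
  then have "\<exists>z. coeff (min_poly x) i = to_fract z" for i using integral_to_ac by metis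
  then obtain z where z: "\<And>i. coeff (min_poly x) i = to_fract (z i)" by metis
  obtain Q where Q: "\<And>i. coeff Q i = (if i \<le> degree (min_poly x) then z i else 0)"
    using poly_with_coeffs[of "degree (min_poly x)" z] by blast
  have *: "map_poly to_fract Q = min_poly x"
    by (intro poly_eqI) (auto simp: Q z[symmetric] coeff_eq_0)
  moreover have "to_fract (lead_coeff Q) = 1" using min_poly(1)[of x] unfolding *[symmetric] by simp
  ultimately show thesis using that by (metis to_fract.hom_one to_fract_eq_iff)
qed

text \<open>Gauss's lemma in the form required: division by the monic Q stays inside Z_p[x], and the
  remainder vanishes at x with a degree below that of the minimal polynomial.\<close>

lemma integral_min_poly_dvd:
  fixes P Q :: "'p::prime_card padic_int poly"
  assumes Q: "map_poly to_fract Q = min_poly x" "lead_coeff Q = 1" and P: "ipoly P x = 0"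
  shows "Q dvd P"
proof -
  define s where "s = degree Q"
  have Qs: "coeff Q s = 1" "\<And>i. i > s \<Longrightarrow> coeff Q i = 0" using Q(2) by (auto simp: s_def coeff_eq_0)
  obtain q r where qr: "P = Q * q + r" "\<And>i. i \<ge> s \<Longrightarrow> coeff r i = 0"
    by (rule monic_division[OF Qs, of "Suc (degree P)" P]) (auto simp: coeff_eq_0)
  have Qx: "ipoly Q x = 0" unfolding lift_poly_embed[symmetric] Q(1) by (rule min_poly(3))
  have "ipoly r x = 0" using P Qx unfolding qr(1) by (simp add: map_poly_embed.hom_add map_poly_embed.hom_mult)
  then have "min_poly x dvd map_poly to_fract r" by (intro min_poly_dvd) (simp only: lift_poly_embed)
  have "r = 0"
  proof (rule ccontr)
    assume "r \<noteq> 0"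
    then have "map_poly to_fract r \<noteq> 0" by simp
    with \<open>min_poly x dvd map_poly to_fract r\<close> have "degree (min_poly x) \<le> degree (map_poly to_fract r)"
      by (rule dvd_imp_degree_le)
    then have "s \<le> degree r" unfolding s_def Q(1)[symmetric] by simp
    then show False using qr(2) \<open>r \<noteq> 0\<close> by (metis leading_coeff_0_iff)
  qed
  then show ?thesis using qr(1) by simp
qed

section \<open>Reduction modulo p\<close>

lemma map_poly_residue_eq_iff:
  "map_poly residue_mod_p A = map_poly residue_mod_p B \<longleftrightarrow> [:padic_p:] dvd A - (B :: 'p::prime_card padic_int poly)"
  unfolding const_poly_dvd_iff poly_eq_iff by (simp add: residue_mod_p_eq_iff)

lemma monic_map_poly_residue: "lead_coeff Q = 1 \<Longrightarrow> lead_coeff (map_poly residue_mod_p Q) = 1"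
proof -
  assume "lead_coeff Q = 1"
  then have c: "coeff (map_poly residue_mod_p Q) (degree Q) = 1" by simp
  then have "degree Q \<le> degree (map_poly residue_mod_p Q)" by (intro le_degree) auto
  then have "degree (map_poly residue_mod_p Q) = degree Q" by (simp add: degree_map_poly_le order_antisym)
  then show ?thesis using c by simp
qed

lemma residue_poly_lift:
  fixes f :: "'p::prime_card mod_ring poly"
  obtains Q where "map_poly residue_mod_p Q = f" "degree Q = degree f" "lead_coeff f = 1 \<Longrightarrow> lead_coeff Q = 1"
proof -
  obtain g :: "'p mod_ring \<Rightarrow> 'p padic_int" where g: "\<And>a. residue_mod_p (g a) = a"
    using residue_mod_p_surj by metis
  \<comment> \<open>Lifting 0 to 0 and 1 to 1 preserves the degree and a leading coefficient
    1.\<close>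
  define h where "h a = (if a = 1 then 1 else if a = 0 then 0 else g a)" for a
  have h: "residue_mod_p (h a) = a" "h a = 0 \<longleftrightarrow> a = 0" for a
  proof -
    show "residue_mod_p (h a) = a" using g[of a] by (simp add: h_def)
    then show "h a = 0 \<longleftrightarrow> a = 0" by (auto simp: h_def)
  qed
  have "map_poly residue_mod_p (map_poly h f) = f"
    by (intro poly_eqI) (simp add: coeff_map_poly h)
  moreover have "degree (map_poly h f) = degree f"
    by (rule degree_map_poly) (simp add: h)
  moreover have "lead_coeff (map_poly h f) = 1" if "lead_coeff f = 1"
    using that \<open>degree (map_poly h f) = degree f\<close> by (simp add: coeff_map_poly h) (simp add: h_def)
  ultimately show thesis using that by blast
qed

lemma nrm_ipoly_cong_p_less_1:
  fixes P P' :: "'p::prime_card padic_int poly"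
  assumes "[:padic_p:] dvd P - P'" "y \<in> algebraic_integers"
  shows "nrm (ipoly P y - ipoly P' y) < 1"
  using nrm_ipoly_cong[of 1 P P' y] assms real_card_gt_1[where ?'p='p]
  by (simp add: order_le_less_trans)

text \<open>A condition on the whole minimal polynomial becomes one inequality at \<alpha>, stable
  under small changes of \<alpha>. If the reduction had a factor B prime to f, a root of a lift of B
  would lie close to a conjugate \<beta> of \<alpha>, and lifts of both f and B would be small at
  \<beta>, against a Bezout relation.\<close>

lemma U_set_iff:
  fixes f :: "'p::prime_card mod_ring poly" and f' :: "'p padic_int poly"
  assumes f: "lead_coeff f = 1" "irreducible f" and f': "map_poly residue_mod_p f' = f"
  shows "\<alpha> \<in> U_set f \<longleftrightarrow> \<alpha> \<in> algebraic_integers \<and> nrm (ipoly f' \<alpha>) < 1"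
proof
  assume \<alpha>: "\<alpha> \<in> U_set f"
  then have int: "\<alpha> \<in> algebraic_integers" by (simp add: U_set_def)
  obtain Q k where Q: "map_poly to_fract Q = min_poly \<alpha>" "map_poly residue_mod_p Q = f ^ k"
    using \<alpha> by (auto simp: U_set_def)
  interpret r: map_poly_comm_ring_hom "residue_mod_p :: 'p padic_int \<Rightarrow> 'p mod_ring" ..
  have "map_poly residue_mod_p Q = map_poly residue_mod_p (f' ^ k)" using Q(2) f' by (simp add: r.hom_power)
  then have "[:padic_p:] dvd Q - f' ^ k" unfolding map_poly_residue_eq_iff .
  then have "nrm (ipoly Q \<alpha> - ipoly (f' ^ k) \<alpha>) < 1" using int by (rule nrm_ipoly_cong_p_less_1)
  moreover have "ipoly Q \<alpha> = 0" unfolding lift_poly_embed[symmetric] Q(1) by (rule min_poly(3))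
  ultimately have "nrm (ipoly f' \<alpha>) ^ k < 1" by (simp add: map_poly_embed.hom_power nrm_power)
  then have "nrm (ipoly f' \<alpha>) < 1" by (meson not_less one_le_power)
  then show "\<alpha> \<in> algebraic_integers \<and> nrm (ipoly f' \<alpha>) < 1" using int by blast
next
  assume \<alpha>: "\<alpha> \<in> algebraic_integers \<and> nrm (ipoly f' \<alpha>) < 1"
  interpret r: map_poly_comm_ring_hom "residue_mod_p :: 'p padic_int \<Rightarrow> 'p mod_ring" ..
  obtain Q where Q: "map_poly to_fract Q = min_poly \<alpha>" "lead_coeff Q = 1"
    using integral_min_poly \<alpha> by blast
  have Q1: "lead_coeff (map_poly residue_mod_p Q) = 1" using monic_map_poly_residue[OF Q(2)] .
  \<comment> \<open>Once the full power of f is split off, the cofactor B is monic and prime to f;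
    it remains to see that B = 1.\<close>
  define k where "k = multiplicity f (map_poly residue_mod_p Q)"
  obtain B where B: "map_poly residue_mod_p Q = f ^ k * B" "\<not> f dvd B"
    using multiplicity_decompose'[OF monic_neq_0[OF Q1] irreducible_not_unit[OF f(2)]] unfolding k_def by blast
  have "lead_coeff (f ^ k) = 1" using f(1) by (simp add: lead_coeff_power)
  then have B1: "lead_coeff B = 1" using Q1 unfolding B(1) lead_coeff_mult by simp
  have cop: "coprime f B"
  proof (rule coprimeI)
    fix c assume c: "c dvd f" "c dvd B"
    then obtain j where j: "f = c * j" by (elim dvdE)
    have "\<not> j dvd 1"
    proof
      assume "j dvd 1"
      then have "f dvd c" unfolding j by (simp add: mult_unit_dvd_iff)
      then show False using c(2) B(2) dvd_trans by blast
    qed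
    then show "c dvd 1" using Factorial_Ring.irreducibleD[OF f(2) j] by blast
  qed
  obtain b where b: "map_poly residue_mod_p b = B" "degree b = degree B" "lead_coeff b = 1"
    using residue_poly_lift[of B] B1 by metis
  have "B = 1"
  proof (rule ccontr)
    assume "B \<noteq> 1"
    then have "degree (map_poly embed b) > 0" using B1 b(2) monic_degree_0[of B] by auto
    then obtain \<gamma> where \<gamma>: "ipoly b \<gamma> = 0" using alg_closed_imp_poly_has_root by blast
    have int: "\<gamma> \<in> algebraic_integers" using iroot_integral[OF b(3) \<gamma>] .
    have "map_poly residue_mod_p Q = map_poly residue_mod_p (f' ^ k * b)"
      using B(1) f' b(1) by (simp add: r.hom_power r.hom_mult)
    then have "[:padic_p:] dvd Q - f' ^ k * b" unfolding map_poly_residue_eq_iff .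
    from nrm_ipoly_cong_p_less_1[OF this int] have "nrm (ipoly Q \<gamma>) < 1 ^ degree Q"
      using \<gamma> by (simp add: map_poly_embed.hom_mult)
    then obtain \<beta> where \<beta>: "ipoly Q \<beta> = 0" "nrm (\<gamma> - \<beta>) < 1"
      using near_root[OF Q(2), of 1 \<gamma>] by auto
    have \<beta>_int: "\<beta> \<in> algebraic_integers" using iroot_integral[OF Q(2) \<beta>(1)] .
    have "\<beta> \<in># conjugates \<alpha>" unfolding in_conjugates_iff using \<beta>(1) by (simp only: lift_poly_embed flip: Q(1))
    then have "nrm (ipoly f' \<beta>) = nrm (ipoly f' \<alpha>)"
      using nrm_min_poly[OF min_poly_poly_conjugate[of \<beta> \<alpha> "map_poly to_fract f'"]] by (simp only: lift_poly_embed)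
    then have 1: "nrm (ipoly f' \<beta>) < 1" using \<alpha> by simp
    have "nrm (ipoly b \<gamma> - ipoly b \<beta>) < 1"
      using nrm_ipoly_diff[OF int \<beta>_int, of b] \<beta>(2) by simp
    then have 2: "nrm (ipoly b \<beta>) < 1" using \<gamma> by simp
    \<comment> \<open>At \<beta> the lifted combination differs from 1 by less than 1 in norm, while
      both of its summands have norm below 1.\<close>
    obtain s t where st: "s * f + t * B = 1"
      using bezout_coefficients_fst_snd[of f B] cop by (metis coprime_iff_gcd_eq_1)
    obtain s' t' where s't': "map_poly residue_mod_p s' = s" "map_poly residue_mod_p t' = t"
      using residue_poly_lift by metis
    have "map_poly residue_mod_p (s' * f' + t' * b) = map_poly residue_mod_p 1"
      using st s't' f' b(1) by (simp add: r.hom_add r.hom_mult)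
    then have "[:padic_p:] dvd (s' * f' + t' * b) - 1" unfolding map_poly_residue_eq_iff .
    from nrm_ipoly_cong_p_less_1[OF this \<beta>_int]
    have 3: "nrm (ipoly (s' * f' + t' * b) \<beta> - 1) < 1" by simp
    have "nrm (ipoly s' \<beta> * ipoly f' \<beta>) < 1" "nrm (ipoly t' \<beta> * ipoly b \<beta>) < 1"
      using nrm_mult_le[OF _ order_refl] integral_poly[OF \<beta>_int] 1 2 unfolding nrm_le_1_iff[symmetric]
      by (meson order_le_less_trans)+
    then have "nrm (ipoly (s' * f' + t' * b) \<beta>) < 1"
      by (simp add: map_poly_embed.hom_add map_poly_embed.hom_mult nrm_add_less)
    from nrm_diff_less[OF this 3] show False by simp
  qed
  then show "\<alpha> \<in> U_set f" using \<alpha> Q(1) B(1) by (auto simp: U_set_def)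
qed

section \<open>The space of polynomials\<close>

locale poly_family =
  fixes F :: "nat \<Rightarrow> 'p::prime_card mod_ring poly" and S :: "nat set"
  assumes F_monic: "i \<in> S \<Longrightarrow> lead_coeff (F i) = 1"
    and F_irreducible: "i \<in> S \<Longrightarrow> irreducible (F i)"
begin

abbreviation "PS \<equiv> poly_space F S"

definition admissible :: "'p padic_closure \<Rightarrow> bool"
  where "admissible \<alpha> \<longleftrightarrow> \<alpha> \<in> (\<Union>i\<in>S. U_set (F i))"

lemma poly_space_iff: "P \<in> PS \<longleftrightarrow> lead_coeff P = 1 \<and> (\<forall>\<alpha>. ipoly P \<alpha> = 0 \<longrightarrow> admissible \<alpha>)"
  by (simp add: poly_space_def lift_poly_embed admissible_def)

lemma poly_space_monic: "P \<in> PS \<Longrightarrow> lead_coeff P = 1"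
  by (simp add: poly_space_iff)

lemma admissible_near:
  assumes "admissible \<alpha>" "\<beta> \<in> algebraic_integers" "nrm (\<alpha> - \<beta>) < 1"
  shows "admissible \<beta>"
proof -
  obtain i where i: "i \<in> S" "\<alpha> \<in> U_set (F i)" using assms(1) by (auto simp: admissible_def)
  obtain f' where f': "map_poly residue_mod_p f' = F i" using residue_poly_lift by metis
  note U = U_set_iff[OF F_monic[OF i(1)] F_irreducible[OF i(1)] f']
  have "nrm (ipoly f' \<alpha> - ipoly f' \<beta>) < 1"
    using nrm_ipoly_diff[of \<alpha> \<beta> f'] assms U[of \<alpha>] i(2) by (simp add: order_le_less_trans)
  then have "nrm (ipoly f' \<beta>) < 1"
    using nrm_diff_less[of "ipoly f' \<alpha>" 1 "ipoly f' \<alpha> - ipoly f' \<beta>"] U[of \<alpha>] i(2) by simp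
  then have "\<beta> \<in> U_set (F i)" using U[of \<beta>] assms(2) by simp
  then show ?thesis using i(1) by (auto simp: admissible_def)
qed

text \<open>Every root of P' has distance below 1 from a root of P. Among monic polynomials,
  membership is thus decided modulo p, which keeps A + p^k and limits of congruent sequences inside
  the space.\<close>

lemma poly_space_cong:
  assumes "P \<in> PS" "lead_coeff P' = 1" "[:padic_p:] dvd P' - P"
  shows "P' \<in> PS"
  unfolding poly_space_iff
proof (intro conjI allI impI)
  fix \<beta> assume \<beta>: "ipoly P' \<beta> = 0"
  have int: "\<beta> \<in> algebraic_integers" using iroot_integral[OF assms(2) \<beta>] .
  have "nrm (ipoly P \<beta>) < 1 ^ degree P" using nrm_ipoly_cong_p_less_1[OF assms(3) int] \<beta> by simp
  then obtain \<alpha> where "ipoly P \<alpha> = 0" "nrm (\<beta> - \<alpha>) < 1"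
    using near_root[OF poly_space_monic[OF assms(1)], of 1 \<beta>] by auto
  then show "admissible \<beta>"
    using admissible_near[OF _ int] assms(1) nrm_minus_commute[of \<alpha> \<beta>] by (auto simp: poly_space_iff)
qed (rule assms(2))

lemma poly_space_1: "1 \<in> PS"
  by (simp add: poly_space_iff)

lemma poly_space_mult: "P \<in> PS \<Longrightarrow> Q \<in> PS \<Longrightarrow> P * Q \<in> PS"
  by (auto simp: poly_space_iff map_poly_embed.hom_mult lead_coeff_mult)

lemma poly_space_factor: "P * Q \<in> PS \<Longrightarrow> lead_coeff P = 1 \<Longrightarrow> P \<in> PS"
  by (auto simp: poly_space_iff map_poly_embed.hom_mult)

end

section \<open>Resultants\<close>

lemma prod_mset_diff_swap:
  "(\<Prod>x\<in>#A. \<Prod>y\<in>#B. x - y) = (- 1) ^ (size A * size B) * (\<Prod>y\<in>#B. \<Prod>x\<in>#A. y - x)"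
  for A :: "'a::comm_ring_1 multiset"
proof -
  have "(\<Prod>y\<in>#B. x - y) = (- 1) ^ size B * (\<Prod>y\<in>#B. y - x)" for x
    by (induction B) (auto simp: algebra_simps)
  then have "(\<Prod>x\<in>#A. \<Prod>y\<in>#B. x - y) = (- 1) ^ (size A * size B) * (\<Prod>x\<in>#A. \<Prod>y\<in>#B. y - x)"
    by (simp add: prod_mset.distrib power_mult[symmetric] mult.commute)
  also have "(\<Prod>x\<in>#A. \<Prod>y\<in>#B. y - x) = (\<Prod>y\<in>#B. \<Prod>x\<in>#A. y - x)"
    by (rule prod_mset.swap)
  finally show ?thesis .
qed

lemma range_to_ac_mult: "a \<in> range to_ac \<Longrightarrow> b \<in> range to_ac \<Longrightarrow> a * b \<in> range to_ac"
proof -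
  assume "a \<in> range to_ac" "b \<in> range to_ac"
  then obtain x y where "a = to_ac x" "b = to_ac y" by blast
  then have "a * b = to_ac (x * y)" by simp
  then show ?thesis by (rule range_eqI)
qed

lemma range_to_ac_power_minus_1: "(- 1) ^ n \<in> range (to_ac :: 'a::field \<Rightarrow> _)"
  by (metis rangeI to_ac_1 to_ac_minus to_ac_power)

text \<open>The Euclidean algorithm: Z is reduced modulo P, and then P and Z are exchanged.\<close>

lemma prod_proots_rational:
  fixes P Z :: "'p::prime_card padic poly"
  assumes "lead_coeff P = 1"
  shows "(\<Prod>x\<in>#proots (lift_padic_poly P). poly (lift_padic_poly Z) x) \<in> range to_ac"
  using assms
proof (induction "degree P" arbitrary: P Z rule: less_induct)
  case less
  define A where "A = proots (lift_padic_poly P)"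
  have mP: "lead_coeff (lift_padic_poly P) = 1" using less.prems by simp
  have P0: "P \<noteq> 0" using less.prems by auto
  define Z' where "Z' = Z mod P"
  have Z': "poly (lift_padic_poly Z) x = poly (lift_padic_poly Z') x" if "x \<in># A" for x
  proof -
    have "poly (lift_padic_poly P) x = 0" using that monic_neq_0[OF mP] by (simp add: A_def)
    moreover have "lift_padic_poly Z = lift_padic_poly (Z div P) * lift_padic_poly P + lift_padic_poly Z'"
      unfolding Z'_def by (metis div_mult_mod_eq map_poly_to_ac.hom_add map_poly_to_ac.hom_mult)
    ultimately show ?thesis by simp
  qed
  then have eq: "(\<Prod>x\<in>#A. poly (lift_padic_poly Z) x) = (\<Prod>x\<in>#A. poly (lift_padic_poly Z') x)"
    by (intro arg_cong[of _ _ prod_mset] image_mset_cong) auto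
  show ?case
  proof (cases "Z' = 0")
    case True
    have "(\<Prod>x\<in>#A. poly (lift_padic_poly Z') x) = to_ac (0 ^ size A)"
      by (simp add: True prod_mset_constant)
    then show ?thesis using eq unfolding A_def by (metis rangeI)
  next
    case False
    define c where "c = lead_coeff Z'"
    define W where "W = smult (inverse c) Z'"
    have c: "c \<noteq> 0" using False by (simp add: c_def)
    have W: "lead_coeff W = 1" "Z' = smult c W" "degree W = degree Z'"
      using c by (simp_all add: W_def c_def)
    have deg: "degree W < degree P"
      using degree_mod_less[OF P0, of Z] False W(3) unfolding Z'_def by simp
    define B where "B = proots (lift_padic_poly W)"
    have mW: "lead_coeff (lift_padic_poly W) = 1" using W(1) by simp
    have "(\<Prod>x\<in>#A. poly (lift_padic_poly Z') x) = to_ac (c ^ size A) * (\<Prod>x\<in>#A. poly (lift_padic_poly W) x)"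
      by (simp add: W(2) to_ac.map_poly_hom_smult prod_mset.distrib prod_mset_constant)
    also have "(\<Prod>x\<in>#A. poly (lift_padic_poly W) x) = (\<Prod>x\<in>#A. \<Prod>y\<in>#B. x - y)"
      unfolding B_def poly_eq_prod_proots[OF mW] ..
    also have "\<dots> = (- 1) ^ (size A * size B) * (\<Prod>y\<in>#B. \<Prod>x\<in>#A. y - x)"
      by (rule prod_mset_diff_swap)
    also have "(\<Prod>y\<in>#B. \<Prod>x\<in>#A. y - x) = (\<Prod>y\<in>#B. poly (lift_padic_poly P) y)"
      unfolding A_def poly_eq_prod_proots[OF mP] ..
    finally have E: "(\<Prod>x\<in>#A. poly (lift_padic_poly Z') x) = to_ac (c ^ size A) *
        ((- 1) ^ (size A * size B) * (\<Prod>y\<in>#B. poly (lift_padic_poly P) y))" .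
    show ?thesis unfolding A_def[symmetric] eq E
      using less.hyps[OF deg W(1), of P] unfolding B_def[symmetric]
      by (intro range_to_ac_mult rangeI range_to_ac_power_minus_1)
  qed
qed

lemma Res_lift_poly:
  assumes "lead_coeff P = 1" "lead_coeff Z = 1"
  shows "Res (lift_poly P) (lift_poly Z) = (\<Prod>x\<in>#iroots P. ipoly Z x)"
  unfolding Res_def lift_poly_embed ipoly_eq_prod[OF assms(2)] using assms by simp

lemma Res_lift_poly_swap:
  assumes "lead_coeff P = 1" "lead_coeff Z = 1"
  shows "nrm (\<Prod>x\<in>#iroots P. ipoly Z x) = nrm (\<Prod>y\<in>#iroots Z. ipoly P y)"
proof -
  have "nrm ((- 1) ^ n * z) = nrm z" for n and z :: "'a padic_closure" by (cases "even n") auto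
  then show ?thesis
    unfolding ipoly_eq_prod[OF assms(2)] ipoly_eq_prod[OF assms(1)] by (subst prod_mset_diff_swap) simp
qed

text \<open>The resultant lies in Q_p and is integral, and Z_p is integrally closed.\<close>

lemma Res_rational:
  fixes P Z :: "'p::prime_card padic_int poly"
  assumes "lead_coeff P = 1" "lead_coeff Z = 1"
  obtains r where "Res (lift_poly P) (lift_poly Z) = embed r"
proof -
  have "(\<Prod>x\<in>#iroots P. ipoly Z x) \<in> range to_ac"
    using prod_proots_rational[of "map_poly to_fract P" "map_poly to_fract Z"] assms
    unfolding lift_poly_embed by simp
  then obtain q where q: "(\<Prod>x\<in>#iroots P. ipoly Z x) = to_ac q" by blast
  have "(\<Prod>x\<in>#iroots P. ipoly Z x) \<in> algebraic_integers"
    using iroot_integral[OF assms(1)] in_iroots_iff[OF assms(1)]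
    by (intro integral_prod_mset) (auto intro: integral_poly)
  then obtain r where "q = to_fract r" unfolding q by (rule integral_to_ac)
  then show thesis using that[of r] q Res_lift_poly[OF assms] by (simp add: embed_def)
qed

text \<open>The product runs over the roots of Z, which stay fixed while P varies. This makes
  multiplicativity in Z and continuity in P visible; for monic P and Z the value is p^(-v) with v =
  \<open>val_Res P Z\<close>.\<close>

definition res_norm :: "'p::prime_card padic_int poly \<Rightarrow> 'p padic_int poly \<Rightarrow> real"
  where "res_norm Z P = nrm (\<Prod>y\<in>#iroots Z. ipoly P y)"

lemma res_norm_eq_nrm_Res:
  "lead_coeff P = 1 \<Longrightarrow> lead_coeff Z = 1 \<Longrightarrow> res_norm Z P = nrm (Res (lift_poly P) (lift_poly Z))"
  unfolding res_norm_def by (simp only: Res_lift_poly Res_lift_poly_swap)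

lemma res_norm_swap:
  "lead_coeff P = 1 \<Longrightarrow> lead_coeff Z = 1 \<Longrightarrow> res_norm Z P = nrm (\<Prod>x\<in>#iroots P. ipoly Z x)"
  unfolding res_norm_def by (simp only: Res_lift_poly_swap)

text \<open>Discreteness of the nonzero values is what later makes their level sets open and
  closed.\<close>

lemma res_norm_values:
  fixes P Z :: "'p::prime_card padic_int poly"
  assumes "lead_coeff P = 1" "lead_coeff Z = 1"
  shows "res_norm Z P = 0 \<or> (\<exists>k. res_norm Z P = (1 / real CARD('p)) ^ k)"
proof -
  obtain r where r: "Res (lift_poly P) (lift_poly Z) = embed r" using Res_rational[OF assms] .
  show ?thesis unfolding res_norm_eq_nrm_Res[OF assms] r
  proof (cases "r = 0")
    case False
    then show "nrm (embed r) = 0 \<or> (\<exists>k. nrm (embed r :: 'p padic_closure) = (1 / real CARD('p)) ^ k)"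
      using nrm_embed_neq_0[of r] by blast
  qed simp
qed

lemma res_norm_mult:
  "lead_coeff Z = 1 \<Longrightarrow> lead_coeff Z' = 1 \<Longrightarrow> res_norm (Z * Z') P = res_norm Z P * res_norm Z' P"
  using monic_neq_0[of Z] monic_neq_0[of Z']
  by (simp add: res_norm_def map_poly_embed.hom_mult proots_mult nrm_mult)

lemma res_norm_1: "res_norm 1 P = 1"
  by (simp add: res_norm_def)

section \<open>Passage between norms and valuations of resultants\<close>

definition norm_of_val :: "nat \<Rightarrow> ereal \<Rightarrow> real"
  where "norm_of_val p v = (if v = \<infinity> then 0 else real p powr (- real_of_ereal v))"

lemma nrm_eq_norm_of_val: "nrm x = norm_of_val CARD('p) (val x)" for x :: "'p::prime_card padic_closure"
proof (cases "x = 0")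
  case False
  then have "val x \<noteq> \<infinity>" using rval_bounds(1) by (metis PInfty_neq_ereal(1))
  then show ?thesis using False by (simp add: nrm_def norm_of_val_def)
qed (simp add: norm_of_val_def val_0)

lemma res_norm_val_Res:
  fixes P Z :: "'p::prime_card padic_int poly"
  assumes "lead_coeff P = 1" "lead_coeff Z = 1"
  shows "res_norm Z P = norm_of_val CARD('p) (val_Res P Z)"
  unfolding res_norm_eq_nrm_Res[OF assms] nrm_eq_norm_of_val val_Res_def ..

lemma val_embed_p_power:
  fixes u :: "'p::prime_card padic_int"
  assumes "u dvd 1"
  shows "val (embed (padic_p ^ k * u) :: 'p padic_closure) = ereal (real k)"
proof -
  let ?x = "embed (padic_p ^ k * u) :: 'p padic_closure"
  have "nrm ?x = (1 / real CARD('p)) ^ k"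
    by (simp only: embed.hom_mult nrm_mult nrm_embed_p_power nrm_embed_unit[OF assms] mult.right_neutral)
  also have "\<dots> = real CARD('p) powr (- real k)"
    using real_card_gt_1[where ?'p='p] by (simp add: powr_minus powr_realpow power_one_over divide_inverse power_inverse)
  finally have n: "nrm ?x = real CARD('p) powr (- real k)" .
  then have x0: "?x \<noteq> 0" proof -
    have "0 < real CARD('p) powr (- real k)" using real_card_gt_1[where ?'p='p] by simp
    then show ?thesis using n nrm_eq_0_iff[of ?x] by (metis less_irrefl)
  qed
  then have "real CARD('p) powr (- rval ?x) = real CARD('p) powr (- real k)" using n unfolding nrm_def by (simp only: if_False)
  then have "rval ?x = real k" using real_card_gt_1[where ?'p='p] by (simp add: powr_inj)
  then show ?thesis using rval_bounds(1)[OF x0] by simp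
qed

lemma val_Res_values:
  assumes "lead_coeff P = 1" "lead_coeff Z = 1"
  shows "val_Res P Z \<in> range ereal_of_enat"
proof -
  obtain r where r: "Res (lift_poly P) (lift_poly Z) = embed r" using Res_rational[OF assms] .
  show ?thesis
  proof (cases "r = 0")
    case True
    then have "val_Res P Z = ereal_of_enat \<infinity>" by (simp add: val_Res_def r val_0)
    then show ?thesis by blast
  next
    case False
    then obtain k u where "r = padic_p ^ k * u" "u dvd 1" using padic_int_decompose by blast
    then have "val_Res P Z = ereal_of_enat (enat k)" by (simp only: val_Res_def r val_embed_p_power) simp
    then show ?thesis by blast
  qed
qed

section \<open>Continuity of resultants and separation of polynomials\<close>

lemma nrm_prod_mset_diff:
  assumes "\<And>y. y \<in># A \<Longrightarrow> f y \<in> algebraic_integers" "\<And>y. y \<in># A \<Longrightarrow> g y \<in> algebraic_integers"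
    and "\<And>y. y \<in># A \<Longrightarrow> nrm (f y - g y) \<le> c" "0 \<le> c"
  shows "nrm ((\<Prod>y\<in>#A. f y) - (\<Prod>y\<in>#A. g y)) \<le> c"
  using assms
proof (induction A)
  case (add a A)
  define pf where "pf = (\<Prod>y\<in>#A. f y)"
  define pg where "pg = (\<Prod>y\<in>#A. g y)"
  have "pf \<in> algebraic_integers" unfolding pf_def by (rule integral_prod_mset) (use add.prems in auto)
  then have "nrm (pf * (f a - g a)) \<le> c" using add.prems by (intro nrm_mult_le) (auto simp: nrm_le_1_iff)
  moreover have "nrm (pf - pg) \<le> c" unfolding pf_def pg_def using add by auto
  then have "nrm (g a * (pf - pg)) \<le> c" using add.prems by (intro nrm_mult_le) (auto simp: nrm_le_1_iff)
  moreover have "f a * pf - g a * pg = pf * (f a - g a) + g a * (pf - pg)" by (simp add: algebra_simps)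
  ultimately have "nrm (f a * pf - g a * pg) \<le> c" by (simp only: nrm_add_le)
  then show ?case by (simp add: pf_def pg_def)
qed simp

lemma res_norm_cong:
  fixes P P' Z :: "'p::prime_card padic_int poly"
  assumes "[:padic_p ^ k:] dvd P - P'" "lead_coeff Z = 1"
  shows "\<bar>res_norm Z P - res_norm Z P'\<bar> \<le> (1 / real CARD('p)) ^ k"
proof -
  define a where "a = (\<Prod>y\<in>#iroots Z. ipoly P y)"
  define b where "b = (\<Prod>y\<in>#iroots Z. ipoly P' y)"
  have "nrm (a - b) \<le> (1 / real CARD('p)) ^ k"
    unfolding a_def b_def using iroot_integral[OF assms(2)] in_iroots_iff[OF assms(2)] nrm_ipoly_cong[OF assms(1)]
    by (intro nrm_prod_mset_diff) (auto intro: integral_poly)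
  moreover have "nrm a \<le> max (nrm b) (nrm (a - b))" using nrm_add[of b "a - b"] by simp
  moreover have "nrm b \<le> max (nrm a) (nrm (a - b))" using nrm_add[of a "b - a"] nrm_minus_commute[of a b] by simp
  ultimately show ?thesis using nrm_nonneg[of a] nrm_nonneg[of b] nrm_nonneg[of "a - b"] unfolding res_norm_def a_def[symmetric] b_def[symmetric]
    by linarith
qed

lemma prod_mset_pos: "(\<And>x. x \<in># A \<Longrightarrow> 0 < f x) \<Longrightarrow> 0 < (\<Prod>x\<in>#A. f x)"
  for f :: "'b \<Rightarrow> real"
  by (induction A) auto

lemma small_p_power:
  assumes "finite W" "\<And>w. w \<in> W \<Longrightarrow> 0 < w"
  obtains k where "k \<ge> 1" "\<And>w. w \<in> W \<Longrightarrow> (1 / real CARD('p::prime_card)) ^ k < w"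
proof -
  define w0 where "w0 = Min (insert 1 W)"
  have w0: "0 < w0" "\<And>w. w \<in> W \<Longrightarrow> w0 \<le> w" "w0 \<le> 1"
    using assms by (auto simp: w0_def)
  obtain k where k: "(1 / real CARD('p)) ^ k < w0"
    using real_arch_pow_inv[OF w0(1), of "1 / real CARD('p)"] real_card_gt_1[where ?'p='p] by auto
  have "k \<noteq> 0" using k w0(3) by (intro notI) simp
  show thesis
  proof (rule that)
    show "k \<ge> 1" using \<open>k \<noteq> 0\<close> by simp
    show "(1 / real CARD('p)) ^ k < w" if "w \<in> W" for w using k w0(2)[OF that] by linarith
  qed
qed

context poly_family
begin

text \<open>The choice is Z = A + p^k. At the roots of A it has norm p^(-k), so the factor from A is
  tiny; at the roots of B it has the norm of A once k is large, so the factor from B is the constant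
  c. The common factor from G is nonzero and cancels.\<close>

lemma separation_coprime:
  assumes "G * A \<in> PS" "lead_coeff G = 1" "lead_coeff A = 1" "lead_coeff B = 1"
    and A: "degree A > 0" and AB: "\<And>x. ipoly A x = 0 \<Longrightarrow> ipoly B x \<noteq> 0"
  obtains Z where "Z \<in> PS" "res_norm Z (G * A) \<noteq> res_norm Z (G * B)"
proof -
  define c where "c = (\<Prod>x\<in>#iroots B. nrm (ipoly A x))"
  \<comment> \<open>All norms that p^k has to undercut. Removing 0 drops the common roots of A and
    G, where Z takes the nonzero value p^k anyway.\<close>
  define W where "W = insert c (nrm ` ipoly A ` (set_mset (iroots G) \<union> set_mset (iroots B)) - {0})"
  have A_B: "ipoly A x \<noteq> 0" if "x \<in># iroots B" for x
    using that AB in_iroots_iff[OF assms(4)] by blast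
  have c: "0 < c" unfolding c_def using A_B by (intro prod_mset_pos) simp
  obtain k where k: "k \<ge> 1" "\<And>w. w \<in> W \<Longrightarrow> (1 / real CARD('p)) ^ k < w"
  proof (rule small_p_power[of W])
    show "0 < w" if "w \<in> W" for w using that c by (auto simp: W_def order_less_le)
  qed (auto simp: W_def)
  define e where "e = (embed (padic_p ^ k) :: 'p padic_closure)"
  have e: "nrm e = (1 / real CARD('p)) ^ k" "e \<noteq> 0"
    using p_power_neq_0[of k, where ?'p='p] by (simp_all only: e_def nrm_embed_p_power embed.hom_0_iff not_False_eq_True)
  define Z where "Z = A + [:padic_p ^ k:]"
  have Zx: "ipoly Z x = ipoly A x + e" for x
    by (simp add: Z_def e_def map_poly_embed.hom_add embed.map_poly_pCons_hom)
  have Z1: "lead_coeff Z = 1"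
  proof -
    have "degree Z = degree A" unfolding Z_def using A by (intro degree_add_eq_left) simp
    then show ?thesis using assms(3) A by (simp add: Z_def coeff_pCons split: nat.splits)
  qed
  have "A \<in> PS" using assms(1,3) poly_space_factor[of A G] by (simp add: mult.commute)
  moreover have "[:padic_p:] dvd Z - A"
    using k(1) by (auto simp: Z_def const_poly_dvd_iff coeff_pCons split: nat.splits)
  ultimately have Z: "Z \<in> PS" using Z1 poly_space_cong by blast
  have close: "nrm (ipoly Z x) = nrm (ipoly A x)" if "nrm (ipoly A x) \<in> W" for x
  proof -
    have "nrm e < nrm (ipoly A x)" using k(2)[OF that] e by simp
    then show ?thesis unfolding Zx using nrm_add[of "ipoly A x" e] nrm_add[of "ipoly A x + e" "- e"] by simp
  qed
  have "ipoly Z x \<noteq> 0" if "x \<in># iroots G" for x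
  proof (cases "ipoly A x = 0")
    case True
    then show ?thesis using e by (simp add: Zx)
  next
    case False
    then have "nrm (ipoly A x) \<in> W" using that by (auto simp: W_def)
    then show ?thesis using close[of x] False by (metis nrm_eq_0_iff)
  qed
  then have G0: "(\<Prod>x\<in>#iroots G. ipoly Z x) \<noteq> 0" by (auto simp: prod_mset_zero_iff)
  have mono: "lead_coeff (G * A) = 1" "lead_coeff (G * B) = 1" using assms by (simp_all add: lead_coeff_mult)
  have G_0: "G \<noteq> 0" "A \<noteq> 0" "B \<noteq> 0" using assms monic_neq_0 by blast+
  have roots: "iroots (G * A) = iroots G + iroots A" "iroots (G * B) = iroots G + iroots B"
    using G_0 by (simp_all add: map_poly_embed.hom_mult proots_mult)
  have "nrm (\<Prod>x\<in>#iroots A. ipoly Z x) = nrm e ^ degree A"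
  proof -
    have "(\<Prod>x\<in>#iroots A. ipoly Z x) = (\<Prod>x\<in>#iroots A. e)"
      using in_iroots_iff[OF assms(3)] by (intro arg_cong[of _ _ prod_mset] image_mset_cong) (simp add: Zx)
    then show ?thesis using size_iroots[OF assms(3)] by (simp add: prod_mset_constant nrm_power)
  qed
  also have "\<dots> \<le> nrm e ^ 1" using A k(1) real_card_gt_1[where ?'p='p] unfolding e
    by (intro power_decreasing) (auto intro: power_le_one)
  also have "\<dots> < c" using k(2)[of c] e by (simp add: W_def)
  also have "c = nrm (\<Prod>x\<in>#iroots B. ipoly Z x)"
    unfolding c_def nrm_prod_mset using A_B close by (intro arg_cong[of _ _ prod_mset] image_mset_cong) (auto simp: W_def)
  finally have "nrm (\<Prod>x\<in>#iroots A. ipoly Z x) \<noteq> nrm (\<Prod>x\<in>#iroots B. ipoly Z x)" by simp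
  then have "res_norm Z (G * A) \<noteq> res_norm Z (G * B)"
    using G0 unfolding res_norm_swap[OF mono(1) Z1] res_norm_swap[OF mono(2) Z1] roots by (simp add: nrm_mult)
  then show thesis using that Z by blast
qed

text \<open>G is a monic common divisor of largest degree. A common root of the cofactors would
  contribute its minimal polynomial over Z_p to both of them and so enlarge G. As the polynomials
  differ, some cofactor has positive degree, and it takes the role of A.\<close>

lemma separation:
  assumes P: "P1 \<in> PS" "P2 \<in> PS" "P1 \<noteq> P2"
  obtains Z where "Z \<in> PS" "res_norm Z P1 \<noteq> res_norm Z P2"
proof -
  define D where "D G \<longleftrightarrow> lead_coeff G = 1 \<and> G dvd P1 \<and> G dvd P2" for G
  have P1: "lead_coeff P1 = 1" "lead_coeff P2 = 1" using P poly_space_monic by blast+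
  have "D G \<Longrightarrow> degree G \<le> degree P1" for G
    using dvd_imp_degree_le[of G P1] monic_neq_0[OF P1(1)] by (simp add: D_def)
  moreover have "D 1" by (simp add: D_def)
  ultimately obtain G where G: "D G" "\<And>H. D H \<Longrightarrow> degree H \<le> degree G"
    using ex_has_greatest_nat[of D 1 degree "Suc (degree P1)"] by (metis less_Suc_eq_le)
  then obtain A B where AB: "P1 = G * A" "P2 = G * B" unfolding D_def by (auto elim!: dvdE)
  have G1: "lead_coeff G = 1" using G(1) by (simp add: D_def)
  have A1: "lead_coeff A = 1" and B1: "lead_coeff B = 1"
    using P1 G1 unfolding AB lead_coeff_mult by simp_all
  have no_common: "\<not> (ipoly A x = 0 \<and> ipoly B x = 0)" for x
  proof
    assume x: "ipoly A x = 0 \<and> ipoly B x = 0"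
    then have "x \<in> algebraic_integers" using iroot_integral[OF A1] by blast
    then obtain Q where Q: "map_poly to_fract Q = min_poly x" "lead_coeff Q = 1" by (rule integral_min_poly)
    have "Q dvd A" "Q dvd B" using integral_min_poly_dvd[OF Q] x by blast+
    then have "D (G * Q)" using G1 Q(2) by (simp add: D_def AB lead_coeff_mult mult_dvd_mono)
    then have "degree (G * Q) \<le> degree G" by (rule G(2))
    moreover have "degree (G * Q) = degree G + degree Q"
      using monic_neq_0[OF G1] monic_neq_0[OF Q(2)] by (rule degree_mult_eq)
    moreover have "degree Q = degree (min_poly x)" unfolding Q(1)[symmetric] by simp
    ultimately show False using degree_min_poly_pos[of x] by simp
  qed
  consider "degree A > 0" | "degree B > 0" | "degree A = 0" "degree B = 0" by blast
  then show thesis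
  proof cases
    case 1
    show thesis
      by (rule separation_coprime[of G A B]) (use that no_common 1 P AB G1 A1 B1 in auto)
  next
    case 2
    show thesis
      by (rule separation_coprime[of G B A]) (use that no_common 2 P AB G1 A1 B1 in auto)
  next
    case 3
    then have "A = 1" "B = 1" using A1 B1 monic_degree_0 by blast+
    then show thesis using P(3) AB by simp
  qed
qed

end

section \<open>Krasner's lemma\<close>

text \<open>As x is algebraic, this ring is already the field Q_p(x); inverses come from
  \<open>inverse_as_poly\<close>. It is the set compared with K in
  \<open>new_integers\<close>.\<close>

definition gen_field :: "'p::prime_card padic_closure \<Rightarrow> 'p padic_closure set"
  where "gen_field x = range (\<lambda>q. poly (lift_padic_poly q) x)"

lemma gen_field_to_ac: "to_ac a \<in> gen_field x"
  unfolding gen_field_def by (rule range_eqI[of _ _ "[:a:]"]) (simp add: to_ac.map_poly_pCons_hom)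

lemma gen_field_self: "x \<in> gen_field x"
  unfolding gen_field_def by (rule range_eqI[of _ _ "[:0, 1:]"]) (simp add: to_ac.map_poly_pCons_hom)

lemma gen_field_add: "a \<in> gen_field x \<Longrightarrow> b \<in> gen_field x \<Longrightarrow> a + b \<in> gen_field x"
proof -
  assume "a \<in> gen_field x" "b \<in> gen_field x"
  then obtain q r where "a = poly (lift_padic_poly q) x" "b = poly (lift_padic_poly r) x"
    by (auto simp: gen_field_def)
  then have "a + b = poly (lift_padic_poly (q + r)) x" by (simp add: map_poly_to_ac.hom_add)
  then show ?thesis unfolding gen_field_def by blast
qed

lemma gen_field_mult: "a \<in> gen_field x \<Longrightarrow> b \<in> gen_field x \<Longrightarrow> a * b \<in> gen_field x"
proof -
  assume "a \<in> gen_field x" "b \<in> gen_field x"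
  then obtain q r where "a = poly (lift_padic_poly q) x" "b = poly (lift_padic_poly r) x"
    by (auto simp: gen_field_def)
  then have "a * b = poly (lift_padic_poly (q * r)) x" by (simp add: map_poly_to_ac.hom_mult)
  then show ?thesis unfolding gen_field_def by blast
qed

lemma gen_field_poly: "a \<in> gen_field x \<Longrightarrow> poly (lift_padic_poly q) a \<in> gen_field x"
proof -
  assume "a \<in> gen_field x"
  then obtain r where "a = poly (lift_padic_poly r) x" by (auto simp: gen_field_def)
  then have "poly (lift_padic_poly q) a = poly (lift_padic_poly (pcompose q r)) x"
    by (simp add: to_ac.map_poly_pcompose poly_pcompose)
  then show ?thesis unfolding gen_field_def by blast
qed

lemma gen_field_subset: "a \<in> gen_field x \<Longrightarrow> gen_field a \<subseteq> gen_field x"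
  using gen_field_poly unfolding gen_field_def[of a] by blast

lemma gen_field_uminus: "a \<in> gen_field x \<Longrightarrow> - a \<in> gen_field x"
  using gen_field_mult[OF gen_field_to_ac[of "-1"], of a] by simp

lemma gen_field_0: "0 \<in> gen_field x" and gen_field_1: "1 \<in> gen_field x"
  using gen_field_to_ac[of 0] gen_field_to_ac[of 1] by simp_all

lemma gen_field_inverse:
  assumes "a \<in> gen_field x"
  shows "inverse a \<in> gen_field x"
proof (cases "a = 0")
  case False
  then obtain h where "\<And>y. y \<in># conjugates a \<Longrightarrow> poly (lift_padic_poly h) y = inverse y"
    using inverse_as_poly[of a] by blast
  then show ?thesis using self_in_conjugates gen_field_poly[OF assms] by metis
qed (simp add: gen_field_0)

definition poly_over :: "'a::zero set \<Rightarrow> 'a poly set"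
  where "poly_over L = {g. \<forall>i. coeff g i \<in> L}"

lemma poly_over_pCons: "pCons a p \<in> poly_over L \<longleftrightarrow> a \<in> L \<and> p \<in> poly_over L"
proof
  assume "pCons a p \<in> poly_over L"
  then have "coeff (pCons a p) 0 \<in> L" "\<And>i. coeff (pCons a p) (Suc i) \<in> L"
    unfolding poly_over_def by blast+
  then show "a \<in> L \<and> p \<in> poly_over L" by (simp add: poly_over_def)
qed (auto simp: poly_over_def coeff_pCons split: nat.splits)

lemma poly_over_gen_field_add:
  "p \<in> poly_over (gen_field x) \<Longrightarrow> q \<in> poly_over (gen_field x) \<Longrightarrow> p + q \<in> poly_over (gen_field x)"
  by (auto simp: poly_over_def intro: gen_field_add)

lemma poly_over_gen_field_smult:
  "a \<in> gen_field x \<Longrightarrow> p \<in> poly_over (gen_field x) \<Longrightarrow> smult a p \<in> poly_over (gen_field x)"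
  by (auto simp: poly_over_def intro: gen_field_mult)

lemma poly_over_gen_field_0: "0 \<in> poly_over (gen_field x)"
  by (simp add: poly_over_def gen_field_0)

lemma poly_over_gen_field_mult:
  assumes "p \<in> poly_over (gen_field x)" "q \<in> poly_over (gen_field x)"
  shows "p * q \<in> poly_over (gen_field x)"
  using assms(1)
proof (induction p)
  case (pCons a p)
  then show ?case using assms(2)
    by (auto simp: poly_over_pCons gen_field_0 intro!: poly_over_gen_field_add poly_over_gen_field_smult)
qed (simp add: poly_over_gen_field_0)

lemma poly_over_gen_field_pcompose:
  assumes "p \<in> poly_over (gen_field x)" "q \<in> poly_over (gen_field x)"
  shows "pcompose p q \<in> poly_over (gen_field x)"
  using assms(1)
proof (induction p)
  case (pCons a p)
  then show ?case using assms(2)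
    by (auto simp: pcompose_pCons poly_over_pCons poly_over_gen_field_0
        intro!: poly_over_gen_field_add poly_over_gen_field_mult)
qed (simp add: poly_over_gen_field_0)

lemma poly_over_gen_field_lift: "lift_padic_poly q \<in> poly_over (gen_field x)"
  by (simp add: poly_over_def gen_field_to_ac)

text \<open>The minimal polynomial of x over Q_p(y). The intermediate field is a set inside the
  closure and not a type, so division by g is carried out one leading term at a time while the
  coefficients are tracked.\<close>

lemma min_poly_over_gen_field:
  fixes x y :: "'p::prime_card padic_closure"
  obtains g where "lead_coeff g = 1" "g \<in> poly_over (gen_field y)" "poly g x = 0"
    "\<And>h. h \<in> poly_over (gen_field y) \<Longrightarrow> poly h x = 0 \<Longrightarrow> g dvd h"
proof -
  define A where "A h \<longleftrightarrow> h \<noteq> 0 \<and> h \<in> poly_over (gen_field y) \<and> poly h x = 0" for h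
  have "A (lift_padic_poly (min_poly x))"
    using monic_neq_0[OF lift_min_poly_monic] by (simp add: A_def poly_over_gen_field_lift min_poly(3))
  then obtain g where g: "A g" "\<And>h. A h \<Longrightarrow> degree g \<le> degree h"
    using arg_min_nat_lemma[of A _ degree] by blast
  define m where "m = smult (inverse (lead_coeff g)) g"
  have m: "lead_coeff m = 1" "degree m = degree g" "poly m x = 0" "m \<in> poly_over (gen_field y)"
  proof -
    have "lead_coeff g \<noteq> 0" "lead_coeff g \<in> gen_field y" using g(1) by (auto simp: A_def poly_over_def)
    then show "lead_coeff m = 1" "degree m = degree g" "poly m x = 0" "m \<in> poly_over (gen_field y)"
      using g(1) by (auto simp: m_def A_def intro!: poly_over_gen_field_smult gen_field_inverse)
  qed
  have "m dvd h" if "h \<in> poly_over (gen_field y)" "poly h x = 0" for h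
    using that
  proof (induction "degree h" arbitrary: h rule: less_induct)
    case less
    show ?case
    proof (cases "h = 0")
      case False
      then have deg: "degree m \<le> degree h" using g(2)[of h] less.prems m(2) by (simp add: A_def)
      define c where "c = monom (lead_coeff h) (degree h - degree m)"
      define h' where "h' = h - c * m"
      have c: "c \<in> poly_over (gen_field y)" using less.prems(1)
        by (auto simp: c_def poly_over_def coeff_monom gen_field_0)
      have "h' = h + c * (- m)" by (simp add: h'_def)
      moreover have "- m \<in> poly_over (gen_field y)" using m(4) by (auto simp: poly_over_def gen_field_uminus)
      ultimately have h': "h' \<in> poly_over (gen_field y)" "poly h' x = 0"
        using less.prems m(3) poly_over_gen_field_add[OF less.prems(1) poly_over_gen_field_mult[OF c, of "- m"]]
        by simp_all
      show ?thesis
      proof (cases "degree h = 0")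
        case True
        then have "\<exists>a. h = [:a:]" by (metis degree_eq_zeroE)
        then show ?thesis using less.prems(2) by auto
      next
        case dh: False
        have "degree h' < degree h"
        proof (rule degree_lessI)
          show "h' \<noteq> 0 \<or> degree h > 0" using dh by simp
          have "coeff h' k = 0" if "k \<ge> degree h" for k
          proof (cases "k = degree h")
            case True
            then show ?thesis using deg m(1) by (simp add: h'_def c_def coeff_monom_mult)
          next
            case False
            then have "coeff h k = 0" "coeff m (k - (degree h - degree m)) = 0"
              using that deg by (auto intro!: coeff_eq_0)
            then show ?thesis using that by (simp add: h'_def c_def coeff_monom_mult)
          qed
          then show "\<forall>k\<ge>degree h. coeff h' k = 0" by blast
        qed
        then have "m dvd h'" using less.hyps h' by blast
        moreover have "h = h' + c * m" by (simp add: h'_def)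
        ultimately show ?thesis by (metis dvd_add dvd_triv_right)
      qed
    qed simp
  qed
  then show thesis using that m by blast
qed

text \<open>Characteristic zero, from n < p^n: the number n is its own residue modulo p^n. Krasner's
  lemma uses it in place of separability.\<close>

lemma of_nat_padic_closure_neq_0: "n > 0 \<Longrightarrow> (of_nat n :: 'p::prime_card padic_closure) \<noteq> 0"
proof
  assume n: "n > 0" and "(of_nat n :: 'p padic_closure) = 0"
  then have "embed (of_nat n :: 'p padic_int) = 0" by (simp only: embed.hom_of_nat)
  then have "(of_nat n :: 'p padic_int) = 0" by (simp only: embed.hom_0_iff)
  then have "int n mod int CARD('p) ^ n = 0" by (metis digit_of_nat zero_padic_int.rep_eq)
  moreover have "n < CARD('p) ^ n"
  proof (rule less_le_trans[OF less_exp])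
    show "2 ^ n \<le> CARD('p) ^ n" using prime_ge_2_nat[OF prime_card[where ?'a='p]] by (intro power_mono) auto
  qed
  then have "int n < int CARD('p) ^ n" by (metis of_nat_less_iff of_nat_power)
  ultimately show False using n by simp
qed

text \<open>Since x and z are conjugate over the field generated by y, so are x - y and z - y; hence
  another conjugate z of x would be as close to y as x is.\<close>

theorem krasner:
  fixes x y :: "'p::prime_card padic_closure"
  assumes P: "poly (lift_padic_poly P) x = 0"
    and sep: "\<And>z. poly (lift_padic_poly P) z = 0 \<Longrightarrow> z \<noteq> x \<Longrightarrow> nrm (y - x) < nrm (x - z)"
  shows "x \<in> gen_field y"
proof -
  obtain g where g: "lead_coeff g = 1" "g \<in> poly_over (gen_field y)" "poly g x = 0"
    "\<And>h. h \<in> poly_over (gen_field y) \<Longrightarrow> poly h x = 0 \<Longrightarrow> g dvd h"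
    using min_poly_over_gen_field[of y x] by blast
  show ?thesis
  proof (cases "\<exists>z. poly g z = 0 \<and> z \<noteq> x")
    case True
    then obtain z where z: "poly g z = 0" "z \<noteq> x" by blast
    have gz: "poly h z = 0" if h: "h \<in> poly_over (gen_field y)" "poly h x = 0" for h
      using g(4)[OF h] z(1) by (auto elim!: dvdE)
    have "nrm (y - x) < nrm (x - z)"
      using sep gz[OF poly_over_gen_field_lift P] z(2) by blast
    moreover have "nrm (z - y) = nrm (x - y)"
    proof -
      \<comment> \<open>Shifting the minimal polynomial of x - y by y gives coefficients in Q_p(y).
        The result vanishes at x, hence at z, so z - y is a conjugate of x - y.\<close>
      define h where "h = pcompose (lift_padic_poly (min_poly (x - y))) [:- y, 1:]"
      have "h \<in> poly_over (gen_field y)"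
        unfolding h_def by (intro poly_over_gen_field_pcompose poly_over_gen_field_lift)
          (simp add: poly_over_pCons gen_field_uminus gen_field_self gen_field_1 poly_over_gen_field_0)
      moreover have "poly h x = 0" using min_poly(3)[of "x - y"] by (simp add: h_def poly_pcompose)
      ultimately have "poly h z = 0" by (rule gz)
      then have "z - y \<in># conjugates (x - y)" unfolding in_conjugates_iff by (simp add: h_def poly_pcompose)
      then show ?thesis by (intro nrm_min_poly min_poly_conjugate)
    qed
    ultimately show ?thesis using nrm_triangle[of x z y] nrm_minus_commute[of x y] nrm_minus_commute[of y z]
      by simp
  next
    case False
    \<comment> \<open>If x is the only root, then g = (X - x)^n, whose second coefficient - n x lies
      in Q_p(y), and n is invertible.\<close>
    define n where "n = degree g"
    have "proots g = replicate_mset n x"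
    proof -
      have "\<forall>a\<in>#proots g. a = x" using False monic_neq_0[OF g(1)] by auto
      then show ?thesis using monic_eq_prod_proots(2)[OF g(1)] by (metis n_def set_mset_subset_singletonD subsetI singletonI)
    qed
    then have gn: "g = [:- x, 1:] ^ n" using monic_eq_prod_proots(1)[OF g(1)] by simp
    have n: "n > 0" using g(3) gn by (intro neq0_conv[THEN iffD1] notI) simp
    have "coeff g (n - 1) = of_nat n * (- x)"
      unfolding gn using n by (subst coeff_linear_poly_power) (cases n, simp_all)+
    then have "of_nat n * (- x) \<in> gen_field y" using g(2) by (metis (mono_tags, lifting) mem_Collect_eq poly_over_def)
    moreover have "of_nat n \<in> gen_field y"
      using gen_field_to_ac[of "of_nat n" y] by (simp only: to_ac_of_nat)
    ultimately have "inverse (of_nat n) * (of_nat n * (- x)) \<in> gen_field y"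
      using gen_field_mult[OF gen_field_inverse] by blast
    then have "- x \<in> gen_field y" using of_nat_padic_closure_neq_0[OF n, where ?'p='p]
      by (simp add: mult.assoc[symmetric] del: mult_minus_right)
    then show ?thesis using gen_field_uminus by fastforce
  qed
qed

lemma new_integers_iff: "x \<in> new_integers K \<longleftrightarrow> x \<in> algebraic_integers \<and> gen_field x = K"
  unfolding new_integers_def gen_field_def[symmetric] using gen_field_self by blast

section \<open>Stability of roots\<close>

abbreviation root_set :: "'p::prime_card padic_int poly \<Rightarrow> 'p padic_closure set"
  where "root_set P \<equiv> {x. ipoly P x = 0}"

lemma finite_root_set: "lead_coeff P = 1 \<Longrightarrow> finite (root_set P)"
  using monic_neq_0[of P] by (intro poly_roots_finite) simp

text \<open>An automorphism over Q_p carries x - y to a root of the same minimal polynomial, and the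
  absolute value depends on nothing else.\<close>

lemma galois_nrm: "\<sigma> \<in> galois_group \<Longrightarrow> nrm (\<sigma> x - \<sigma> y) = nrm (x - y)"
  and galois_root: "\<sigma> \<in> galois_group \<Longrightarrow> ipoly P x = 0 \<Longrightarrow> ipoly P (\<sigma> x) = 0"
proof -
  assume \<sigma>: "\<sigma> \<in> galois_group"
  then have add: "\<sigma> (a + b) = \<sigma> a + \<sigma> b" and mult: "\<sigma> (a * b) = \<sigma> a * \<sigma> b" and fixed: "\<sigma> (to_ac c) = to_ac c" for a b c
    by (auto simp: galois_group_def)
  have poly: "\<sigma> (poly (lift_padic_poly q) a) = poly (lift_padic_poly q) (\<sigma> a)" for q a
    by (induction q) (simp_all add: to_ac.map_poly_pCons_hom add mult fixed fixed[of 0, simplified])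
  have "\<sigma> x = \<sigma> (x - y) + \<sigma> y" by (simp flip: add)
  moreover have "min_poly (\<sigma> (x - y)) = min_poly (x - y)"
  proof (rule min_poly_eqI)
    show "poly (lift_padic_poly (min_poly (x - y))) (\<sigma> (x - y)) = 0"
      unfolding poly[symmetric] min_poly(3) using fixed[of 0] by simp
  qed (rule min_poly)+
  ultimately show "nrm (\<sigma> x - \<sigma> y) = nrm (x - y)" by (metis add_diff_cancel_right' nrm_min_poly)
  show "ipoly P (\<sigma> x) = 0" if "ipoly P x = 0"
    using that poly[of "map_poly to_fract P" x] fixed[of 0] unfolding lift_poly_embed by simp
qed

text \<open>The product has finitely many factors, so a single radius serves all
  coordinates.\<close>

lemma open_new_integers_ball:
  fixes K :: "nat \<Rightarrow> 'p::prime_card padic_closure set" and m :: nat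
  defines "T \<equiv> product_topology (\<lambda>i. subtopology padic_closure_topology (new_integers (K i))) {..<m}"
  assumes V: "openin T V" "x \<in> V"
  obtains \<epsilon> where "\<epsilon> > 0" "\<And>x'. x' \<in> topspace T \<Longrightarrow> (\<And>i. i < m \<Longrightarrow> nrm (x' i - x i) < \<epsilon>) \<Longrightarrow> x' \<in> V"
proof -
  from V obtain W where "\<forall>i\<in>{..<m}. openin (subtopology padic_closure_topology (new_integers (K i))) (W i)"
    and W: "x \<in> Pi\<^sub>E {..<m} W" "Pi\<^sub>E {..<m} W \<subseteq> V"
    unfolding T_def openin_product_topology_alt by meson
  then have W_open: "openin (subtopology padic_closure_topology (new_integers (K i))) (W i)" if "i < m" for i
    using that by blast
  have "\<exists>\<epsilon>>0. \<forall>y \<in> new_integers (K i). nrm (y - x i) < \<epsilon> \<longrightarrow> y \<in> W i" if i: "i < m" for i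
  proof -
    obtain O' where O': "openin padic_closure_topology O'" "W i = O' \<inter> new_integers (K i)"
      using W_open[OF i] unfolding openin_subtopology by blast
    have "x i \<in> O'" using W(1) i O'(2) by (auto simp: PiE_def Pi_def)
    then obtain r where r: "{y. ereal r < val (y - x i)} \<subseteq> O'"
      using O'(1) unfolding openin_padic_closure_topology by blast
    have "real CARD('p) powr (- r) > 0" using real_card_gt_1[where ?'p='p] by simp
    moreover have "y \<in> W i" if "y \<in> new_integers (K i)" "nrm (y - x i) < real CARD('p) powr (- r)" for y
      using that r unfolding O'(2) val_less_iff by blast
    ultimately show ?thesis by blast
  qed
  then obtain \<epsilon> where \<epsilon>: "\<And>i. i < m \<Longrightarrow> \<epsilon> i > 0"
    "\<And>i y. i < m \<Longrightarrow> y \<in> new_integers (K i) \<Longrightarrow> nrm (y - x i) < \<epsilon> i \<Longrightarrow> y \<in> W i" by metis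
  define e where "e = Min (insert 1 (\<epsilon> ` {..<m}))"
  have e: "e > 0" "\<And>i. i < m \<Longrightarrow> e \<le> \<epsilon> i" using \<epsilon>(1) by (auto simp: e_def)
  show thesis
  proof (rule that[OF e(1)])
    fix x' assume x': "x' \<in> topspace T" "\<And>i. i < m \<Longrightarrow> nrm (x' i - x i) < e"
    then have x'_PiE: "x' \<in> Pi\<^sub>E {..<m} (\<lambda>i. topspace padic_closure_topology \<inter> new_integers (K i))" by (simp add: T_def)
    have "x' \<in> Pi\<^sub>E {..<m} W"
    proof (rule PiE_I)
      fix i assume "i \<in> {..<m}"
      then show "x' i \<in> W i" using x'(2)[of i] e(2)[of i] \<epsilon>(2)[of i "x' i"] x'_PiE by fastforce
    next
      fix i assume "i \<notin> {..<m}"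
      then show "x' i = undefined" using x'_PiE by (auto simp: PiE_def extensional_def)
    qed
    then show "x' \<in> V" using W(2) by blast
  qed
qed

lemma topspace_padic_closure_topology: "topspace padic_closure_topology = UNIV"
proof -
  have "openin padic_closure_topology UNIV" unfolding openin_padic_closure_topology by blast
  then show ?thesis using openin_subset by blast
qed

text \<open>At a root of one polynomial the other is at most p^(-k) in norm, so
  \<open>near_root\<close> applies in both directions.\<close>

lemma root_matching:
  fixes P P' :: "'p::prime_card padic_int poly"
  assumes P: "lead_coeff P = 1" and P': "lead_coeff P' = 1" "degree P' = degree P" "[:padic_p ^ k:] dvd P' - P"
    and \<epsilon>: "0 < \<epsilon>" "(1 / real CARD('p)) ^ k < \<epsilon> ^ degree P"
  shows "x' \<in> root_set P' \<Longrightarrow> \<exists>x\<in>root_set P. nrm (x' - x) < \<epsilon>"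
    and "x \<in> root_set P \<Longrightarrow> \<exists>x'\<in>root_set P'. nrm (x - x') < \<epsilon>"
proof -
  have near: "\<exists>y\<in>root_set B. nrm (x - y) < \<epsilon>"
    if AB: "lead_coeff A = 1" "lead_coeff B = 1" "[:padic_p ^ k:] dvd A - B" "degree B = degree P"
      "ipoly A x = 0" for A B :: "'p padic_int poly" and x
  proof -
    have "x \<in> algebraic_integers" using iroot_integral AB(1,5) by blast
    then have "nrm (ipoly A x - ipoly B x) \<le> (1 / real CARD('p)) ^ k" by (rule nrm_ipoly_cong[OF AB(3)])
    then have "nrm (ipoly B x) < \<epsilon> ^ degree B" using AB(4,5) \<epsilon>(2) by simp
    then obtain y where "ipoly B y = 0" "nrm (x - y) < \<epsilon>" using near_root[OF AB(2)] \<epsilon>(1) by (metis less_imp_le)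
    then show ?thesis by blast
  qed
  show "\<exists>x\<in>root_set P. nrm (x' - x) < \<epsilon>" if "x' \<in> root_set P'"
    using near[OF P'(1) P P'(3)] that by blast
  have "[:padic_p ^ k:] dvd P - P'" using P'(3) by (metis dvd_minus_iff minus_diff_eq)
  then show "\<exists>x'\<in>root_set P'. nrm (x - x') < \<epsilon>" if "x \<in> root_set P"
    using near[OF P P'(1)] P'(2) that by blast
qed

lemma separated_roots:
  assumes "finite R"
  obtains \<delta> where "\<delta> > 0" "\<And>x z. x \<in> R \<Longrightarrow> z \<in> R \<Longrightarrow> x \<noteq> z \<Longrightarrow> \<delta> \<le> nrm (x - z)"
proof
  define D where "D = insert 1 ((\<lambda>(x, z). nrm (x - z)) ` {(x, z) \<in> R \<times> R. x \<noteq> z})"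
  have fin: "finite D" using finite_subset[of "{(x, z) \<in> R \<times> R. x \<noteq> z}" "R \<times> R"] assms by (auto simp: D_def)
  then show "Min D > 0" by (subst Min_gr_iff) (auto simp: D_def)
  show "Min D \<le> nrm (x - z)" if "x \<in> R" "z \<in> R" "x \<noteq> z" for x z
    using fin that by (intro Min_le) (auto simp: D_def)
qed

text \<open>Let \<delta> separate the roots of P. For P' close to P, every root of P' lies near
  exactly one root of P, and this map \<phi> is onto, so the number of roots cannot drop. If it
  stays the same, \<phi> is bijective and the roots of P' are \<delta>-separated as well. Krasner's
  lemma then applies in both directions, so \<phi> preserves generated fields; it respects Galois
  orbits because automorphisms are isometries. Hence \<phi> carries the tuples for P' to those for
  P.\<close>

lemma root_tuple_count_stable:
  fixes P :: "'p::prime_card padic_int poly" and K :: "nat \<Rightarrow> 'p padic_closure set" and m :: nat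
  defines "T \<equiv> product_topology (\<lambda>i. subtopology padic_closure_topology (new_integers (K i))) {..<m}"
  assumes P: "lead_coeff P = 1" and U: "openin T U" "closedin T U"
  obtains k where "\<And>P'. lead_coeff P' = 1 \<Longrightarrow> degree P' = degree P \<Longrightarrow> [:padic_p ^ k:] dvd P' - P \<Longrightarrow>
      card (root_set P) \<le> card (root_set P') \<and>
      (card (root_set P') = card (root_set P) \<longrightarrow> root_tuple_count m U P' = root_tuple_count m U P)"
proof -
  let ?R = "root_set P"
  have finR: "finite ?R" using finite_root_set[OF P] .
  obtain \<delta> where \<delta>: "\<delta> > 0" "\<And>x z. x \<in> ?R \<Longrightarrow> z \<in> ?R \<Longrightarrow> x \<noteq> z \<Longrightarrow> \<delta> \<le> nrm (x - z)"
    using separated_roots[OF finR] by blast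
  have topT: "x \<in> topspace T \<longleftrightarrow> x \<in> Pi\<^sub>E {..<m} (\<lambda>i. new_integers (K i))" for x
    by (simp add: T_def topspace_padic_closure_topology)
  have U_sub: "U \<subseteq> topspace T" using U(1) by (rule openin_subset)
  \<comment> \<open>U and its complement are both open, so membership in U is constant on a ball
    around each tuple.\<close>
  have "\<exists>\<epsilon>>0. \<forall>x'\<in>topspace T. (\<forall>i<m. nrm (x' i - x i) < \<epsilon>) \<longrightarrow> (x' \<in> U \<longleftrightarrow> x \<in> U)" if x: "x \<in> topspace T" for x
  proof (cases "x \<in> U")
    case True
    then show ?thesis using open_new_integers_ball[where m = m and K = K and V = U and x = x] U(1) unfolding T_def by metis
  next
    case False
    have "openin T (topspace T - U)" using U(2) by blast
    then obtain \<epsilon> where "\<epsilon> > 0" "\<And>x'. x' \<in> topspace T \<Longrightarrow> (\<And>i. i < m \<Longrightarrow> nrm (x' i - x i) < \<epsilon>) \<Longrightarrow> x' \<in> topspace T - U"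
      using open_new_integers_ball[where m = m and K = K and V = "topspace T - U" and x = x] x False unfolding T_def by blast
    then show ?thesis using False by blast
  qed
  then obtain \<epsilon>' where \<epsilon>': "\<And>x. x \<in> topspace T \<Longrightarrow> \<epsilon>' x > 0"
    "\<And>x x'. x \<in> topspace T \<Longrightarrow> x' \<in> topspace T \<Longrightarrow> (\<And>i. i < m \<Longrightarrow> nrm (x' i - x i) < \<epsilon>' x) \<Longrightarrow> x' \<in> U \<longleftrightarrow> x \<in> U"
    by metis
  \<comment> \<open>Only tuples of roots of P serve as centres. There are finitely many, so their
    radii have a positive minimum.\<close>
  define Tup where "Tup = Pi\<^sub>E {..<m} (\<lambda>_. ?R) \<inter> topspace T"
  have finTup: "finite Tup" unfolding Tup_def using finR by (intro finite_Int disjI1 finite_PiE) auto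
  define \<epsilon> where "\<epsilon> = Min (insert \<delta> (\<epsilon>' ` Tup))"
  have \<epsilon>: "\<epsilon> > 0" "\<epsilon> \<le> \<delta>" "\<And>x. x \<in> Tup \<Longrightarrow> \<epsilon> \<le> \<epsilon>' x"
    unfolding \<epsilon>_def using finTup \<delta>(1) \<epsilon>'(1) by (auto simp: Tup_def)
  obtain k where k: "(1 / real CARD('p)) ^ k < \<epsilon> ^ degree P"
    using small_p_power[of "{\<epsilon> ^ degree P}"] \<epsilon>(1) by (metis finite.emptyI finite.insertI insert_iff singletonD zero_less_power)
  show thesis
  proof (rule that)
    fix P' :: "'p padic_int poly"
    assume P': "lead_coeff P' = 1" "degree P' = degree P" "[:padic_p ^ k:] dvd P' - P"
    let ?R' = "root_set P'"
    have finR': "finite ?R'" using finite_root_set[OF P'(1)] .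
    note match = root_matching[OF P P' \<epsilon>(1) k]
    define \<phi> where "\<phi> x' = (SOME x. x \<in> ?R \<and> nrm (x' - x) < \<epsilon>)" for x'
    have \<phi>: "\<phi> x' \<in> ?R" "nrm (x' - \<phi> x') < \<epsilon>" if "x' \<in> ?R'" for x'
    proof -
      have "\<exists>x. x \<in> ?R \<and> nrm (x' - x) < \<epsilon>" using match(1)[OF that] by blast
      then have "\<phi> x' \<in> ?R \<and> nrm (x' - \<phi> x') < \<epsilon>" unfolding \<phi>_def by (rule someI_ex)
      then show "\<phi> x' \<in> ?R" "nrm (x' - \<phi> x') < \<epsilon>" by blast+
    qed
    \<comment> \<open>Two roots of P within \<delta> of x' are within \<delta> of each other by the
      ultrametric inequality, hence equal; the arbitrary choice in \<phi> is therefore no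
      choice.\<close>
    have \<phi>_eq: "\<phi> x' = x" if "x' \<in> ?R'" "x \<in> ?R" "nrm (x' - x) < \<delta>" for x' x
    proof (rule ccontr)
      assume "\<phi> x' \<noteq> x"
      then have "\<delta> \<le> nrm (\<phi> x' - x)" using \<delta>(2) \<phi>(1) that by blast
      moreover have "nrm (\<phi> x' - x') < \<delta>" using \<phi>(2)[OF that(1)] \<epsilon>(2) nrm_minus_commute[of x'] by simp
      ultimately show False using nrm_triangle_less[OF _ that(3), of "\<phi> x'"] by simp
    qed
    have surj: "\<phi> ` ?R' = ?R"
    proof
      show "?R \<subseteq> \<phi> ` ?R'"
      proof
        fix x assume x: "x \<in> ?R"
        then obtain x' where x': "x' \<in> ?R'" "nrm (x - x') < \<epsilon>" using match(2) by blast
        then have "\<phi> x' = x" using \<phi>_eq x \<epsilon>(2) nrm_minus_commute[of x x'] by simp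
        then show "x \<in> \<phi> ` ?R'" using x' by blast
      qed
    qed (use \<phi> in auto)
    then have "card ?R \<le> card ?R'" using card_image_le[OF finR', of \<phi>] by simp
    moreover have "root_tuple_count m U P' = root_tuple_count m U P" if card: "card ?R' = card ?R"
    proof -
      have inj: "inj_on \<phi> ?R'" using eq_card_imp_inj_on[OF finR', of \<phi>] surj card by simp
      \<comment> \<open>Roots of P' closer than \<delta> would have the same image under \<phi>, so
        injectivity passes the separation on to P'.\<close>
      have sep': "\<delta> \<le> nrm (a - b)" if "a \<in> ?R'" "b \<in> ?R'" "a \<noteq> b" for a b
      proof (rule ccontr)
        assume "\<not> \<delta> \<le> nrm (a - b)"
        then have "nrm (a - b) < \<delta>" by simp
        moreover have "nrm (b - \<phi> b) < \<delta>" using \<phi>(2)[OF that(2)] \<epsilon>(2) by simp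
        ultimately have "\<phi> a = \<phi> b" using \<phi>_eq[OF that(1) \<phi>(1)[OF that(2)]] nrm_triangle_less by blast
        then show False using inj that by (auto dest: inj_onD)
      qed
      have close: "nrm (a - \<phi> a) < \<delta>" "nrm (\<phi> a - a) < \<delta>" if "a \<in> ?R'" for a
        using \<phi>(2)[OF that] \<epsilon>(2) nrm_minus_commute[of a] by simp_all
      \<comment> \<open>Krasner twice: each of a and \<phi> a is nearer to the other than to any
        further root of its own polynomial.\<close>
      have kr: "gen_field (\<phi> a) = gen_field a" if a: "a \<in> ?R'" for a
      proof
        have "\<phi> a \<in> gen_field a"
        proof (rule krasner)
          show "poly (lift_poly P) (\<phi> a) = 0" using \<phi>(1)[OF a] by (simp add: lift_poly_embed)
          show "nrm (a - \<phi> a) < nrm (\<phi> a - z)" if "poly (lift_poly P) z = 0" "z \<noteq> \<phi> a" for z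
            using \<delta>(2)[of "\<phi> a" z] \<phi>(1)[OF a] that close[OF a] unfolding lift_poly_embed by fastforce
        qed
        then show "gen_field (\<phi> a) \<subseteq> gen_field a" by (rule gen_field_subset)
        have "a \<in> gen_field (\<phi> a)"
        proof (rule krasner)
          show "poly (lift_poly P') a = 0" using a by (simp add: lift_poly_embed)
          show "nrm (\<phi> a - a) < nrm (a - z)" if "poly (lift_poly P') z = 0" "z \<noteq> a" for z
            using sep'[of a z] a that close[OF a] unfolding lift_poly_embed by fastforce
        qed
        then show "gen_field a \<subseteq> gen_field (\<phi> a)" by (rule gen_field_subset)
      qed
      have new: "\<phi> a \<in> new_integers L \<longleftrightarrow> a \<in> new_integers L" if a: "a \<in> ?R'" for a L
        unfolding new_integers_iff kr[OF a] using iroot_integral[OF P] iroot_integral[OF P'(1)] a \<phi>(1)[OF a] by blast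
      \<comment> \<open>The same \<sigma> works on both sides: it preserves the distance between a
        and \<phi> a, and among separated roots closeness means equality.\<close>
      have conj: "(\<exists>\<sigma>\<in>galois_group. \<sigma> (\<phi> a) = \<phi> b) \<longleftrightarrow> (\<exists>\<sigma>\<in>galois_group. \<sigma> a = b)"
        if ab: "a \<in> ?R'" "b \<in> ?R'" for a b
      proof (intro bex_cong refl iffI)
        fix \<sigma> :: "'p padic_closure \<Rightarrow> 'p padic_closure" assume \<sigma>: "\<sigma> \<in> galois_group"
        show "\<sigma> a = b" if eq: "\<sigma> (\<phi> a) = \<phi> b"
        proof (rule ccontr)
          assume "\<sigma> a \<noteq> b"
          moreover have "\<sigma> a \<in> ?R'" using galois_root[OF \<sigma>] ab by blast
          ultimately have "\<delta> \<le> nrm (\<sigma> a - b)" using sep' ab by blast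
          moreover have "nrm (\<sigma> a - \<sigma> (\<phi> a)) < \<delta>" using galois_nrm[OF \<sigma>] close[OF ab(1)] by simp
          ultimately show False using nrm_triangle_less[of "\<sigma> a" "\<sigma> (\<phi> a)" \<delta> b] eq close[OF ab(2)] by simp
        qed
        show "\<sigma> (\<phi> a) = \<phi> b" if eq: "\<sigma> a = b"
        proof (rule ccontr)
          assume "\<sigma> (\<phi> a) \<noteq> \<phi> b"
          moreover have "\<sigma> (\<phi> a) \<in> ?R" using galois_root[OF \<sigma>] \<phi>(1)[OF ab(1)] by blast
          ultimately have "\<delta> \<le> nrm (\<sigma> (\<phi> a) - \<phi> b)" using \<delta>(2) \<phi>(1)[OF ab(2)] by blast
          moreover have "nrm (\<sigma> (\<phi> a) - \<sigma> a) < \<delta>" using galois_nrm[OF \<sigma>] close[OF ab(1)] by simp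
          ultimately show False using nrm_triangle_less[of "\<sigma> (\<phi> a)" "\<sigma> a" \<delta> "\<phi> b"] eq close[OF ab(2)] by simp
        qed
      qed
      define tuples where "tuples Q = {x \<in> U. (\<forall>i<m. poly (lift_poly Q) (x i) = 0) \<and>
        (\<forall>i<m. \<forall>j<m. i \<noteq> j \<longrightarrow> (\<forall>\<sigma>\<in>galois_group. \<sigma> (x i) \<noteq> x j))}" for Q :: "'p padic_int poly"
      have tuples: "x \<in> tuples Q \<longleftrightarrow> x \<in> U \<and> x \<in> Pi\<^sub>E {..<m} (\<lambda>_. root_set Q) \<and>
          (\<forall>i<m. \<forall>j<m. i \<noteq> j \<longrightarrow> \<not> (\<exists>\<sigma>\<in>galois_group. \<sigma> (x i) = x j))" for x Q
        using U_sub topT unfolding tuples_def lift_poly_embed by (auto simp: PiE_def Pi_def extensional_def)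
      define \<Phi> where "\<Phi> x = restrict (\<phi> \<circ> x) {..<m}" for x
      have \<Phi>_in: "\<Phi> x \<in> Pi\<^sub>E {..<m} (\<lambda>_. ?R)" if "x \<in> Pi\<^sub>E {..<m} (\<lambda>_. ?R')" for x
        using that \<phi>(1) by (auto simp: \<Phi>_def PiE_def Pi_def)
      have \<Phi>_U: "\<Phi> x \<in> U \<longleftrightarrow> x \<in> U" if x: "x \<in> Pi\<^sub>E {..<m} (\<lambda>_. ?R')" for x
      proof -
        have top: "\<Phi> x \<in> topspace T \<longleftrightarrow> x \<in> topspace T"
          using x new unfolding topT \<Phi>_def PiE_def Pi_def extensional_def by auto
        show ?thesis
        proof (cases "x \<in> topspace T")
          case True
          then have "\<Phi> x \<in> Tup" using top \<Phi>_in[OF x] by (simp add: Tup_def)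
          moreover have "nrm (x i - \<Phi> x i) < \<epsilon>" if "i < m" for i
            using \<phi>(2)[of "x i"] x that by (auto simp: \<Phi>_def PiE_def Pi_def)
          ultimately show ?thesis using \<epsilon>'(2)[of "\<Phi> x" x] \<epsilon>(3)[of "\<Phi> x"] True top by fastforce
        qed (use top U_sub in blast)
      qed
      have \<Phi>_tuples: "\<Phi> x \<in> tuples P \<longleftrightarrow> x \<in> tuples P'" if x: "x \<in> Pi\<^sub>E {..<m} (\<lambda>_. ?R')" for x
      proof -
        have "x i \<in> ?R'" if "i < m" for i using x that by (auto simp: PiE_def Pi_def)
        then have "(\<exists>\<sigma>\<in>galois_group. \<sigma> (\<Phi> x i) = \<Phi> x j) \<longleftrightarrow> (\<exists>\<sigma>\<in>galois_group. \<sigma> (x i) = x j)" if "i < m" "j < m" for i j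
          using conj[of "x i" "x j"] that by (simp add: \<Phi>_def)
        then show ?thesis unfolding tuples using \<Phi>_U[OF x] \<Phi>_in[OF x] x by (intro conj_cong) auto
      qed
      have "bij_betw \<Phi> (tuples P') (tuples P)"
        unfolding bij_betw_def
      proof (intro conjI equalityI subsetI)
        show "inj_on \<Phi> (tuples P')"
        proof (rule inj_onI)
          fix x y assume xy: "x \<in> tuples P'" "y \<in> tuples P'" "\<Phi> x = \<Phi> y"
          show "x = y"
          proof (rule PiE_ext)
            show "x \<in> Pi\<^sub>E {..<m} (\<lambda>_. ?R')" "y \<in> Pi\<^sub>E {..<m} (\<lambda>_. ?R')" using xy tuples by blast+
            fix i assume i: "i \<in> {..<m}"
            then have "\<phi> (x i) = \<phi> (y i)" using fun_cong[OF xy(3), of i] by (simp add: \<Phi>_def)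
            moreover have "x i \<in> ?R'" "y i \<in> ?R'" using xy i unfolding tuples by (auto simp: PiE_def Pi_def)
            ultimately show "x i = y i" using inj by (auto dest: inj_onD)
          qed
        qed
        show "z \<in> tuples P" if "z \<in> \<Phi> ` tuples P'" for z using that \<Phi>_tuples tuples by blast
        show "z \<in> \<Phi> ` tuples P'" if z: "z \<in> tuples P" for z
        proof -
          have zR: "z i \<in> \<phi> ` ?R'" if "i < m" for i using z that unfolding tuples surj by (auto simp: PiE_def Pi_def)
          define x where "x = restrict (\<lambda>i. inv_into ?R' \<phi> (z i)) {..<m}"
          have x: "x \<in> Pi\<^sub>E {..<m} (\<lambda>_. ?R')" unfolding x_def using inv_into_into[OF zR] by auto
          have "\<Phi> x = z"
          proof (rule PiE_ext[OF \<Phi>_in[OF x]])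
            show "z \<in> Pi\<^sub>E {..<m} (\<lambda>_. ?R)" using z tuples by blast
            show "\<Phi> x i = z i" if "i \<in> {..<m}" for i
              using that f_inv_into_f[OF zR] by (simp add: \<Phi>_def x_def)
          qed
          then show ?thesis using \<Phi>_tuples[OF x] z by blast
        qed
      qed
      then have "card (tuples P') = card (tuples P)" by (rule bij_betw_same_card)
      then show ?thesis by (simp only: root_tuple_count_def tuples_def)
    qed
    ultimately show "card ?R \<le> card ?R' \<and> (card ?R' = card ?R \<longrightarrow> root_tuple_count m U P' = root_tuple_count m U P)"
      by blast
  qed
qed

lemma root_tuple_count_le:
  fixes P :: "'p::prime_card padic_int poly" and K :: "nat \<Rightarrow> 'p padic_closure set"
  assumes P: "lead_coeff P = 1"
    and U: "openin (product_topology (\<lambda>i. subtopology padic_closure_topology (new_integers (K i))) {..<m}) U"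
  shows "root_tuple_count m U P \<le> degree P ^ m"
proof -
  have "U \<subseteq> extensional {..<m}" using openin_subset[OF U] by (auto simp: PiE_def)
  then have "root_tuple_count m U P \<le> card (Pi\<^sub>E {..<m} (\<lambda>_. root_set P))"
    unfolding root_tuple_count_def lift_poly_embed using finite_root_set[OF P]
    by (intro card_mono finite_PiE) (auto simp: PiE_def)
  also have "\<dots> = card (root_set P) ^ m" by (simp add: card_PiE)
  also have "\<dots> \<le> degree P ^ m"
    using poly_roots_degree[of "map_poly embed P"] monic_neq_0[OF P] by (intro power_mono) auto
  finally show ?thesis .
qed

text \<open>At a squarefree polynomial the number of distinct roots attains its upper bound. Since
  it does not drop nearby, it is locally constant there.\<close>

lemma rsquarefree_card_root_set:
  fixes P :: "'p::prime_card padic_int poly"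
  assumes P: "lead_coeff P = 1"
  shows "card (root_set P) \<le> degree P" and "rsquarefree (lift_poly P) \<Longrightarrow> card (root_set P) = degree P"
proof -
  have P0: "map_poly embed P \<noteq> 0" using monic_neq_0[OF P] by simp
  show "card (root_set P) \<le> degree P" using poly_roots_degree[OF P0] by simp
  assume "rsquarefree (lift_poly P)"
  then have "order x (map_poly embed P) \<le> 1" for x
    unfolding lift_poly_embed rsquarefree_def by (metis le_numeral_extra(4) zero_le_one)
  then have ord: "order x (map_poly embed P) = (if ipoly P x = 0 then 1 else 0)" for x
    using order_root[of "map_poly embed P" x] P0 by (metis One_nat_def le_0_eq le_Suc_eq)
  have "count (iroots P) x = count (mset_set (root_set P)) x" for x
    using finite_root_set[OF P] P0 ord[of x] by simp
  then have "iroots P = mset_set (root_set P)" by (rule multiset_eqI)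
  then show "card (root_set P) = degree P" using size_iroots[OF P] by simp
qed

section \<open>Measures on ranked profinite spaces\<close>

lemma space_borel_of: "space (borel_of T) = topspace T"
  by (simp add: borel_of_def space_measure_of_conv)

lemma sets_borel_of: "sets (borel_of T) = sigma_sets (topspace T) {V. openin T V}"
  unfolding borel_of_def by (rule sets_measure_of) (auto dest: openin_subset)

lemma openin_sets_borel_of: "openin T V \<Longrightarrow> V \<in> sets (borel_of T)"
  by (simp add: sets_borel_of)

lemma continuous_map_borel_measurable:
  assumes "continuous_map T euclideanreal g"
  shows "g \<in> borel_measurable (borel_of T)"
proof (rule borel_measurableI)
  fix V :: "real set" assume "open V"
  then have "openin T {x \<in> topspace T. g x \<in> V}"
    using assms by (intro openin_continuous_map_preimage) (auto simp: open_openin[symmetric])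
  moreover have "g -` V \<inter> space (borel_of T) = {x \<in> topspace T. g x \<in> V}"
    by (auto simp: space_borel_of)
  ultimately show "g -` V \<inter> space (borel_of T) \<in> sets (borel_of T)" by (simp add: openin_sets_borel_of)
qed

lemma convergent_approx:
  fixes a :: "nat \<Rightarrow> real"
  assumes "\<And>e. e > 0 \<Longrightarrow> \<exists>b. convergent b \<and> (\<forall>n. \<bar>a n - b n\<bar> \<le> e)"
  shows "convergent a"
proof -
  have "Cauchy a"
  proof (rule metric_CauchyI)
    fix e :: real assume e: "e > 0"
    then obtain b where b: "convergent b" "\<And>n. \<bar>a n - b n\<bar> \<le> e / 4" using assms[of "e / 4"] by auto
    obtain N where N: "\<And>m n. m \<ge> N \<Longrightarrow> n \<ge> N \<Longrightarrow> dist (b m) (b n) < e / 4"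
      using metric_CauchyD[OF convergent_Cauchy[OF b(1)], of "e / 4"] e by auto
    have "dist (a m) (a n) < e" if "m \<ge> N" "n \<ge> N" for m n
      using N[OF that] b(2)[of m] b(2)[of n] e unfolding dist_real_def by linarith
    then show "\<exists>N. \<forall>m\<ge>N. \<forall>n\<ge>N. dist (a m) (a n) < e" by blast
  qed
  then show ?thesis by (simp add: Cauchy_convergent_iff)
qed

lemma tendsto_approx:
  fixes a :: "nat \<Rightarrow> real"
  assumes "\<And>e. e > 0 \<Longrightarrow> \<exists>b l'. b \<longlonglongrightarrow> l' \<and> (\<forall>\<^sub>F n in sequentially. \<bar>a n - b n\<bar> \<le> e) \<and> \<bar>l - l'\<bar> \<le> e"
  shows "a \<longlonglongrightarrow> l"
proof (rule tendstoI)
  fix e :: real assume e: "e > 0"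
  then obtain b l' where b: "b \<longlonglongrightarrow> l'" "\<forall>\<^sub>F n in sequentially. \<bar>a n - b n\<bar> \<le> e / 4" "\<bar>l - l'\<bar> \<le> e / 4"
    using assms[of "e / 4"] by auto
  have "\<forall>\<^sub>F n in sequentially. dist (b n) l' < e / 4" using tendstoD[OF b(1), of "e / 4"] e by simp
  with b(2) show "\<forall>\<^sub>F n in sequentially. dist (a n) l < e"
  proof eventually_elim
    case (elim n)
    then show ?case using b(3) e unfolding dist_real_def by linarith
  qed
qed

text \<open>The relation E k is the congruence of level k; on each set of bounded rank it has
  finitely many classes, so these sets are profinite.\<close>

locale ranked_profinite =
  fixes \<Omega> :: "'x set" and rk :: "'x \<Rightarrow> nat" and E :: "nat \<Rightarrow> 'x \<Rightarrow> 'x \<Rightarrow> bool" and T :: "'x topology"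
  assumes E_refl: "E k x x"
    and E_sym: "E k x y \<Longrightarrow> E k y x"
    and E_trans: "E k x y \<Longrightarrow> E k y z \<Longrightarrow> E k x z"
    and E_Suc: "E (Suc k) x y \<Longrightarrow> E k x y"
    and E_rk: "E k x y \<Longrightarrow> rk x = rk y"
    and E_finite: "\<exists>Q. finite Q \<and> Q \<subseteq> \<Omega> \<and> (\<forall>x\<in>\<Omega>. rk x \<le> D \<longrightarrow> (\<exists>q\<in>Q. E k q x))"
    and E_complete: "(\<And>k. s k \<in> \<Omega>) \<Longrightarrow> (\<And>k. E k (s k) (s (Suc k))) \<Longrightarrow> \<exists>x\<in>\<Omega>. \<forall>k. E k (s k) x"
    and openin_T: "openin T V \<longleftrightarrow> V \<subseteq> \<Omega> \<and> (\<forall>x\<in>V. \<exists>k. \<forall>y\<in>\<Omega>. E k x y \<longrightarrow> y \<in> V)"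
begin

lemma E_le: "k \<le> l \<Longrightarrow> E l x y \<Longrightarrow> E k x y"
proof (induction l)
  case (Suc l)
  then show ?case using E_Suc by (cases "k = Suc l") auto
qed simp

lemma topspace_T: "topspace T = \<Omega>"
proof
  show "topspace T \<subseteq> \<Omega>" using openin_topspace[of T] unfolding openin_T by blast
  have "openin T \<Omega>" unfolding openin_T by blast
  then show "\<Omega> \<subseteq> topspace T" by (rule openin_subset)
qed

text \<open>Compactness of the part of bounded rank, by a descent as in Koenig's lemma. If no finite
  family covers, there are nested classes of levels 0, 1, 2, ... none of which is finitely covered.
  They close in on a point x, and the class of level \<open>\<kappa> x\<close> is covered by the
  single ball around x.\<close>

lemma finite_subcover:
  fixes \<kappa> :: "'x \<Rightarrow> nat"
  obtains Q where "finite Q" "Q \<subseteq> \<Omega>" "\<And>x. x \<in> \<Omega> \<Longrightarrow> rk x \<le> D \<Longrightarrow> \<exists>q\<in>Q. E (\<kappa> q) q x"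
proof -
  define cov where "cov k x \<longleftrightarrow> (\<exists>Q. finite Q \<and> Q \<subseteq> \<Omega> \<and> (\<forall>y\<in>\<Omega>. E k x y \<longrightarrow> (\<exists>q\<in>Q. E (\<kappa> q) q y)))" for k x
  have glue: "\<exists>Q. finite Q \<and> Q \<subseteq> \<Omega> \<and> (\<forall>r\<in>R. \<forall>y\<in>\<Omega>. E k r y \<longrightarrow> (\<exists>q\<in>Q. E (\<kappa> q) q y))"
    if R: "finite R" "\<And>r. r \<in> R \<Longrightarrow> cov k r" for R k
  proof -
    have "\<forall>r\<in>R. \<exists>Q. finite Q \<and> Q \<subseteq> \<Omega> \<and> (\<forall>y\<in>\<Omega>. E k r y \<longrightarrow> (\<exists>q\<in>Q. E (\<kappa> q) q y))"
      using R(2) unfolding cov_def by blast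
    from bchoice[OF this] obtain f where f: "\<forall>r\<in>R. finite (f r) \<and> f r \<subseteq> \<Omega> \<and> (\<forall>y\<in>\<Omega>. E k r y \<longrightarrow> (\<exists>q\<in>f r. E (\<kappa> q) q y))"
      by blast
    show ?thesis by (rule exI[of _ "\<Union>r\<in>R. f r"]) (use f R(1) in blast)
  qed
  have "\<exists>Q. finite Q \<and> Q \<subseteq> \<Omega> \<and> (\<forall>x\<in>\<Omega>. rk x \<le> D \<longrightarrow> (\<exists>q\<in>Q. E (\<kappa> q) q x))"
  proof (rule ccontr)
    assume neg: "\<not> ?thesis"
    have base: "\<exists>x. x \<in> \<Omega> \<and> \<not> cov 0 x"
    proof (rule ccontr)
      assume "\<nexists>x. x \<in> \<Omega> \<and> \<not> cov 0 x"
      then have all: "\<And>x. x \<in> \<Omega> \<Longrightarrow> cov 0 x" by blast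
      obtain R where R: "finite R" "R \<subseteq> \<Omega>" "\<forall>x\<in>\<Omega>. rk x \<le> D \<longrightarrow> (\<exists>q\<in>R. E 0 q x)" using E_finite[of D 0] by blast
      have "cov 0 r" if "r \<in> R" for r using all R(2) that by blast
      from glue[OF R(1) this] obtain Q where Q: "finite Q" "Q \<subseteq> \<Omega>"
        "\<forall>r\<in>R. \<forall>y\<in>\<Omega>. E 0 r y \<longrightarrow> (\<exists>q\<in>Q. E (\<kappa> q) q y)"
        by blast
      have "\<forall>x\<in>\<Omega>. rk x \<le> D \<longrightarrow> (\<exists>q\<in>Q. E (\<kappa> q) q x)" using Q(3) R(3) by blast
      then show False using neg Q by blast
    qed
    have step: "\<exists>y. (y \<in> \<Omega> \<and> \<not> cov (Suc k) y) \<and> E k x y" if x: "x \<in> \<Omega> \<and> \<not> cov k x" for x k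
    proof (rule ccontr)
      assume "\<not> ?thesis"
      then have all: "\<And>y. y \<in> \<Omega> \<Longrightarrow> E k x y \<Longrightarrow> cov (Suc k) y" by blast
      obtain R where R: "finite R" "R \<subseteq> \<Omega>" "\<forall>y\<in>\<Omega>. rk y \<le> rk x \<longrightarrow> (\<exists>q\<in>R. E (Suc k) q y)" using E_finite[of "rk x" "Suc k"] by blast
      have R': "finite {r \<in> R. E k x r}" using R(1) by simp
      have "cov (Suc k) r" if "r \<in> {r \<in> R. E k x r}" for r using all R(2) that by blast
      from glue[OF R' this] obtain Q where Q: "finite Q" "Q \<subseteq> \<Omega>"
        "\<forall>r\<in>{r \<in> R. E k x r}. \<forall>y\<in>\<Omega>. E (Suc k) r y \<longrightarrow> (\<exists>q\<in>Q. E (\<kappa> q) q y)"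
        by blast
      have "\<exists>q\<in>Q. E (\<kappa> q) q y" if y: "y \<in> \<Omega>" "E k x y" for y
      proof -
        obtain r where r: "r \<in> R" "E (Suc k) r y" using R(3) y E_rk[OF y(2)] by auto
        then have "E k x r" using y(2) E_Suc E_sym E_trans by blast
        then show ?thesis using Q(3) r y(1) by blast
      qed
      then have "cov k x" using Q unfolding cov_def by blast
      then show False using x by blast
    qed
    obtain s where s: "\<And>k. s k \<in> \<Omega> \<and> \<not> cov k (s k)" "\<And>k. E k (s k) (s (Suc k))"
      using dependent_nat_choice[of "\<lambda>k x. x \<in> \<Omega> \<and> \<not> cov k x" "\<lambda>k x y. E k x y"] base step by blast
    obtain x where x: "x \<in> \<Omega>" "\<And>k. E k (s k) x" using E_complete[of s] s by blast
    have "cov (\<kappa> x) (s (\<kappa> x))" unfolding cov_def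
    proof (intro exI[of _ "{x}"] conjI ballI impI)
      fix y assume "y \<in> \<Omega>" "E (\<kappa> x) (s (\<kappa> x)) y"
      then show "\<exists>q\<in>{x}. E (\<kappa> q) q y" using x(2)[of "\<kappa> x"] E_sym E_trans by blast
    qed (use x in auto)
    then show False using s(1) by blast
  qed
  then show thesis using that by blast
qed

section \<open>The algebra of open and closed sets\<close>

text \<open>The open and closed sets, with one level k for all points of bounded rank. Compactness
  would supply this uniformity; having it in the definition makes the Boolean operations
  elementary.\<close>

definition clp :: "'x set \<Rightarrow> bool"
  where "clp A \<longleftrightarrow> A \<subseteq> \<Omega> \<and> (\<forall>D. \<exists>k. \<forall>x\<in>A. \<forall>y\<in>\<Omega>. rk x \<le> D \<longrightarrow> E k x y \<longrightarrow> y \<in> A)"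

lemma clp_subset: "clp A \<Longrightarrow> A \<subseteq> \<Omega>"
  by (simp add: clp_def)

lemma clpD: "clp A \<Longrightarrow> \<exists>k. \<forall>x\<in>A. \<forall>y\<in>\<Omega>. rk x \<le> D \<longrightarrow> E k x y \<longrightarrow> y \<in> A"
  by (simp add: clp_def)

lemma clp_saturated:
  assumes "A \<subseteq> \<Omega>" "\<And>x y. x \<in> A \<Longrightarrow> y \<in> \<Omega> \<Longrightarrow> E k x y \<Longrightarrow> y \<in> A"
  shows "clp A"
  using assms unfolding clp_def by blast

lemma clp_compl: "clp A \<Longrightarrow> clp (\<Omega> - A)"
  unfolding clp_def by (metis DiffD1 DiffD2 DiffI Diff_subset E_rk E_sym)

lemma clp_Int: "clp A \<Longrightarrow> clp B \<Longrightarrow> clp (A \<inter> B)"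
proof -
  assume A: "clp A" and B: "clp B"
  have "\<exists>k. \<forall>x\<in>A \<inter> B. \<forall>y\<in>\<Omega>. rk x \<le> D \<longrightarrow> E k x y \<longrightarrow> y \<in> A \<inter> B" for D
  proof -
    obtain k where "\<forall>x\<in>A. \<forall>y\<in>\<Omega>. rk x \<le> D \<longrightarrow> E k x y \<longrightarrow> y \<in> A"
      using clpD[OF A] by blast
    moreover obtain l where "\<forall>x\<in>B. \<forall>y\<in>\<Omega>. rk x \<le> D \<longrightarrow> E l x y \<longrightarrow> y \<in> B"
      using clpD[OF B] by blast
    ultimately show ?thesis using E_le[of k "max k l"] E_le[of l "max k l"]
      by (intro exI[of _ "max k l"]) fastforce
  qed
  then show ?thesis using A unfolding clp_def by blast
qed

lemma clp_space: "clp \<Omega>" by (auto simp: clp_def)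

lemma clp_empty: "clp {}" by (auto simp: clp_def)

lemma clp_Un: "clp A \<Longrightarrow> clp B \<Longrightarrow> clp (A \<union> B)"
proof -
  assume A: "clp A" "clp B"
  then have "clp (\<Omega> - ((\<Omega> - A) \<inter> (\<Omega> - B)))" by (intro clp_compl clp_Int)
  moreover have "\<Omega> - ((\<Omega> - A) \<inter> (\<Omega> - B)) = A \<union> B" using A[THEN clp_subset] by blast
  ultimately show ?thesis by simp
qed

lemma clp_openin: "clp A \<Longrightarrow> openin T A"
  unfolding openin_T clp_def by (meson order_refl)

lemma clp_sets: "clp A \<Longrightarrow> A \<in> sets (borel_of T)"
  by (intro openin_sets_borel_of clp_openin)

lemma clp_ball: "clp A \<Longrightarrow> x \<in> A \<Longrightarrow> \<exists>k. \<forall>y\<in>\<Omega>. E k x y \<longrightarrow> y \<in> A"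
  using clp_openin unfolding openin_T by blast

definition tail :: "nat \<Rightarrow> 'x set" where "tail D = {x \<in> \<Omega>. D < rk x}"

lemma clp_tail: "clp (tail D)"
  by (rule clp_saturated[of _ 0]) (auto simp: tail_def dest: E_rk)

lemma algebra_clp: "Sigma_Algebra.algebra \<Omega> {A. clp A}"
  unfolding Sigma_Algebra.algebra_iff_Un using clp_subset clp_compl clp_Un clp_empty by auto

text \<open>An open set V is the countable union of the sets of points whose class of level k lies
  in V, and each of these is a union of such classes.\<close>

lemma sigma_sets_clp: "sigma_sets \<Omega> {A. clp A} = sets (borel_of T)"
proof
  show "sigma_sets \<Omega> {A. clp A} \<subseteq> sets (borel_of T)"
    unfolding sets_borel_of topspace_T by (intro sigma_sets_mono') (auto intro: clp_openin)
  have "V \<in> sigma_sets \<Omega> {A. clp A}" if V: "openin T V" for V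
  proof -
    define W where "W k = {x \<in> V. \<forall>y\<in>\<Omega>. E k x y \<longrightarrow> y \<in> V}" for k
    have VX: "V \<subseteq> \<Omega>" using V openin_T by blast
    have "clp (W k)" for k
    proof (rule clp_saturated[of _ k])
      show "W k \<subseteq> \<Omega>" using VX by (auto simp: W_def)
      show "y \<in> W k" if "x \<in> W k" "y \<in> \<Omega>" "E k x y" for x y
        using that E_trans unfolding W_def by blast
    qed
    then have "(\<Union>k. W k) \<in> sigma_sets \<Omega> {A. clp A}" by (intro sigma_sets.Union) auto
    moreover have "V = (\<Union>k. W k)" using V unfolding openin_T W_def by blast
    ultimately show ?thesis by simp
  qed
  then show "sets (borel_of T) \<subseteq> sigma_sets \<Omega> {A. clp A}"
    unfolding sets_borel_of topspace_T by (intro sigma_sets_mono) auto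
qed

section \<open>Laws and bounded measurable functions\<close>

definition law_on :: "'x measure \<Rightarrow> bool"
  where "law_on \<nu> \<longleftrightarrow> prob_space \<nu> \<and> sets \<nu> = sets (borel_of T)"

lemma law_on_space: "law_on \<nu> \<Longrightarrow> space \<nu> = \<Omega>"
  unfolding law_on_def by (metis sets_eq_imp_space_eq space_borel_of topspace_T)

lemma law_on_sets: "law_on \<nu> \<Longrightarrow> clp A \<Longrightarrow> A \<in> sets \<nu>"
  unfolding law_on_def using clp_sets by simp

lemma law_on_measurable: "law_on \<nu> \<Longrightarrow> borel_measurable \<nu> = borel_measurable (borel_of T)"
  unfolding law_on_def by (intro measurable_cong_sets) auto

lemma measure_eqI_clp:
  assumes "law_on \<mu>" "law_on \<nu>" "\<And>A. clp A \<Longrightarrow> measure \<mu> A = measure \<nu> A"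
  shows "\<mu> = \<nu>"
proof (rule measure_eqI_generator_eq[where \<Omega> = \<Omega> and E = "{A. clp A}" and A = "\<lambda>_. \<Omega>"])
  interpret \<mu>: prob_space \<mu> using assms(1) by (simp add: law_on_def)
  interpret \<nu>: prob_space \<nu> using assms(2) by (simp add: law_on_def)
  show "Int_stable {A. clp A}" by (auto simp: Int_stable_def intro: clp_Int)
  show "{A. clp A} \<subseteq> Pow \<Omega>" using clp_subset by auto
  show "emeasure \<mu> A = emeasure \<nu> A" if "A \<in> {A. clp A}" for A
    using assms(3) that by (simp add: \<mu>.emeasure_eq_measure \<nu>.emeasure_eq_measure)
  show "sets \<mu> = sigma_sets \<Omega> {A. clp A}" "sets \<nu> = sigma_sets \<Omega> {A. clp A}"
    using assms(1,2) by (simp_all add: law_on_def sigma_sets_clp)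
  show "emeasure \<mu> \<Omega> \<noteq> \<infinity>" for i by simp
qed (auto simp: clp_space)

definition bounded_meas :: "('x \<Rightarrow> real) \<Rightarrow> bool"
  where "bounded_meas g \<longleftrightarrow> g \<in> borel_measurable (borel_of T) \<and> (\<exists>C. \<forall>x\<in>\<Omega>. \<bar>g x\<bar> \<le> C)"

lemma bounded_meas_integrable:
  assumes "law_on \<nu>" "bounded_meas g"
  shows "integrable \<nu> g"
proof -
  interpret prob_space \<nu> using assms(1) by (simp add: law_on_def)
  obtain C where "\<forall>x\<in>\<Omega>. \<bar>g x\<bar> \<le> C" using assms(2) by (auto simp: bounded_meas_def)
  then show ?thesis
    using assms by (intro integrable_const_bound[where B = C])
      (auto simp: bounded_meas_def law_on_measurable law_on_space)
qed

lemma integral_abs_le: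
  assumes "law_on \<nu>" "bounded_meas g" "\<And>x. x \<in> \<Omega> \<Longrightarrow> \<bar>g x\<bar> \<le> c"
  shows "\<bar>\<integral>x. g x \<partial>\<nu>\<bar> \<le> c"
proof -
  interpret prob_space \<nu> using assms(1) by (simp add: law_on_def)
  have "\<bar>\<integral>x. g x \<partial>\<nu>\<bar> \<le> (\<integral>x. \<bar>g x\<bar> \<partial>\<nu>)" using integral_norm_bound[of \<nu> g] by simp
  also have "\<dots> \<le> (\<integral>x. c \<partial>\<nu>)"
    using bounded_meas_integrable[OF assms(1,2)] assms law_on_space
    by (intro integral_mono) auto
  finally show ?thesis by (simp add: prob_space)
qed

lemma bounded_meas_const: "bounded_meas (\<lambda>_. c)"
  by (auto simp: bounded_meas_def)

lemma bounded_meas_add: "bounded_meas g \<Longrightarrow> bounded_meas h \<Longrightarrow> bounded_meas (\<lambda>x. g x + h x)"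
proof -
  assume g: "bounded_meas g" and h: "bounded_meas h"
  then obtain C D where "\<forall>x\<in>\<Omega>. \<bar>g x\<bar> \<le> C" "\<forall>x\<in>\<Omega>. \<bar>h x\<bar> \<le> D" by (auto simp: bounded_meas_def)
  then have "\<forall>x\<in>\<Omega>. \<bar>g x + h x\<bar> \<le> C + D" by (meson abs_triangle_ineq add_mono order_trans)
  then show ?thesis using g h by (auto simp: bounded_meas_def)
qed

lemma bounded_meas_mult: "bounded_meas g \<Longrightarrow> bounded_meas h \<Longrightarrow> bounded_meas (\<lambda>x. g x * h x)"
proof -
  assume g: "bounded_meas g" and h: "bounded_meas h"
  then obtain C D where "\<forall>x\<in>\<Omega>. \<bar>g x\<bar> \<le> C" "\<forall>x\<in>\<Omega>. \<bar>h x\<bar> \<le> D" by (auto simp: bounded_meas_def)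
  then have "\<forall>x\<in>\<Omega>. \<bar>g x * h x\<bar> \<le> C * D" unfolding abs_mult by (meson abs_ge_zero mult_mono order_trans)
  then show ?thesis using g h by (auto simp: bounded_meas_def)
qed

lemma bounded_meas_sum: "(\<And>i. i \<in> I \<Longrightarrow> bounded_meas (f i)) \<Longrightarrow> bounded_meas (\<lambda>x. \<Sum>i\<in>I. f i x)"
  by (induction I rule: infinite_finite_induct) (simp_all add: bounded_meas_const bounded_meas_add)

lemma bounded_meas_diff: "bounded_meas g \<Longrightarrow> bounded_meas h \<Longrightarrow> bounded_meas (\<lambda>x. g x - h x)"
  using bounded_meas_add[of g "\<lambda>x. - 1 * h x"] bounded_meas_mult[OF bounded_meas_const, of h "- 1"] by simp

lemma bounded_meas_indicator: "clp A \<Longrightarrow> bounded_meas (indicator A)"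
  using clp_sets by (auto simp: bounded_meas_def indicator_def intro!: exI[of _ 1])

lemma bounded_meas_continuous:
  "continuous_map T euclideanreal g \<Longrightarrow> bounded (g ` \<Omega>) \<Longrightarrow> bounded_meas g"
  by (auto simp: bounded_meas_def continuous_map_borel_measurable bounded_iff)

lemma integral_indicator_law_on: "law_on \<nu> \<Longrightarrow> clp A \<Longrightarrow> (\<integral>x. indicator A x \<partial>\<nu>) = measure \<nu> A"
  using clp_subset[of A] by (simp add: law_on_space Int_absorb2)

definition tight :: "(nat \<Rightarrow> 'x measure) \<Rightarrow> bool"
  where "tight \<nu> \<longleftrightarrow> (\<forall>e>0. \<exists>D. \<forall>n. measure (\<nu> n) (tail D) \<le> e)"

lemma continuous_on_clp:
  assumes "\<And>x. x \<in> \<Omega> \<Longrightarrow> \<exists>k. \<forall>y\<in>\<Omega>. E k x y \<longrightarrow> g y = g x"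
  shows "continuous_map T euclideanreal g"
  unfolding continuous_map_def topspace_T
proof (intro conjI allI impI)
  fix U :: "real set" assume "openin euclideanreal U"
  show "openin T {x \<in> \<Omega>. g x \<in> U}" unfolding openin_T
  proof (intro conjI ballI)
    fix x assume x: "x \<in> {x \<in> \<Omega>. g x \<in> U}"
    then obtain k where "\<forall>y\<in>\<Omega>. E k x y \<longrightarrow> g y = g x" using assms by blast
    then show "\<exists>k. \<forall>y\<in>\<Omega>. E k x y \<longrightarrow> y \<in> {x \<in> \<Omega>. g x \<in> U}" using x by (metis (mono_tags, lifting) mem_Collect_eq)
  qed blast
qed simp

lemma continuous_indicator_clp:
  assumes "clp A"
  shows "continuous_map T euclideanreal (indicator A)"
proof (rule continuous_on_clp)
  fix x assume x: "x \<in> \<Omega>"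
  show "\<exists>k. \<forall>y\<in>\<Omega>. E k x y \<longrightarrow> (indicator A y :: real) = indicator A x"
  proof (cases "x \<in> A")
    case True
    then show ?thesis using clp_ball[OF assms] by (metis indicator_simps(1))
  next
    case False
    then show ?thesis using clp_ball[OF clp_compl[OF assms], of x] x by (metis DiffD2 DiffI indicator_simps(2))
  qed
qed

text \<open>By compactness g is uniformly continuous up to rank D, so replacing x by a
  representative of its class of level k costs at most e. The value 0 beyond rank D keeps the bound
  C.\<close>

lemma uniform_step_approximation:
  assumes g: "continuous_map T euclideanreal g" "\<And>x. x \<in> \<Omega> \<Longrightarrow> \<bar>g x\<bar> \<le> C" and "0 \<le> C" "e > 0"
  shows "\<exists>h F. finite F \<and> (\<forall>c. clp {x \<in> \<Omega>. h x = c}) \<and> (\<forall>x\<in>\<Omega>. h x \<in> F) \<and>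
    (\<forall>x\<in>\<Omega>. rk x \<le> D \<longrightarrow> \<bar>g x - h x\<bar> \<le> e) \<and> (\<forall>x\<in>\<Omega>. \<bar>h x\<bar> \<le> C)"
proof -
  have "\<exists>k. \<forall>y\<in>\<Omega>. E k x y \<longrightarrow> \<bar>g y - g x\<bar> < e / 2" if x: "x \<in> \<Omega>" for x
  proof -
    have "openin T {y \<in> \<Omega>. g y \<in> ball (g x) (e / 2)}"
      using g(1) openin_continuous_map_preimage[of T euclideanreal g "ball (g x) (e / 2)"]
      by (simp add: topspace_T open_openin[symmetric])
    then show ?thesis using x \<open>e > 0\<close> unfolding openin_T by (force simp: dist_real_def abs_minus_commute)
  qed
  then obtain \<kappa> where \<kappa>: "\<And>x y. x \<in> \<Omega> \<Longrightarrow> y \<in> \<Omega> \<Longrightarrow> E (\<kappa> x) x y \<Longrightarrow> \<bar>g y - g x\<bar> < e / 2" by metis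
  obtain Q where Q: "finite Q" "Q \<subseteq> \<Omega>" "\<And>x. x \<in> \<Omega> \<Longrightarrow> rk x \<le> D \<Longrightarrow> \<exists>q\<in>Q. E (\<kappa> q) q x"
    by (rule finite_subcover[where D = D and \<kappa> = \<kappa>]) blast
  define k where "k = Max (insert 0 (\<kappa> ` Q))"
  have k: "\<kappa> q \<le> k" if "q \<in> Q" for q using Q(1) that by (auto simp: k_def)
  have uni: "\<bar>g x - g y\<bar> < e" if xy: "x \<in> \<Omega>" "y \<in> \<Omega>" "rk x \<le> D" "E k x y" for x y
  proof -
    obtain q where q: "q \<in> Q" "E (\<kappa> q) q x" using Q(3) xy by blast
    then have "E (\<kappa> q) q y" using E_le[OF k[OF q(1)] xy(4)] E_trans by blast
    then have "\<bar>g x - g q\<bar> < e / 2" "\<bar>g y - g q\<bar> < e / 2" using \<kappa>[of q] q Q(2) xy by auto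
    then show ?thesis by linarith
  qed
  \<comment> \<open>For congruent points the two predicates coincide, so the choice operator returns
    the same representative, and the step function is constant on classes.\<close>
  define r where "r x = (SOME y. y \<in> \<Omega> \<and> E k x y)" for x
  have r: "r x \<in> \<Omega>" "E k x (r x)" if "x \<in> \<Omega>" for x
    using someI[of "\<lambda>y. y \<in> \<Omega> \<and> E k x y" x] that E_refl by (simp_all add: r_def)
  have r_eq: "r x = r y" if "E k x y" for x y
  proof -
    have "E k x z \<longleftrightarrow> E k y z" for z using that E_sym E_trans by blast
    then show ?thesis by (simp add: r_def)
  qed
  define h where "h x = (if rk x \<le> D then g (r x) else 0)" for x
  have h_eq: "h x = h y" if "E k x y" for x y using r_eq[OF that] E_rk[OF that] by (simp add: h_def)
  obtain R where R: "finite R" "R \<subseteq> \<Omega>" "\<forall>x\<in>\<Omega>. rk x \<le> D \<longrightarrow> (\<exists>q\<in>R. E k q x)" using E_finite[of D k] by blast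
  show ?thesis
  proof (intro exI[of _ h] exI[of _ "insert 0 (h ` R)"] conjI ballI allI impI)
    show "finite (insert 0 (h ` R))" using R by simp
    show "clp {x \<in> \<Omega>. h x = c}" for c
      by (rule clp_saturated[of _ k]) (use h_eq in auto)
    show "h x \<in> insert 0 (h ` R)" if x: "x \<in> \<Omega>" for x
    proof (cases "rk x \<le> D")
      case True
      then obtain q where "q \<in> R" "E k q x" using R(3) x by blast
      then show ?thesis using h_eq by (metis image_eqI insertCI)
    qed (simp add: h_def)
    show "\<bar>g x - h x\<bar> \<le> e" if "x \<in> \<Omega>" "rk x \<le> D" for x
      using uni[of x "r x"] r[OF that(1)] that by (simp add: h_def)
    show "\<bar>h x\<bar> \<le> C" if "x \<in> \<Omega>" for x using g(2)[OF r(1)[OF that]] \<open>0 \<le> C\<close> by (simp add: h_def)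
  qed
qed

section \<open>Weak convergence and existence of limit laws\<close>

lemma weak_convergence:
  assumes \<nu>: "\<And>n. law_on (\<nu> n)" and \<mu>: "law_on \<mu>" and t: "tight \<nu>"
    and conv: "\<And>A. clp A \<Longrightarrow> (\<lambda>n. measure (\<nu> n) A) \<longlonglongrightarrow> measure \<mu> A"
    and g: "continuous_map T euclideanreal g" "bounded (g ` \<Omega>)"
  shows "(\<lambda>n. \<integral>x. g x \<partial>\<nu> n) \<longlonglongrightarrow> (\<integral>x. g x \<partial>\<mu>)"
proof (rule tendsto_approx)
  fix e :: real assume e: "e > 0"
  obtain C where C: "C > 0" "\<And>x. x \<in> \<Omega> \<Longrightarrow> \<bar>g x\<bar> \<le> C" using g(2) unfolding bounded_pos by auto
  \<comment> \<open>Beyond rank D the error is at most 2 C, so mass d there costs e / 2; the other e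
    / 2 is the error up to rank D.\<close>
  define d where "d = e / (4 * C)"
  have "d > 0" using e C by (simp add: d_def)
  then obtain D where D: "\<And>n. measure (\<nu> n) (tail D) \<le> d" using t unfolding tight_def by blast
  have D\<mu>: "measure \<mu> (tail D) \<le> d"
    using conv[OF clp_tail] by (rule LIMSEQ_le_const2) (use D in auto)
  have "\<exists>h F. finite F \<and> (\<forall>c. clp {x \<in> \<Omega>. h x = c}) \<and> (\<forall>x\<in>\<Omega>. h x \<in> F) \<and>
    (\<forall>x\<in>\<Omega>. rk x \<le> D \<longrightarrow> \<bar>g x - h x\<bar> \<le> e / 2) \<and> (\<forall>x\<in>\<Omega>. \<bar>h x\<bar> \<le> C)"
    by (rule uniform_step_approximation[OF g(1)]) (use C e in auto)
  then obtain h F where h: "finite F" "\<And>c. clp {x \<in> \<Omega>. h x = c}" "\<And>x. x \<in> \<Omega> \<Longrightarrow> h x \<in> F"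
    "\<And>x. x \<in> \<Omega> \<Longrightarrow> rk x \<le> D \<Longrightarrow> \<bar>g x - h x\<bar> \<le> e / 2" "\<And>x. x \<in> \<Omega> \<Longrightarrow> \<bar>h x\<bar> \<le> C"
    by blast
  define H where "H x = (\<Sum>c\<in>F. c * indicator {x \<in> \<Omega>. h x = c} x)" for x
  have H: "H x = h x" if "x \<in> \<Omega>" for x
  proof -
    have "H x = (\<Sum>c\<in>F. if c = h x then c else 0)" unfolding H_def using that by (intro sum.cong) auto
    then show ?thesis using h(1) h(3)[OF that] by simp
  qed
  have bm_term: "bounded_meas (\<lambda>x. c * indicator {x \<in> \<Omega>. h x = c} x)" for c
    by (intro bounded_meas_mult bounded_meas_const bounded_meas_indicator h(2))
  have bmH: "bounded_meas H" unfolding H_def by (intro bounded_meas_sum bm_term)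
  have bmg: "bounded_meas g" using bounded_meas_continuous g by blast
  have intH: "(\<integral>x. H x \<partial>\<rho>) = (\<Sum>c\<in>F. c * measure \<rho> {x \<in> \<Omega>. h x = c})" if "law_on \<rho>" for \<rho>
  proof -
    have "(\<integral>x. H x \<partial>\<rho>) = (\<Sum>c\<in>F. \<integral>x. c * indicator {x \<in> \<Omega>. h x = c} x \<partial>\<rho>)"
      unfolding H_def using bounded_meas_integrable[OF that bm_term] by (intro Bochner_Integration.integral_sum)
    then show ?thesis using integral_indicator_law_on[OF that h(2)] by simp
  qed
  have close: "\<bar>(\<integral>x. g x \<partial>\<rho>) - (\<integral>x. H x \<partial>\<rho>)\<bar> \<le> e"
    if \<rho>: "law_on \<rho>" "measure \<rho> (tail D) \<le> d" for \<rho>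
  proof -
    interpret prob_space \<rho> using \<rho> by (simp add: law_on_def)
    note int = bounded_meas_integrable[OF \<rho>(1)]
    have b: "\<bar>g x - H x\<bar> \<le> e / 2 + 2 * C * indicator (tail D) x" if x: "x \<in> \<Omega>" for x
    proof (cases "rk x \<le> D")
      case True
      then show ?thesis using h(4)[OF x] H[OF x] by (simp add: tail_def)
    next
      case False
      then have "indicator (tail D) x = (1 :: real)" using x by (simp add: tail_def)
      then show ?thesis using C(2)[OF x] h(5)[OF x] H[OF x] e by simp
    qed
    have "\<bar>(\<integral>x. g x \<partial>\<rho>) - (\<integral>x. H x \<partial>\<rho>)\<bar> = \<bar>\<integral>x. g x - H x \<partial>\<rho>\<bar>"
      using int[OF bmg] int[OF bmH] by simp
    also have "\<dots> \<le> (\<integral>x. \<bar>g x - H x\<bar> \<partial>\<rho>)" using integral_norm_bound[of \<rho> "\<lambda>x. g x - H x"] by simp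
    also have "\<dots> \<le> (\<integral>x. e / 2 + 2 * C * indicator (tail D) x \<partial>\<rho>)"
    proof (rule integral_mono)
      show "integrable \<rho> (\<lambda>x. \<bar>g x - H x\<bar>)" using int[OF bounded_meas_diff[OF bmg bmH]] by simp
      show "integrable \<rho> (\<lambda>x. e / 2 + 2 * C * indicator (tail D) x)"
        by (intro int bounded_meas_add bounded_meas_mult bounded_meas_const bounded_meas_indicator clp_tail)
    qed (use b law_on_space[OF \<rho>(1)] in auto)
    also have "\<dots> = e / 2 + 2 * C * measure \<rho> (tail D)"
      using int[OF bounded_meas_indicator[OF clp_tail[of D]]] integral_indicator_law_on[OF \<rho>(1) clp_tail[of D]]
      by (simp add: prob_space)
    also have "\<dots> \<le> e / 2 + 2 * C * d" using \<rho>(2) C(1) by (intro add_mono mult_left_mono) auto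
    also have "\<dots> = e" using C(1) by (simp add: d_def)
    finally show ?thesis .
  qed
  show "\<exists>b l'. b \<longlonglongrightarrow> l' \<and> (\<forall>\<^sub>F n in sequentially. \<bar>(\<integral>x. g x \<partial>\<nu> n) - b n\<bar> \<le> e) \<and> \<bar>(\<integral>x. g x \<partial>\<mu>) - l'\<bar> \<le> e"
  proof (intro exI conjI)
    show "(\<lambda>n. \<integral>x. H x \<partial>\<nu> n) \<longlonglongrightarrow> (\<integral>x. H x \<partial>\<mu>)"
      unfolding intH[OF \<nu>] intH[OF \<mu>] by (intro tendsto_sum tendsto_mult tendsto_const conv h(2))
    show "\<forall>\<^sub>F n in sequentially. \<bar>(\<integral>x. g x \<partial>\<nu> n) - (\<integral>x. H x \<partial>\<nu> n)\<bar> \<le> e"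
      using close[OF \<nu> D] by simp
    show "\<bar>(\<integral>x. g x \<partial>\<mu>) - (\<integral>x. H x \<partial>\<mu>)\<bar> \<le> e" using close[OF \<mu> D\<mu>] .
  qed
qed

text \<open>The limits of the measures are finitely additive on the algebra of \<open>clp\<close>
  sets, and Caratheodory's theorem asks for continuity at the empty set. If such sets decrease to
  the empty set, compactness of the part up to rank D pushes them into \<open>tail D\<close> from
  some index on, where tightness makes the mass uniformly small.\<close>

lemma limit_law_exists:
  assumes \<nu>: "\<And>n. law_on (\<nu> n)" and t: "tight \<nu>"
    and conv: "\<And>A. clp A \<Longrightarrow> convergent (\<lambda>n. measure (\<nu> n) A)"
  obtains \<mu> where "law_on \<mu>" "\<And>A. clp A \<Longrightarrow> (\<lambda>n. measure (\<nu> n) A) \<longlonglongrightarrow> measure \<mu> A"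
proof -
  interpret Sigma_Algebra.algebra \<Omega> "{A. clp A}" by (rule algebra_clp)
  define l where "l A = lim (\<lambda>n. measure (\<nu> n) A)" for A
  have l: "(\<lambda>n. measure (\<nu> n) A) \<longlonglongrightarrow> l A" if "clp A" for A
    using conv[OF that] unfolding l_def by (simp add: convergent_LIMSEQ_iff)
  have l0: "l A \<ge> 0" if "clp A" for A by (rule LIMSEQ_le_const[OF l[OF that]]) auto
  have pos: "positive {A. clp A} (\<lambda>A. ennreal (l A))"
    using LIMSEQ_unique[OF l[OF clp_empty], of 0] by (simp add: positive_def)
  have l_add: "l (A \<union> B) = l A + l B" if AB: "clp A" "clp B" "A \<inter> B = {}" for A B
  proof (rule LIMSEQ_unique[OF l[OF clp_Un[OF AB(1,2)]]])
    have "measure (\<nu> n) (A \<union> B) = measure (\<nu> n) A + measure (\<nu> n) B" for n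
    proof -
      interpret prob_space "\<nu> n" using \<nu> by (simp add: law_on_def)
      show ?thesis using law_on_sets[OF \<nu>] AB by (intro finite_measure_Union) auto
    qed
    then show "(\<lambda>n. measure (\<nu> n) (A \<union> B)) \<longlonglongrightarrow> l A + l B" using l AB by (simp add: tendsto_add)
  qed
  have add: "additive {A. clp A} (\<lambda>A. ennreal (l A))"
    unfolding additive_def using l_add l0 by (auto simp: ennreal_plus)
  have cont: "(\<lambda>i. ennreal (l (A i))) \<longlonglongrightarrow> 0"
    if A: "range A \<subseteq> {A. clp A}" "decseq A" "(\<Inter>i. A i) = {}" for A :: "nat \<Rightarrow> 'x set"
  proof -
    have clpA: "clp (A i)" for i using A(1) by blast
    have "(\<lambda>i. l (A i)) \<longlonglongrightarrow> 0"
    proof (rule LIMSEQ_I)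
      fix e :: real assume e: "e > 0"
      obtain D where D: "\<And>n. measure (\<nu> n) (tail D) \<le> e / 2" using t e unfolding tight_def by (metis half_gt_zero)
      have "\<exists>i k. \<forall>y\<in>\<Omega>. E k x y \<longrightarrow> y \<in> \<Omega> - A i" if x: "x \<in> \<Omega>" for x
      proof -
        obtain i where "x \<notin> A i" using A(3) by blast
        then show ?thesis using clp_ball[OF clp_compl[OF clpA[of i]], of x] x by blast
      qed
      then obtain i \<kappa> where i: "\<And>x y. x \<in> \<Omega> \<Longrightarrow> y \<in> \<Omega> \<Longrightarrow> E (\<kappa> x) x y \<Longrightarrow> y \<in> \<Omega> - A (i x)" by metis
      obtain Q where Q: "finite Q" "Q \<subseteq> \<Omega>" "\<And>x. x \<in> \<Omega> \<Longrightarrow> rk x \<le> D \<Longrightarrow> \<exists>q\<in>Q. E (\<kappa> q) q x"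
        by (rule finite_subcover[where D = D and \<kappa> = \<kappa>]) blast
      define N where "N = Max (insert 0 (i ` Q))"
      have "A j \<subseteq> tail D" if j: "j \<ge> N" for j
      proof
        fix x assume x: "x \<in> A j"
        then have xX: "x \<in> \<Omega>" using clp_subset[OF clpA] by blast
        have "\<not> rk x \<le> D"
        proof
          assume "rk x \<le> D"
          then obtain q where q: "q \<in> Q" "E (\<kappa> q) q x" using Q(3) xX by blast
          then have "x \<notin> A (i q)" using i[of q x] Q(2) xX by blast
          moreover have "i q \<le> j" using q(1) Q(1) j unfolding N_def by (meson Max_ge finite.insertI finite_imageI imageI insertI2 order_trans)
          ultimately show False using A(2) x by (auto simp: decseq_def)
        qed
        then show "x \<in> tail D" using xX by (simp add: tail_def)
      qed
      then have "measure (\<nu> n) (A j) \<le> e / 2" if "j \<ge> N" for j n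
      proof -
        interpret prob_space "\<nu> n" using \<nu> by (simp add: law_on_def)
        show ?thesis using finite_measure_mono[of "A j" "tail D"] law_on_sets[OF \<nu> clp_tail] D[of n] that \<open>\<And>j. N \<le> j \<Longrightarrow> A j \<subseteq> tail D\<close>
          by (meson order_trans)
      qed
      then have lA: "l (A j) \<le> e / 2" if "j \<ge> N" for j
        by (intro LIMSEQ_le_const2[OF l[OF clpA]]) (use that in auto)
      show "\<exists>N. \<forall>j\<ge>N. norm (l (A j) - 0) < e"
      proof (intro exI allI impI)
        fix j assume "N \<le> j"
        then show "norm (l (A j) - 0) < e" using lA[of j] l0[OF clpA[of j]] e by simp
      qed
    qed
    then show ?thesis using tendsto_ennrealI by fastforce
  qed
  have "\<exists>\<mu>. (\<forall>s\<in>{A. clp A}. \<mu> s = ennreal (l s)) \<and> measure_space \<Omega> (sigma_sets \<Omega> {A. clp A}) \<mu>"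
    by (rule caratheodory_empty_continuous[OF pos add _ cont]) auto
  then obtain m where m: "\<And>s. clp s \<Longrightarrow> m s = ennreal (l s)" "measure_space \<Omega> (sigma_sets \<Omega> {A. clp A}) m"
    by blast
  define \<mu> where "\<mu> = measure_of \<Omega> (sigma_sets \<Omega> {A. clp A}) m"
  have clp_Pow: "{A. clp A} \<subseteq> Pow \<Omega>" using clp_subset by blast
  then have sub: "sigma_sets \<Omega> {A. clp A} \<subseteq> Pow \<Omega>" using sigma_sets_into_sp by blast
  have sets: "sets \<mu> = sigma_sets \<Omega> {A. clp A}"
    unfolding \<mu>_def by (rule sigma_algebra.sets_measure_of_eq[OF sigma_algebra_sigma_sets[OF clp_Pow]])
  have em: "emeasure \<mu> A = ennreal (l A)" if "clp A" for A
    using emeasure_measure_of[OF \<mu>_def, of A] m that sub sets by (auto simp: measure_space_def)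
  have "l \<Omega> = 1"
  proof (rule LIMSEQ_unique[OF l[OF clp_space]])
    have "measure (\<nu> n) \<Omega> = 1" for n
      using prob_space.prob_space[of "\<nu> n"] \<nu>[of n] law_on_space[OF \<nu>] by (simp add: law_on_def)
    then show "(\<lambda>n. measure (\<nu> n) \<Omega>) \<longlonglongrightarrow> 1" by simp
  qed
  then have "prob_space \<mu>"
    using em[OF clp_space] sub unfolding \<mu>_def by (intro prob_spaceI) (simp add: space_measure_of)
  then have law: "law_on \<mu>" using sets by (simp add: law_on_def sigma_sets_clp)
  show thesis
  proof (rule that[OF law])
    show "(\<lambda>n. measure (\<nu> n) A) \<longlonglongrightarrow> measure \<mu> A" if "clp A" for A
      using l[OF that] em[OF that] l0[OF that] by (simp add: measure_def)
  qed
qed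

text \<open>On the set where a level-k neighbourhood keeps h constant, h is continuous.\<close>

lemma continuous_mapping:
  assumes \<nu>: "\<And>n. law_on (\<nu> n)" and \<mu>: "law_on \<mu>"
    and conv: "\<And>g. continuous_map T euclideanreal g \<Longrightarrow> bounded (g ` \<Omega>) \<Longrightarrow>
      (\<lambda>n. \<integral>x. g x \<partial>\<nu> n) \<longlonglongrightarrow> (\<integral>x. g x \<partial>\<mu>)"
    and h: "bounded_meas h" and loc: "AE x in \<mu>. \<exists>k. \<forall>y\<in>\<Omega>. E k x y \<longrightarrow> h y = h x"
  shows "(\<lambda>n. \<integral>x. h x \<partial>\<nu> n) \<longlonglongrightarrow> (\<integral>x. h x \<partial>\<mu>)"
proof (rule tendsto_approx)
  fix e :: real assume e: "e > 0"
  interpret \<mu>: prob_space \<mu> using \<mu> by (simp add: law_on_def)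
  obtain C0 where "\<And>x. x \<in> \<Omega> \<Longrightarrow> \<bar>h x\<bar> \<le> C0" using h by (auto simp: bounded_meas_def)
  then obtain C where C: "C > 0" "\<And>x. x \<in> \<Omega> \<Longrightarrow> \<bar>h x\<bar> \<le> C" by (metis abs_ge_zero less_add_one less_imp_le order_le_less_trans order_trans)
  define G where "G k = {x \<in> \<Omega>. \<forall>y\<in>\<Omega>. E k x y \<longrightarrow> h y = h x}" for k
  have G_sat: "y \<in> G k" if "x \<in> G k" "y \<in> \<Omega>" "E k x y" for x y k
  proof -
    have "h z = h y" if "z \<in> \<Omega>" "E k y z" for z
      using \<open>x \<in> G k\<close> E_trans[OF \<open>E k x y\<close> that(2)] that(1) \<open>y \<in> \<Omega>\<close> \<open>E k x y\<close> by (simp add: G_def)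
    then show ?thesis using that(2) by (simp add: G_def)
  qed
  have G: "clp (G k)" for k
  proof (rule clp_saturated[of _ k])
    show "G k \<subseteq> \<Omega>" by (auto simp: G_def)
    show "y \<in> G k" if "x \<in> G k" "y \<in> \<Omega>" "E k x y" for x y using G_sat that by blast
  qed
  have "incseq G" unfolding incseq_Suc_iff G_def using E_Suc by blast
  then have "(\<lambda>k. measure \<mu> (G k)) \<longlonglongrightarrow> measure \<mu> (\<Union>k. G k)"
    using law_on_sets[OF \<mu> G] by (intro \<mu>.finite_Lim_measure_incseq) auto
  moreover have "measure \<mu> (\<Union>k. G k) = 1"
  proof (subst \<mu>.prob_eq_1)
    show "(\<Union>k. G k) \<in> sets \<mu>" using law_on_sets[OF \<mu> G] by auto
    show "AE x in \<mu>. x \<in> (\<Union>k. G k)" using loc AE_space law_on_space[OF \<mu>] by (auto simp: G_def)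
  qed
  ultimately have "(\<lambda>k. measure \<mu> (G k)) \<longlonglongrightarrow> 1" by simp
  moreover have d: "1 - e / (2 * C) < 1" using e C by simp
  ultimately obtain k where k: "1 - e / (2 * C) < measure \<mu> (G k)"
    using order_tendstoD(1) eventually_sequentially by (metis order_refl)
  \<comment> \<open>The set \<open>G k\<close> is open and closed and h is constant on the classes
    inside it, so g is continuous. It differs from h only off \<open>G k\<close>, by at most
    C.\<close>
  define g where "g x = h x * indicator (G k) x" for x
  have g_bm: "bounded_meas g" unfolding g_def by (intro bounded_meas_mult h bounded_meas_indicator G)
  have g_cont: "continuous_map T euclideanreal g"
  proof (rule continuous_on_clp)
    fix x assume x: "x \<in> \<Omega>"
    show "\<exists>k. \<forall>y\<in>\<Omega>. E k x y \<longrightarrow> g y = g x"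
    proof (cases "x \<in> G k")
      case True
      have "g y = g x" if "y \<in> \<Omega>" "E k x y" for y
      proof -
        have "y \<in> G k" using G_sat True that by blast
        then show ?thesis using True that by (simp add: g_def G_def)
      qed
      then show ?thesis by blast
    next
      case False
      then obtain l where "\<forall>y\<in>\<Omega>. E l x y \<longrightarrow> y \<in> \<Omega> - G k" using clp_ball[OF clp_compl[OF G[of k]], of x] x by blast
      then show ?thesis using False by (intro exI[of _ l]) (auto simp: g_def)
    qed
  qed
  have g_bd: "bounded (g ` \<Omega>)" using C(2) C(1) unfolding bounded_iff
    by (intro exI[of _ C]) (auto simp: g_def indicator_def)
  have close: "\<bar>(\<integral>x. h x \<partial>\<rho>) - (\<integral>x. g x \<partial>\<rho>)\<bar> \<le> e"
    if \<rho>: "law_on \<rho>" "1 - e / C \<le> measure \<rho> (G k)" for \<rho>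
  proof -
    interpret prob_space \<rho> using \<rho> by (simp add: law_on_def)
    note int = bounded_meas_integrable[OF \<rho>(1)]
    have b: "\<bar>h x - g x\<bar> \<le> C * (1 - indicator (G k) x)" if x: "x \<in> \<Omega>" for x
      using C(2)[OF x] by (auto simp: g_def indicator_def)
    have "\<bar>(\<integral>x. h x \<partial>\<rho>) - (\<integral>x. g x \<partial>\<rho>)\<bar> = \<bar>\<integral>x. h x - g x \<partial>\<rho>\<bar>"
      using int[OF h] int[OF g_bm] by simp
    also have "\<dots> \<le> (\<integral>x. \<bar>h x - g x\<bar> \<partial>\<rho>)" using integral_norm_bound[of \<rho> "\<lambda>x. h x - g x"] by simp
    also have "\<dots> \<le> (\<integral>x. C * (1 - indicator (G k) x) \<partial>\<rho>)"
    proof (rule integral_mono)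
      show "integrable \<rho> (\<lambda>x. \<bar>h x - g x\<bar>)" using int[OF bounded_meas_diff[OF h g_bm]] by simp
      show "integrable \<rho> (\<lambda>x. C * (1 - indicator (G k) x))"
        by (intro int bounded_meas_diff bounded_meas_mult bounded_meas_const bounded_meas_indicator G)
    qed (use b law_on_space[OF \<rho>(1)] in auto)
    also have "\<dots> = C * (1 - measure \<rho> (G k))"
      using int[OF bounded_meas_indicator[OF G[of k]]] integral_indicator_law_on[OF \<rho>(1) G[of k]]
      by (simp add: prob_space)
    also have "\<dots> \<le> C * (e / C)" using \<rho>(2) C(1) by (intro mult_left_mono) auto
    finally show ?thesis using C(1) by simp
  qed
  have "(\<lambda>n. measure (\<nu> n) (G k)) \<longlonglongrightarrow> measure \<mu> (G k)"
  proof -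
    have "bounded ((indicator (G k) :: 'x \<Rightarrow> real) ` \<Omega>)"
      by (auto simp: bounded_iff indicator_def intro!: exI[of _ 1])
    then show ?thesis using conv[OF continuous_indicator_clp[OF G[of k]]]
      unfolding integral_indicator_law_on[OF \<nu> G] integral_indicator_law_on[OF \<mu> G] by blast
  qed
  then have "\<forall>\<^sub>F n in sequentially. 1 - e / (2 * C) < measure (\<nu> n) (G k)" using k by (rule order_tendstoD(1))
  then have ev: "\<forall>\<^sub>F n in sequentially. \<bar>(\<integral>x. h x \<partial>\<nu> n) - (\<integral>x. g x \<partial>\<nu> n)\<bar> \<le> e"
  proof eventually_elim
    case (elim n)
    moreover have "e / (2 * C) \<le> e / C" using e C by (simp add: field_simps)
    ultimately show ?case using close[OF \<nu>] by simp
  qed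
  have "e / (2 * C) \<le> e / C" using e C by (simp add: field_simps)
  then have "\<bar>(\<integral>x. h x \<partial>\<mu>) - (\<integral>x. g x \<partial>\<mu>)\<bar> \<le> e" using close[OF \<mu>] k by simp
  then show "\<exists>b l'. b \<longlonglongrightarrow> l' \<and> (\<forall>\<^sub>F n in sequentially. \<bar>(\<integral>x. h x \<partial>\<nu> n) - b n\<bar> \<le> e) \<and> \<bar>(\<integral>x. h x \<partial>\<mu>) - l'\<bar> \<le> e"
    using conv[OF g_cont g_bd] ev by blast
qed

text \<open>On each stratum where r is constant, h is locally constant.\<close>

lemma stratified_measurable:
  fixes r h :: "'x \<Rightarrow> nat"
  assumes st: "\<And>x. x \<in> \<Omega> \<Longrightarrow> \<exists>k. \<forall>y\<in>\<Omega>. E k x y \<longrightarrow> r x \<le> r y \<and> (r y = r x \<longrightarrow> h y = h x)"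
  shows "h \<in> measurable (borel_of T) (count_space UNIV)"
proof (rule measurable_count_space_eq2_countable[THEN iffD2, OF conjI, rotated])
  obtain \<kappa> where \<kappa>: "\<And>x y. x \<in> \<Omega> \<Longrightarrow> y \<in> \<Omega> \<Longrightarrow> E (\<kappa> x) x y \<Longrightarrow> r x \<le> r y \<and> (r y = r x \<longrightarrow> h y = h x)"
    using st by metis
  have op: "openin T {x \<in> \<Omega>. a \<le> r x}" for a
    unfolding openin_T
  proof (intro conjI ballI)
    fix x assume x: "x \<in> {x \<in> \<Omega>. a \<le> r x}"
    then have "y \<in> {x \<in> \<Omega>. a \<le> r x}" if "y \<in> \<Omega>" "E (\<kappa> x) x y" for y using \<kappa>[of x y] that by simp
    then show "\<exists>k. \<forall>y\<in>\<Omega>. E k x y \<longrightarrow> y \<in> {x \<in> \<Omega>. a \<le> r x}" by blast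
  qed blast
  \<comment> \<open>A union of open classes that, within the stratum r = a, is exactly the part
    where h = j.\<close>
  define W where "W a j = (\<Union>x\<in>{x \<in> \<Omega>. r x = a \<and> h x = j}. {y \<in> \<Omega>. E (\<kappa> x) x y})" for a j
  have W: "openin T (W a j)" for a j
    unfolding W_def by (intro openin_Union) (auto intro!: clp_openin clp_saturated dest: E_trans)
  have "{x \<in> \<Omega>. r x = a \<and> h x = j} = W a j \<inter> ({x \<in> \<Omega>. a \<le> r x} - {x \<in> \<Omega>. Suc a \<le> r x})" for a j
  proof (intro equalityI subsetI)
    fix x assume "x \<in> {x \<in> \<Omega>. r x = a \<and> h x = j}"
    then show "x \<in> W a j \<inter> ({x \<in> \<Omega>. a \<le> r x} - {x \<in> \<Omega>. Suc a \<le> r x})"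
      using E_refl unfolding W_def by auto
  next
    fix y assume y: "y \<in> W a j \<inter> ({x \<in> \<Omega>. a \<le> r x} - {x \<in> \<Omega>. Suc a \<le> r x})"
    then obtain x where "x \<in> \<Omega>" "r x = a" "h x = j" "E (\<kappa> x) x y" "y \<in> \<Omega>" unfolding W_def by blast
    moreover have "r y = a" using y by auto
    ultimately show "y \<in> {x \<in> \<Omega>. r x = a \<and> h x = j}" using \<kappa>[of x y] by simp
  qed
  then have "{x \<in> \<Omega>. r x = a \<and> h x = j} \<in> sets (borel_of T)" for a j
    by (simp only:) (intro sets.Int sets.Diff openin_sets_borel_of op W)
  then have "(\<Union>a. {x \<in> \<Omega>. r x = a \<and> h x = j}) \<in> sets (borel_of T)" for j by (intro sets.countable_UN) auto
  moreover have "h -` {j} \<inter> space (borel_of T) = (\<Union>a. {x \<in> \<Omega>. r x = a \<and> h x = j})" for j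
    by (auto simp: space_borel_of topspace_T)
  ultimately show "\<forall>a\<in>UNIV. h -` {a} \<inter> space (borel_of T) \<in> sets (borel_of T)" by simp
qed auto

lemma rk_measurable: "rk \<in> measurable (borel_of T) (count_space UNIV)"
  by (rule stratified_measurable[where r = "\<lambda>_. 0"]) (use E_rk in auto)

lemma locally_constant_open: "openin T {x \<in> \<Omega>. \<exists>k. \<forall>y\<in>\<Omega>. E k x y \<longrightarrow> h y = h x}"
  unfolding openin_T
proof (intro conjI ballI)
  fix x assume "x \<in> {x \<in> \<Omega>. \<exists>k. \<forall>y\<in>\<Omega>. E k x y \<longrightarrow> h y = h x}"
  then obtain k where k: "\<forall>y\<in>\<Omega>. E k x y \<longrightarrow> h y = h x" by blast
  have "y \<in> {x \<in> \<Omega>. \<exists>k. \<forall>y\<in>\<Omega>. E k x y \<longrightarrow> h y = h x}" if y: "y \<in> \<Omega>" "E k x y" for y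
  proof -
    have "h z = h y" if "z \<in> \<Omega>" "E k y z" for z using k y that E_trans by metis
    then show ?thesis using y by blast
  qed
  then show "\<exists>k. \<forall>y\<in>\<Omega>. E k x y \<longrightarrow> y \<in> {x \<in> \<Omega>. \<exists>k. \<forall>y\<in>\<Omega>. E k x y \<longrightarrow> h y = h x}" by blast
qed blast

text \<open>Truncation at rank D gives bounded functions, whose integrals converge; what is cut off
  is at most \<epsilon> D, uniformly in n. In the limit the truncations exhaust the integral by
  monotone convergence. Working in \<open>ennreal\<close> allows for a limit not yet known to be
  finite.\<close>

lemma moment_convergence:
  fixes h :: "'x \<Rightarrow> nat"
  assumes \<nu>: "\<And>n. law_on (\<nu> n)" and \<mu>: "law_on \<mu>"
    and conv: "\<And>g. continuous_map T euclideanreal g \<Longrightarrow> bounded (g ` \<Omega>) \<Longrightarrow>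
      (\<lambda>n. \<integral>x. g x \<partial>\<nu> n) \<longlonglongrightarrow> (\<integral>x. g x \<partial>\<mu>)"
    and h: "h \<in> measurable (borel_of T) (count_space UNIV)" "\<And>x. x \<in> \<Omega> \<Longrightarrow> h x \<le> rk x ^ m"
    and loc: "AE x in \<mu>. \<exists>k. \<forall>y\<in>\<Omega>. E k x y \<longrightarrow> h y = h x"
    and ui: "(\<lambda>D. SUP n. \<integral>\<^sup>+x. of_nat (rk x ^ m) * indicator (tail D) x \<partial>\<nu> n) \<longlonglongrightarrow> 0"
  shows "(\<lambda>n. \<integral>\<^sup>+x. of_nat (h x) \<partial>\<nu> n) \<longlonglongrightarrow> (\<integral>\<^sup>+x. of_nat (h x) \<partial>\<mu>)"
proof -
  define hD where "hD D x = (if rk x \<le> D then real (h x) else 0)" for D x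
  define \<epsilon> where "\<epsilon> D = (SUP n. \<integral>\<^sup>+x. of_nat (rk x ^ m) * indicator (tail D) x \<partial>\<nu> n)" for D
  have rk': "rk \<in> measurable (borel_of T) (count_space UNIV)" by (rule rk_measurable)
  have hD_meas: "hD D \<in> borel_measurable (borel_of T)" for D
    unfolding hD_def using h(1) rk' by measurable
  have hD_le: "\<bar>hD D x\<bar> \<le> real (D ^ m)" if "x \<in> \<Omega>" for D x
  proof (cases "rk x \<le> D")
    case True
    then have "h x \<le> D ^ m" using h(2)[OF that] power_mono[of "rk x" D m] by simp
    then show ?thesis using True by (simp add: hD_def del: of_nat_power)
  qed (simp add: hD_def)
  have hD: "bounded_meas (hD D)" for D
    unfolding bounded_meas_def using hD_meas hD_le by blast
  have conv_hD: "(\<lambda>n. \<integral>x. hD D x \<partial>\<nu> n) \<longlonglongrightarrow> (\<integral>x. hD D x \<partial>\<mu>)" for D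
  proof (rule continuous_mapping[OF \<nu> \<mu> conv hD])
    show "AE x in \<mu>. \<exists>k. \<forall>y\<in>\<Omega>. E k x y \<longrightarrow> hD D y = hD D x"
      using loc
    proof eventually_elim
      case (elim x)
      then obtain k where "\<forall>y\<in>\<Omega>. E k x y \<longrightarrow> h y = h x" by blast
      then show ?case using E_rk by (intro exI[of _ k]) (auto simp: hD_def)
    qed
  qed
  have nnD: "(\<integral>\<^sup>+x. ennreal (hD D x) \<partial>\<rho>) = ennreal (\<integral>x. hD D x \<partial>\<rho>)" if "law_on \<rho>" for D \<rho>
    by (rule nn_integral_eq_integral[OF bounded_meas_integrable[OF that hD]]) (simp add: hD_def)
  have lower: "ennreal (\<integral>x. hD D x \<partial>\<rho>) \<le> (\<integral>\<^sup>+x. of_nat (h x) \<partial>\<rho>)" if "law_on \<rho>" for D \<rho>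
    unfolding nnD[OF that, symmetric] by (intro nn_integral_mono) (simp add: hD_def ennreal_of_nat_eq_real_of_nat)
  have upper: "(\<integral>\<^sup>+x. of_nat (h x) \<partial>\<nu> n) \<le> ennreal (\<integral>x. hD D x \<partial>\<nu> n) + \<epsilon> D" for D n
  proof -
    have "(\<integral>\<^sup>+x. of_nat (h x) \<partial>\<nu> n) \<le> (\<integral>\<^sup>+x. ennreal (hD D x) + of_nat (rk x ^ m) * indicator (tail D) x \<partial>\<nu> n)"
    proof (rule nn_integral_mono)
      fix x assume "x \<in> space (\<nu> n)"
      then have x: "x \<in> \<Omega>" by (simp add: law_on_space[OF \<nu>])
      show "of_nat (h x) \<le> ennreal (hD D x) + of_nat (rk x ^ m) * indicator (tail D) x"
      proof (cases "rk x \<le> D")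
        case True
        then show ?thesis by (simp add: hD_def ennreal_of_nat_eq_real_of_nat tail_def)
      next
        case False
        then have "indicator (tail D) x = (1 :: ennreal)" using x by (simp add: tail_def)
        moreover have "(of_nat (h x) :: ennreal) \<le> of_nat (rk x ^ m)" using h(2)[OF x] by (simp only: of_nat_le_iff)
        ultimately show ?thesis using False by (simp add: hD_def)
      qed
    qed
    also have "\<dots> = (\<integral>\<^sup>+x. ennreal (hD D x) \<partial>\<nu> n) + (\<integral>\<^sup>+x. of_nat (rk x ^ m) * indicator (tail D) x \<partial>\<nu> n)"
    proof (rule nn_integral_add)
      have sets: "sets (\<nu> n) = sets (borel_of T)" using \<nu> by (simp add: law_on_def)
      note [measurable_cong] = sets
      have [measurable]: "hD D \<in> borel_measurable (\<nu> n)" using hD_meas by (simp add: law_on_measurable[OF \<nu>])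
      have "rk \<in> measurable (\<nu> n) (count_space UNIV)" using rk' sets by (metis measurable_cong_sets)
      then have rkm: "(\<lambda>x. of_nat (rk x ^ m) :: ennreal) \<in> borel_measurable (\<nu> n)"
        by (rule measurable_compose[where g = "\<lambda>k. of_nat (k ^ m)"]) simp
      have tl: "tail D \<in> sets (\<nu> n)" using law_on_sets[OF \<nu> clp_tail] .
      show "(\<lambda>x. ennreal (hD D x)) \<in> borel_measurable (\<nu> n)" by measurable
      show "(\<lambda>x. of_nat (rk x ^ m) * indicator (tail D) x :: ennreal) \<in> borel_measurable (\<nu> n)"
        by (rule borel_measurable_times_ennreal[OF rkm borel_measurable_indicator[OF tl]])
    qed
    also have "\<dots> \<le> ennreal (\<integral>x. hD D x \<partial>\<nu> n) + \<epsilon> D"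
      unfolding nnD[OF \<nu>] \<epsilon>_def by (intro add_left_mono SUP_upper) simp
    finally show ?thesis .
  qed
  define L where "L = (\<integral>\<^sup>+x. of_nat (h x) \<partial>\<mu>)"
  have L_SUP: "L = (SUP D. ennreal (\<integral>x. hD D x \<partial>\<mu>))"
  proof -
    have "incseq (\<lambda>D x. ennreal (hD D x))"
      by (auto simp: incseq_def le_fun_def hD_def)
    moreover have "(\<lambda>x. ennreal (hD D x)) \<in> borel_measurable \<mu>" for D
      using hD_meas by (simp add: law_on_measurable[OF \<mu>])
    ultimately have "(\<integral>\<^sup>+x. (SUP D. ennreal (hD D x)) \<partial>\<mu>) = (SUP D. \<integral>\<^sup>+x. ennreal (hD D x) \<partial>\<mu>)"
      by (rule nn_integral_monotone_convergence_SUP)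
    moreover have "(SUP D. ennreal (hD D x)) = of_nat (h x)" for x
    proof (rule antisym)
      show "(SUP D. ennreal (hD D x)) \<le> of_nat (h x)"
        by (rule SUP_least) (simp add: hD_def ennreal_of_nat_eq_real_of_nat)
      show "of_nat (h x) \<le> (SUP D. ennreal (hD D x))"
        by (rule SUP_upper2[of "rk x"]) (simp_all add: hD_def ennreal_of_nat_eq_real_of_nat)
    qed
    ultimately show ?thesis by (simp add: L_def nnD[OF \<mu>])
  qed
  show ?thesis unfolding L_def[symmetric]
  proof (rule order_tendstoI)
    fix y assume "y < L"
    then obtain D where "y < ennreal (\<integral>x. hD D x \<partial>\<mu>)" unfolding L_SUP less_SUP_iff by blast
    then have "\<forall>\<^sub>F n in sequentially. y < ennreal (\<integral>x. hD D x \<partial>\<nu> n)"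
      using order_tendstoD(1)[OF tendsto_ennrealI[OF conv_hD]] by blast
    then show "\<forall>\<^sub>F n in sequentially. y < (\<integral>\<^sup>+x. of_nat (h x) \<partial>\<nu> n)"
      by eventually_elim (use lower[OF \<nu>] in \<open>auto intro: less_le_trans\<close>)
  next
    fix y assume y: "L < y"
    have "(\<lambda>D. L + \<epsilon> D) \<longlonglongrightarrow> L + 0" using ui unfolding \<epsilon>_def[symmetric] by (intro tendsto_add tendsto_const)
    then have "\<forall>\<^sub>F D in sequentially. L + \<epsilon> D < y" using y by (intro order_tendstoD(2)) auto
    then obtain D where D: "L + \<epsilon> D < y" by (auto simp: eventually_sequentially)
    have "(\<lambda>n. ennreal (\<integral>x. hD D x \<partial>\<nu> n) + \<epsilon> D) \<longlonglongrightarrow> ennreal (\<integral>x. hD D x \<partial>\<mu>) + \<epsilon> D"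
      by (intro tendsto_add tendsto_const tendsto_ennrealI conv_hD)
    moreover have "ennreal (\<integral>x. hD D x \<partial>\<mu>) + \<epsilon> D < y"
      using D lower[OF \<mu>, of D] unfolding L_def by (meson add_right_mono order_le_less_trans)
    ultimately have "\<forall>\<^sub>F n in sequentially. ennreal (\<integral>x. hD D x \<partial>\<nu> n) + \<epsilon> D < y"
      by (rule order_tendstoD(2))
    then show "\<forall>\<^sub>F n in sequentially. (\<integral>\<^sup>+x. of_nat (h x) \<partial>\<nu> n) < y"
      by eventually_elim (use upper in \<open>auto intro: le_less_trans\<close>)
  qed
qed

end

section \<open>Multiplicative families of norms determine laws\<close>

locale norm_family = ranked_profinite \<Omega> rk E T
  for \<Omega> :: "'x set" and rk :: "'x \<Rightarrow> nat" and E :: "nat \<Rightarrow> 'x \<Rightarrow> 'x \<Rightarrow> bool" and T :: "'x topology" +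
  fixes I :: "'i set" and f :: "'i \<Rightarrow> 'x \<Rightarrow> real" and c :: real
  assumes c: "0 < c" "c < 1"
    and f_one: "\<exists>i\<in>I. \<forall>x\<in>\<Omega>. f i x = 1"
    and f_mult: "i \<in> I \<Longrightarrow> j \<in> I \<Longrightarrow> \<exists>l\<in>I. \<forall>x\<in>\<Omega>. f l x = f i x * f j x"
    and f_values: "i \<in> I \<Longrightarrow> x \<in> \<Omega> \<Longrightarrow> f i x = 0 \<or> (\<exists>k. f i x = c ^ k)"
    and f_cong: "i \<in> I \<Longrightarrow> x \<in> \<Omega> \<Longrightarrow> y \<in> \<Omega> \<Longrightarrow> E k x y \<Longrightarrow> \<bar>f i x - f i y\<bar> \<le> c ^ k"
    and f_separates: "x \<in> \<Omega> \<Longrightarrow> y \<in> \<Omega> \<Longrightarrow> x \<noteq> y \<Longrightarrow> \<exists>i\<in>I. f i x \<noteq> f i y"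
begin

lemma f_bounds: "i \<in> I \<Longrightarrow> x \<in> \<Omega> \<Longrightarrow> 0 \<le> f i x \<and> f i x \<le> 1"
  using f_values[of i x] power_le_one[of c] zero_le_power[of c] less_imp_le[OF c(1)] less_imp_le[OF c(2)] by auto

lemma f_continuous:
  assumes i: "i \<in> I"
  shows "continuous_map T euclideanreal (f i)"
  unfolding continuous_map_def topspace_T
proof (intro conjI allI impI)
  fix U :: "real set" assume U: "openin euclideanreal U"
  show "openin T {x \<in> \<Omega>. f i x \<in> U}" unfolding openin_T
  proof (intro conjI ballI)
    fix x assume x: "x \<in> {x \<in> \<Omega>. f i x \<in> U}"
    then obtain e where e: "e > 0" "ball (f i x) e \<subseteq> U" using U by (auto simp: open_openin[symmetric] open_contains_ball)
    obtain k where k: "c ^ k < e" using real_arch_pow_inv[OF e(1) c(2)] by blast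
    have "f i y \<in> U" if "y \<in> \<Omega>" "E k x y" for y
    proof -
      have "\<bar>f i x - f i y\<bar> < e" using f_cong[OF i _ that(1,2)] x k by fastforce
      then show ?thesis using e(2) by (auto simp: dist_real_def)
    qed
    then show "\<exists>k. \<forall>y\<in>\<Omega>. E k x y \<longrightarrow> y \<in> {x \<in> \<Omega>. f i x \<in> U}" by blast
  qed blast
qed simp

lemma f_bounded_meas: "i \<in> I \<Longrightarrow> bounded_meas (f i)"
  using f_bounds[of i] f_continuous[of i] by (intro bounded_meas_continuous) (auto simp: bounded_iff intro!: exI[of _ 1])

text \<open>Among 0 and the powers of c, the value c^k is at distance at least c^k - c^(k+1) from
  every other one, so a level l with c^l below this gap keeps the value.\<close>

lemma f_level_clp:
  assumes i: "i \<in> I"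
  shows "clp {x \<in> \<Omega>. f i x = c ^ k}"
proof -
  define d where "d = c ^ k - c ^ Suc k"
  have d: "d > 0" using c by (simp add: d_def)
  obtain l where l: "c ^ l < d" using real_arch_pow_inv[OF d c(2)] by blast
  show ?thesis
  proof (rule clp_saturated[of _ l])
    fix x y assume x: "x \<in> {x \<in> \<Omega>. f i x = c ^ k}" and y: "y \<in> \<Omega>" "E l x y"
    have less: "\<bar>c ^ k - f i y\<bar> < d" using f_cong[OF i _ y] x l by fastforce
    have far: "d \<le> c ^ m - c ^ n" if "n > m" "m \<le> k" for m n
    proof -
      have "c ^ n \<le> c ^ Suc m" using c that by (intro power_decreasing) auto
      then have "c ^ m - c ^ n \<ge> c ^ m * (1 - c)" by (simp add: algebra_simps)
      moreover have "c ^ k * (1 - c) \<le> c ^ m * (1 - c)" using c that by (intro mult_right_mono power_decreasing) auto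
      ultimately show ?thesis by (simp add: d_def algebra_simps)
    qed
    have "f i y \<noteq> 0"
    proof
      assume "f i y = 0"
      then have "c ^ k < d" using less c by simp
      then show False using zero_less_power[OF c(1), of "Suc k"] unfolding d_def by linarith
    qed
    then obtain m where m: "f i y = c ^ m" using f_values[OF i y(1)] by blast
    have "m = k" using less far[of k m] far[of m k] unfolding m by (cases m k rule: linorder_cases) auto
    then show "y \<in> {x \<in> \<Omega>. f i x = c ^ k}" using y m by simp
  qed blast
qed

end

text \<open>The functions h for which all integrals of h f_i converge form a module over the algebra M of
  multipliers below, which contains the f_i and is closed under uniform limits.\<close>

locale norm_convergence = norm_family \<Omega> rk E T I f c
  for \<Omega> :: "'x set" and rk :: "'x \<Rightarrow> nat" and E :: "nat \<Rightarrow> 'x \<Rightarrow> 'x \<Rightarrow> bool" and T :: "'x topology"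
    and I :: "'i set" and f :: "'i \<Rightarrow> 'x \<Rightarrow> real" and c :: real +
  fixes \<nu> :: "nat \<Rightarrow> 'x measure"
  assumes law: "law_on (\<nu> n)" and tight: "tight \<nu>"
    and conv_f: "i \<in> I \<Longrightarrow> convergent (\<lambda>n. \<integral>x. f i x \<partial>\<nu> n)"
begin

definition H :: "('x \<Rightarrow> real) \<Rightarrow> bool"
  where "H h \<longleftrightarrow> bounded_meas h \<and> (\<forall>i\<in>I. convergent (\<lambda>n. \<integral>x. h x * f i x \<partial>\<nu> n))"

text \<open>Functions with convergent integrals need not be closed under products. Multipliers of
  \<open>H\<close> are, by composition, and this makes them an algebra.\<close>

definition M :: "('x \<Rightarrow> real) \<Rightarrow> bool"
  where "M g \<longleftrightarrow> bounded_meas g \<and> (\<forall>h. H h \<longrightarrow> H (\<lambda>x. g x * h x))"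

lemma integral_cong_space: "(\<And>x. x \<in> \<Omega> \<Longrightarrow> g x = h x) \<Longrightarrow> (\<integral>x. g x \<partial>\<nu> n) = (\<integral>x. h x \<partial>\<nu> n)"
  using law_on_space[OF law] by (intro Bochner_Integration.integral_cong) auto

lemma H_one: "H (\<lambda>_. 1)"
  using conv_f by (simp add: H_def bounded_meas_const)

lemma H_scale: "H h \<Longrightarrow> H (\<lambda>x. a * h x)"
  unfolding H_def by (auto intro!: bounded_meas_mult bounded_meas_const convergent_mult simp: mult.assoc convergent_const)

lemma H_add: "H g \<Longrightarrow> H h \<Longrightarrow> H (\<lambda>x. g x + h x)"
proof -
  assume g: "H g" and h: "H h"
  have "convergent (\<lambda>n. \<integral>x. (g x + h x) * f i x \<partial>\<nu> n)" if i: "i \<in> I" for i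
  proof -
    have "(\<integral>x. (g x + h x) * f i x \<partial>\<nu> n) = (\<integral>x. g x * f i x \<partial>\<nu> n) + (\<integral>x. h x * f i x \<partial>\<nu> n)" for n
      using g h bounded_meas_integrable[OF law bounded_meas_mult[OF _ f_bounded_meas[OF i]]]
      by (simp add: distrib_right H_def)
    then show ?thesis using g h i by (simp add: H_def convergent_add)
  qed
  then show ?thesis using g h by (simp add: H_def bounded_meas_add)
qed

lemma M_bounded_meas: "M g \<Longrightarrow> bounded_meas g" by (simp add: M_def)

lemma M_const: "M (\<lambda>_. a)"
  using H_scale by (simp add: M_def bounded_meas_const)

lemma M_add: "M g \<Longrightarrow> M h \<Longrightarrow> M (\<lambda>x. g x + h x)"
  unfolding M_def using bounded_meas_add H_add by (simp add: distrib_right)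

lemma M_mult: "M g \<Longrightarrow> M h \<Longrightarrow> M (\<lambda>x. g x * h x)"
  unfolding M_def using bounded_meas_mult by (simp add: mult.assoc)

lemma M_diff: "M g \<Longrightarrow> M h \<Longrightarrow> M (\<lambda>x. g x - h x)"
  using M_add[of g "\<lambda>x. - 1 * h x"] M_mult[OF M_const, of h "- 1"] by simp

lemma M_power: "M g \<Longrightarrow> M (\<lambda>x. g x ^ n)"
  by (induction n) (simp_all add: M_const M_mult)

text \<open>Here multiplicativity enters: multiplying by f j turns the test function f i into
  another member of the family.\<close>

lemma M_f: "j \<in> I \<Longrightarrow> M (f j)"
proof -
  assume j: "j \<in> I"
  have "convergent (\<lambda>n. \<integral>x. f j x * h x * f i x \<partial>\<nu> n)" if h: "H h" and i: "i \<in> I" for h i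
  proof -
    obtain l where l: "l \<in> I" "\<forall>x\<in>\<Omega>. f l x = f j x * f i x" using f_mult[OF j i] by blast
    have "(\<integral>x. f j x * h x * f i x \<partial>\<nu> n) = (\<integral>x. h x * f l x \<partial>\<nu> n)" for n
      using l(2) by (intro integral_cong_space) (simp add: mult_ac)
    then show ?thesis using h l(1) by (simp add: H_def)
  qed
  then show ?thesis using f_bounded_meas[OF j] by (auto simp: M_def H_def bounded_meas_mult)
qed

lemma M_uniform_limit:
  assumes g: "bounded_meas g" and lim: "\<And>e. e > 0 \<Longrightarrow> \<exists>g'. M g' \<and> (\<forall>x\<in>\<Omega>. \<bar>g x - g' x\<bar> \<le> e)"
  shows "M g"
proof -
  have "convergent (\<lambda>n. \<integral>x. g x * h x * f i x \<partial>\<nu> n)" if h: "H h" and i: "i \<in> I" for h i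
  proof (rule convergent_approx)
    fix e :: real assume e: "e > 0"
    have hb: "bounded_meas h" using h by (simp add: H_def)
    then obtain C0 where C0: "\<forall>x\<in>\<Omega>. \<bar>h x\<bar> \<le> C0" by (auto simp: bounded_meas_def)
    define C where "C = max C0 1"
    have C: "C > 0" "\<And>x. x \<in> \<Omega> \<Longrightarrow> \<bar>h x\<bar> \<le> C" using C0 by (auto simp: C_def)
    have "e / C > 0" using e C by simp
    then obtain g' where g': "M g'" "\<forall>x\<in>\<Omega>. \<bar>g x - g' x\<bar> \<le> e / C" using lim by blast
    have bm: "bounded_meas (\<lambda>x. g x * h x * f i x)" "bounded_meas (\<lambda>x. g' x * h x * f i x)"
      using g hb M_bounded_meas[OF g'(1)] f_bounded_meas[OF i] by (intro bounded_meas_mult; simp)+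
    have "\<bar>(\<integral>x. g x * h x * f i x \<partial>\<nu> n) - (\<integral>x. g' x * h x * f i x \<partial>\<nu> n)\<bar> \<le> e" for n
    proof -
      have "(\<integral>x. g x * h x * f i x \<partial>\<nu> n) - (\<integral>x. g' x * h x * f i x \<partial>\<nu> n)
        = (\<integral>x. g x * h x * f i x - g' x * h x * f i x \<partial>\<nu> n)"
        using bounded_meas_integrable[OF law bm(1)] bounded_meas_integrable[OF law bm(2)] by simp
      moreover have "\<bar>\<integral>x. g x * h x * f i x - g' x * h x * f i x \<partial>\<nu> n\<bar> \<le> e"
      proof (rule integral_abs_le[OF law bounded_meas_diff[OF bm]])
        fix x assume x: "x \<in> \<Omega>"
        have "\<bar>g x * h x * f i x - g' x * h x * f i x\<bar> = \<bar>g x - g' x\<bar> * \<bar>h x\<bar> * \<bar>f i x\<bar>"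
          by (simp add: abs_mult[symmetric] algebra_simps)
        also have "\<dots> \<le> (e / C) * C * 1"
          using g'(2) C x f_bounds[OF i x] e by (intro mult_mono) auto
        finally show "\<bar>g x * h x * f i x - g' x * h x * f i x\<bar> \<le> e" using C by simp
      qed
      ultimately show ?thesis by simp
    qed
    moreover have "convergent (\<lambda>n. \<integral>x. g' x * h x * f i x \<partial>\<nu> n)"
      using g'(1) h i by (simp add: M_def H_def)
    ultimately show "\<exists>b. convergent b \<and> (\<forall>n. \<bar>(\<integral>x. g x * h x * f i x \<partial>\<nu> n) - b n\<bar> \<le> e)" by blast
  qed
  then show ?thesis using g by (auto simp: M_def H_def bounded_meas_mult)
qed

lemma M_cong:
  assumes "M g" "bounded_meas h" "\<And>x. x \<in> \<Omega> \<Longrightarrow> g x = h x"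
  shows "M h"
  by (rule M_uniform_limit[OF assms(2)]) (use assms in \<open>auto intro!: exI[of _ g]\<close>)

text \<open>If L k is the set where f i is at most c^k, then the powers of (f i / c^k) restricted to L k
  tend uniformly to the indicator of the set where f i equals c^k.\<close>

lemma M_indicator_level:
  assumes i: "i \<in> I"
  shows "M (indicator {x \<in> \<Omega>. f i x = c ^ k})"
proof -
  define V where "V k = {x \<in> \<Omega>. f i x = c ^ k}" for k
  define L where "L k = {x \<in> \<Omega>. f i x \<le> c ^ k}" for k
  have step: "M (indicator (V k)) \<and> clp (L (Suc k)) \<and> M (indicator (L (Suc k)))"
    if L: "clp (L k)" "M (indicator (L k))" for k
  proof -
    have Vclp: "clp (V k)" unfolding V_def by (rule f_level_clp[OF i])
    \<comment> \<open>As the values are discrete, \<open>L k\<close> splits into the level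
      \<open>V k\<close> and the next set \<open>L (Suc k)\<close>; the induction peels off one
      level at a time.\<close>
    have lower: "f i x \<le> c ^ Suc k \<or> f i x = c ^ k" if x: "x \<in> L k" for x
    proof (cases "f i x = 0")
      case True
      then show ?thesis using c by simp
    next
      case False
      then obtain m where m: "f i x = c ^ m" using x f_values[OF i, of x] by (auto simp: L_def)
      then have "c ^ m \<le> c ^ k" using x by (simp add: L_def)
      then have "k \<le> m" using c by (simp add: power_decreasing_iff)
      then show ?thesis using m c by (cases "k = m") (auto intro!: disjI1 power_decreasing simp del: power_Suc)
    qed
    have MV: "M (indicator (V k))"
    proof (rule M_uniform_limit[OF bounded_meas_indicator[OF Vclp]])
      fix e :: real assume e: "e > 0"
      obtain j0 where j0: "c ^ j0 < e" using real_arch_pow_inv[OF e c(2)] by blast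
      \<comment> \<open>A positive exponent, so that the power of 0 off \<open>L k\<close> is
        0.\<close>
      define j where "j = Suc j0"
      have "c ^ j \<le> c ^ j0" using c by (intro power_decreasing) (auto simp: j_def)
      then have j: "c ^ j < e" using j0 by simp
      define g where "g x = (inverse (c ^ k) * f i x * indicator (L k) x) ^ j" for x
      have "M g" unfolding g_def by (intro M_power M_mult M_const M_f[OF i] L(2))
      moreover have "\<bar>indicator (V k) x - g x\<bar> \<le> e" if x: "x \<in> \<Omega>" for x
      proof (cases "x \<in> L k")
        case False
        then have "x \<notin> V k" by (auto simp: V_def L_def)
        then show ?thesis using False e by (simp add: g_def j_def)
      next
        case True
        show ?thesis
        proof (cases "f i x = c ^ k")
          case True
          then have "g x = 1" "x \<in> V k" using \<open>x \<in> L k\<close> x c by (simp_all add: g_def V_def)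
          then show ?thesis using e by simp
        next
          case False
          then have le: "f i x \<le> c ^ Suc k" using lower[OF True] by blast
          have pos: "0 \<le> inverse (c ^ k) * f i x" using f_bounds[OF i x] c by simp
          have "inverse (c ^ k) * f i x \<le> inverse (c ^ k) * c ^ Suc k"
            using le c by (intro mult_left_mono) auto
          moreover have "inverse (c ^ k) * c ^ Suc k = c" using c by simp
          ultimately have "inverse (c ^ k) * f i x \<le> c" by metis
          then have "0 \<le> g x" "g x \<le> c ^ j" unfolding g_def using True pos by (simp_all add: power_mono)
          moreover have "x \<notin> V k" using False by (simp add: V_def)
          ultimately show ?thesis using j by simp
        qed
      qed
      ultimately show "\<exists>g'. M g' \<and> (\<forall>x\<in>\<Omega>. \<bar>indicator (V k) x - g' x\<bar> \<le> e)" by blast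
    qed
    have eq: "L (Suc k) = L k \<inter> (\<Omega> - V k)"
    proof -
      have "c ^ Suc k < c ^ k" using c by simp
      then show ?thesis using lower by (fastforce simp: L_def V_def simp del: power_Suc)
    qed
    have Lclp: "clp (L (Suc k))" unfolding eq by (intro clp_Int clp_compl L(1) Vclp)
    moreover have "M (indicator (L (Suc k)))"
    proof (rule M_cong[OF M_diff[OF L(2) MV] bounded_meas_indicator[OF Lclp]])
      have "V k \<subseteq> L k" by (auto simp: V_def L_def)
      then show "indicator (L k) x - indicator (V k) x = (indicator (L (Suc k)) x :: real)" if "x \<in> \<Omega>" for x
        using that unfolding eq by (auto simp: indicator_def)
    qed
    ultimately show ?thesis using MV by blast
  qed
  have L0: "L 0 = \<Omega>" using f_bounds[OF i] by (auto simp: L_def)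
  have "clp (L k) \<and> M (indicator (L k))" for k
  proof (induction k)
    case 0
    have "M (indicator \<Omega>)"
      by (rule M_cong[OF M_const bounded_meas_indicator[OF clp_space]]) (auto simp: indicator_def)
    then show ?case using L0 clp_space by simp
  qed (use step in blast)
  then show ?thesis using step unfolding V_def by blast
qed

section \<open>Sets whose indicators are multipliers\<close>

definition MA :: "'x set \<Rightarrow> bool"
  where "MA A \<longleftrightarrow> clp A \<and> M (indicator A)"

lemma MA_compl: "MA A \<Longrightarrow> MA (\<Omega> - A)"
proof -
  assume A: "MA A"
  then have c: "clp (\<Omega> - A)" by (simp add: MA_def clp_compl)
  have "M (indicator (\<Omega> - A))"
    by (rule M_cong[OF M_diff[OF M_const, of "indicator A" 1] bounded_meas_indicator[OF c]])
      (use A in \<open>auto simp: MA_def indicator_def\<close>)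
  then show ?thesis using c by (simp add: MA_def)
qed

lemma MA_Int: "MA A \<Longrightarrow> MA B \<Longrightarrow> MA (A \<inter> B)"
proof -
  assume "MA A" "MA B"
  moreover have "(\<lambda>x. indicator A x * indicator B x) = (indicator (A \<inter> B) :: 'x \<Rightarrow> real)"
    by (auto simp: indicator_def)
  ultimately show ?thesis unfolding MA_def using M_mult[of "indicator A" "indicator B"] clp_Int by simp
qed

lemma MA_space: "MA \<Omega>"
  unfolding MA_def using M_cong[OF M_const bounded_meas_indicator[OF clp_space], of 1] clp_space by simp

lemma MA_INT: "finite Q \<Longrightarrow> (\<And>q. q \<in> Q \<Longrightarrow> MA (A q)) \<Longrightarrow> MA (\<Omega> \<inter> (\<Inter>q\<in>Q. A q))"
proof (induction Q rule: finite_induct)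
  case (insert q Q)
  then have "MA (A q)" "MA (\<Omega> \<inter> (\<Inter>q\<in>Q. A q))" by simp_all
  then have "MA (A q \<inter> (\<Omega> \<inter> (\<Inter>q\<in>Q. A q)))" by (rule MA_Int)
  then show ?case by (simp add: Int_left_commute)
qed (simp add: MA_space)

text \<open>The zero set of f i is not among the level sets at hand. A point where f i vanishes is
  separated by the complement of the level set through the other point.\<close>

lemma MA_separates:
  assumes "x \<in> \<Omega>" "y \<in> \<Omega>" "x \<noteq> y"
  obtains B where "MA B" "x \<in> B" "y \<notin> B"
proof -
  obtain i where i: "i \<in> I" "f i x \<noteq> f i y" using f_separates assms by blast
  have level: "MA {z \<in> \<Omega>. f i z = c ^ k}" for k
    unfolding MA_def using f_level_clp M_indicator_level i(1) by blast
  show thesis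
  proof (cases "f i x = 0")
    case False
    then obtain k where k: "f i x = c ^ k" using f_values i assms by blast
    then show thesis using that[OF level[of k]] assms i(2) by simp
  next
    case True
    then obtain k where k: "f i y = c ^ k" using f_values[OF i(1) assms(2)] i(2) by auto
    then show thesis using that[OF MA_compl[OF level[of k]]] assms i(2) by simp
  qed
qed

text \<open>Compactness is used twice, as in the theorem of Stone and Weierstrass. For y outside A,
  finitely many separating sets unite to one that contains A up to rank D and misses y; then
  finitely many of these unions intersect in A up to rank D.\<close>

lemma clp_eq_MA_on_rank:
  assumes A: "clp A"
  obtains A' where "MA A'" "\<And>x. x \<in> \<Omega> \<Longrightarrow> rk x \<le> D \<Longrightarrow> x \<in> A' \<longleftrightarrow> x \<in> A"
proof -
  have one: "\<exists>B. MA B \<and> y \<notin> B \<and> (\<forall>x\<in>A. rk x \<le> D \<longrightarrow> x \<in> B)" if y: "y \<in> \<Omega> - A" for y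
  proof -
    have "\<exists>B. x \<in> A \<longrightarrow> MA B \<and> x \<in> B \<and> y \<notin> B" for x
      using MA_separates[of x y] y clp_subset[OF A] by (metis DiffD1 DiffD2 subsetD)
    then obtain B where B: "\<And>x. x \<in> A \<Longrightarrow> MA (B x) \<and> x \<in> B x \<and> y \<notin> B x" by metis
    \<comment> \<open>The cover must reach all points up to rank D, so a point outside A receives a
      neighbourhood that misses A and contributes nothing to W.\<close>
    have "\<exists>k. \<forall>z\<in>\<Omega>. E k x z \<longrightarrow> (if x \<in> A then z \<in> B x else z \<notin> A)" if x: "x \<in> \<Omega>" for x
    proof (cases "x \<in> A")
      case True
      then show ?thesis using clp_ball[of "B x" x] B[OF True] by (simp add: MA_def)
    next
      case False
      then show ?thesis using clp_ball[OF clp_compl[OF A], of x] x by auto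
    qed
    then obtain \<kappa> where \<kappa>: "\<And>x z. x \<in> \<Omega> \<Longrightarrow> z \<in> \<Omega> \<Longrightarrow> E (\<kappa> x) x z \<Longrightarrow> (if x \<in> A then z \<in> B x else z \<notin> A)"
      by metis
    obtain Q where Q: "finite Q" "Q \<subseteq> \<Omega>" "\<And>x. x \<in> \<Omega> \<Longrightarrow> rk x \<le> D \<Longrightarrow> \<exists>q\<in>Q. E (\<kappa> q) q x"
      by (rule finite_subcover[where D = D and \<kappa> = \<kappa>]) blast
    \<comment> \<open>The union of the sets B q with q in A, written through complements because
      \<open>MA_INT\<close> treats intersections.\<close>
    define W where "W = \<Omega> - (\<Omega> \<inter> (\<Inter>q\<in>Q \<inter> A. \<Omega> - B q))"
    have "MA W" unfolding W_def using Q(1) B by (intro MA_compl MA_INT) auto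
    moreover have "y \<notin> W" using B y by (auto simp: W_def)
    moreover have "x \<in> W" if x: "x \<in> A" "rk x \<le> D" for x
    proof -
      have x\<Omega>: "x \<in> \<Omega>" using x clp_subset[OF A] by blast
      then obtain q where q: "q \<in> Q" "E (\<kappa> q) q x" using Q(3) x by blast
      then have "q \<in> A \<and> x \<in> B q" using \<kappa>[of q x] Q(2) x\<Omega> x(1) by (auto split: if_splits)
      then show ?thesis using q x\<Omega> by (auto simp: W_def)
    qed
    ultimately show ?thesis by blast
  qed
  have "\<exists>B. y \<in> \<Omega> - A \<longrightarrow> MA B \<and> y \<notin> B \<and> (\<forall>x\<in>A. rk x \<le> D \<longrightarrow> x \<in> B)" for y using one[of y] by blast
  then obtain B where B: "\<And>y. y \<in> \<Omega> - A \<Longrightarrow> MA (B y) \<and> y \<notin> B y \<and> (\<forall>x\<in>A. rk x \<le> D \<longrightarrow> x \<in> B y)"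
    by metis
  have "\<exists>k. \<forall>z\<in>\<Omega>. E k y z \<longrightarrow> (if y \<in> A then z \<in> A else z \<notin> B y)" if y: "y \<in> \<Omega>" for y
  proof (cases "y \<in> A")
    case True
    then show ?thesis using clp_ball[OF A] by simp
  next
    case False
    then have "clp (B y)" "y \<notin> B y" using B y by (auto simp: MA_def)
    then show ?thesis using clp_ball[OF clp_compl, of "B y" y] False y by auto
  qed
  then obtain \<kappa> where \<kappa>: "\<And>y z. y \<in> \<Omega> \<Longrightarrow> z \<in> \<Omega> \<Longrightarrow> E (\<kappa> y) y z \<Longrightarrow> (if y \<in> A then z \<in> A else z \<notin> B y)"
    by metis
  obtain Q where Q: "finite Q" "Q \<subseteq> \<Omega>" "\<And>x. x \<in> \<Omega> \<Longrightarrow> rk x \<le> D \<Longrightarrow> \<exists>q\<in>Q. E (\<kappa> q) q x"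
    by (rule finite_subcover[where D = D and \<kappa> = \<kappa>]) blast
  define A' where "A' = \<Omega> \<inter> (\<Inter>q\<in>Q - A. B q)"
  show thesis
  proof (rule that)
    show "MA A'" unfolding A'_def using Q B by (intro MA_INT) auto
    fix x assume x: "x \<in> \<Omega>" "rk x \<le> D"
    show "x \<in> A' \<longleftrightarrow> x \<in> A"
    proof
      assume "x \<in> A"
      then show "x \<in> A'" using B Q(2) x by (auto simp: A'_def)
    next
      assume x': "x \<in> A'"
      obtain q where q: "q \<in> Q" "E (\<kappa> q) q x" using Q(3) x by blast
      then have "if q \<in> A then x \<in> A else x \<notin> B q" using \<kappa> Q(2) x by blast
      then show "x \<in> A" using x' q by (auto simp: A'_def split: if_splits)
    qed
  qed
qed

text \<open>Tightness makes the replacement of A by A', correct only up to rank D, an error uniform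
  in n.\<close>

theorem convergent_measure_clp:
  assumes A: "clp A"
  shows "convergent (\<lambda>n. measure (\<nu> n) A)"
proof (rule convergent_approx)
  fix e :: real assume "e > 0"
  then obtain D where D: "\<And>n. measure (\<nu> n) (tail D) \<le> e" using tight unfolding tight_def by blast
  obtain A' where A': "MA A'" "\<And>x. x \<in> \<Omega> \<Longrightarrow> rk x \<le> D \<Longrightarrow> x \<in> A' \<longleftrightarrow> x \<in> A"
    using clp_eq_MA_on_rank[OF A] by blast
  have A'c: "clp A'" using A'(1) by (simp add: MA_def)
  obtain i where i: "i \<in> I" "\<forall>x\<in>\<Omega>. f i x = 1" using f_one by blast
  have "H (indicator A')" using A'(1) H_one unfolding MA_def M_def by fastforce
  then have "convergent (\<lambda>n. \<integral>x. indicator A' x * f i x \<partial>\<nu> n)" using i(1) by (simp add: H_def)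
  moreover have "(\<integral>x. indicator A' x * f i x \<partial>\<nu> n) = measure (\<nu> n) A'" for n
    using integral_cong_space[of "\<lambda>x. indicator A' x * f i x" "indicator A'" n] i(2) integral_indicator_law_on[OF law A'c]
    by simp
  ultimately have "convergent (\<lambda>n. measure (\<nu> n) A')" by simp
  moreover have "\<bar>measure (\<nu> n) A - measure (\<nu> n) A'\<bar> \<le> e" for n
  proof -
    interpret prob_space "\<nu> n" using law by (simp add: law_on_def)
    have sets: "A \<in> sets (\<nu> n)" "A' \<in> sets (\<nu> n)" "tail D \<in> sets (\<nu> n)"
      using law_on_sets[OF law] A A'c clp_tail by blast+
    have "A \<subseteq> A' \<union> tail D" "A' \<subseteq> A \<union> tail D"
      using A'(2) clp_subset[OF A] clp_subset[OF A'c] by (fastforce simp: tail_def not_less)+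
    then have "measure (\<nu> n) A \<le> measure (\<nu> n) A' + measure (\<nu> n) (tail D)"
      "measure (\<nu> n) A' \<le> measure (\<nu> n) A + measure (\<nu> n) (tail D)"
      using sets finite_measure_mono measure_Un_le by (meson order_trans sets.Un)+
    then show ?thesis using D[of n] by linarith
  qed
  ultimately show "\<exists>b. convergent b \<and> (\<forall>n. \<bar>measure (\<nu> n) A - b n\<bar> \<le> e)" by blast
qed

end

context norm_family
begin

text \<open>Uniqueness follows from convergence: the sequence \<mu>1, \<mu>2, \<mu>1, ... satisfies
  all hypotheses, and the measures of a set along it can converge only if the two values
  agree.\<close>

lemma law_eqI:
  assumes law: "law_on \<mu>1" "law_on \<mu>2" and eq: "\<And>i. i \<in> I \<Longrightarrow> (\<integral>x. f i x \<partial>\<mu>1) = (\<integral>x. f i x \<partial>\<mu>2)"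
  shows "\<mu>1 = \<mu>2"
proof (rule measure_eqI_clp[OF law])
  define \<nu> where "\<nu> n = (if even n then \<mu>1 else \<mu>2)" for n :: nat
  have single: "\<exists>D. \<forall>D'\<ge>D. measure \<mu> (tail D') \<le> e" if \<mu>: "law_on \<mu>" and e: "e > 0" for \<mu> and e :: real
  proof -
    interpret prob_space \<mu> using \<mu> by (simp add: law_on_def)
    have "(\<lambda>D. measure \<mu> (tail D)) \<longlonglongrightarrow> measure \<mu> (\<Inter>D. tail D)"
      using law_on_sets[OF \<mu> clp_tail] by (intro finite_Lim_measure_decseq) (auto simp: decseq_def tail_def)
    moreover have "(\<Inter>D. tail D) = {}" by (auto simp: tail_def)
    ultimately have "\<forall>\<^sub>F D in sequentially. measure \<mu> (tail D) < e" using e by (intro order_tendstoD) auto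
    then show ?thesis unfolding eventually_sequentially using less_imp_le by blast
  qed
  have "tight \<nu>" unfolding tight_def
  proof (intro allI impI)
    fix e :: real assume e: "e > 0"
    obtain D1 where D1: "\<forall>D'\<ge>D1. measure \<mu>1 (tail D') \<le> e" using single[OF law(1) e] by blast
    obtain D2 where D2: "\<forall>D'\<ge>D2. measure \<mu>2 (tail D') \<le> e" using single[OF law(2) e] by blast
    show "\<exists>D. \<forall>n. measure (\<nu> n) (tail D) \<le> e"
      by (intro exI[of _ "max D1 D2"]) (simp add: \<nu>_def D1 D2)
  qed
  moreover have "convergent (\<lambda>n. \<integral>x. f i x \<partial>\<nu> n)" if "i \<in> I" for i
  proof -
    have "(\<lambda>n. \<integral>x. f i x \<partial>\<nu> n) = (\<lambda>n. \<integral>x. f i x \<partial>\<mu>1)" using eq[OF that] by (auto simp: \<nu>_def)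
    then show ?thesis by (simp add: convergent_const)
  qed
  ultimately interpret norm_convergence \<Omega> rk E T I f c \<nu>
    by unfold_locales (auto simp: \<nu>_def law)
  fix A assume "clp A"
  then have "convergent (\<lambda>n. measure (\<nu> n) A)" by (rule convergent_measure_clp)
  then obtain l where l: "(\<lambda>n. measure (\<nu> n) A) \<longlonglongrightarrow> l" by (auto simp: convergent_def)
  have "(\<lambda>n. measure (\<nu> (2 * n)) A) \<longlonglongrightarrow> l" "(\<lambda>n. measure (\<nu> (Suc (2 * n))) A) \<longlonglongrightarrow> l"
    using LIMSEQ_subseq_LIMSEQ[OF l, of "\<lambda>n. 2 * n"] LIMSEQ_subseq_LIMSEQ[OF l, of "\<lambda>n. Suc (2 * n)"]
    by (auto simp: strict_mono_def o_def)
  then have "l = measure \<mu>1 A" "l = measure \<mu>2 A"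
    by (auto simp: \<nu>_def LIMSEQ_const_iff)
  then show "measure \<mu>1 A = measure \<mu>2 A" by simp
qed

end

section \<open>The space of polynomials as a ranked profinite space\<close>

definition poly_cong :: "nat \<Rightarrow> 'p::prime_card padic_int poly \<Rightarrow> 'p padic_int poly \<Rightarrow> bool"
  where "poly_cong k P P' \<longleftrightarrow> degree P = degree P' \<and> [:padic_p ^ k:] dvd P - P'"

lemma poly_cong_sym: "poly_cong k P P' \<Longrightarrow> poly_cong k P' P"
  unfolding poly_cong_def by (metis dvd_minus_iff minus_diff_eq)

lemma poly_cong_trans: "poly_cong k P Q \<Longrightarrow> poly_cong k Q R \<Longrightarrow> poly_cong k P R"
  unfolding poly_cong_def using dvd_add[of "[:padic_p ^ k:]" "P - Q" "Q - R"] by simp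

lemma poly_cong_Suc: "poly_cong (Suc k) P Q \<Longrightarrow> poly_cong k P Q"
  unfolding poly_cong_def const_poly_dvd_iff by (metis dvd_mult_right power_Suc)

lemma poly_cong_digits:
  fixes P Q :: "'p::prime_card padic_int poly"
  shows "poly_cong k P Q \<longleftrightarrow> degree P = degree Q \<and>
    (\<forall>i\<le>degree P. Rep_padic_int (coeff P i) k = Rep_padic_int (coeff Q i) k)"
proof -
  have "padic_p ^ k dvd coeff P i - coeff Q i" if "degree P = degree Q" "i > degree P" for i
    using that by (simp add: coeff_eq_0)
  then show ?thesis
    unfolding poly_cong_def const_poly_dvd_iff coeff_diff p_power_dvd_diff_iff[symmetric] by (meson not_less)
qed

lemma openin_padic_int_ball: "openin padic_int_topology {y :: 'p::prime_card padic_int. padic_p ^ k dvd y - a}"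
  unfolding openin_padic_int_topology
proof (intro ballI exI[of _ k] subsetI)
  fix x y :: "'p padic_int" assume "x \<in> {y. padic_p ^ k dvd y - a}" "y \<in> {y. padic_p ^ k dvd y - x}"
  then have "padic_p ^ k dvd (y - x) + (x - a)" by (intro dvd_add) auto
  then show "y \<in> {y. padic_p ^ k dvd y - a}" by simp
qed

context poly_family
begin

text \<open>The coefficientwise product topology is the one given by congruences modulo p^k: there
  are finitely many coefficients, so one k serves all of them.\<close>

lemma openin_degree_component:
  assumes W: "W \<subseteq> {P \<in> PS. degree P = d}"
  shows "openin (degree_component F S d) W \<longleftrightarrow> (\<forall>P\<in>W. \<exists>k. \<forall>P'\<in>PS. poly_cong k P P' \<longrightarrow> P' \<in> W)"
proof -
  define A where "A = {P \<in> PS. degree P = d}"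
  define r where "r P = restrict (coeff P) {..<d}" for P :: "'p padic_int poly"
  define TP where "TP = product_topology (\<lambda>_::nat. padic_int_topology :: 'p padic_int topology) {..<d}"
  have comp: "openin (degree_component F S d) W \<longleftrightarrow> (\<exists>U. openin TP U \<and> W = r -` U \<inter> A)" for W
    unfolding degree_component_def A_def r_def TP_def by (simp add: openin_pullback_topology)
  show ?thesis
  proof
    assume "openin (degree_component F S d) W"
    then obtain U where U: "openin TP U" "W = r -` U \<inter> A" using comp by blast
    show "\<forall>P\<in>W. \<exists>k. \<forall>P'\<in>PS. poly_cong k P P' \<longrightarrow> P' \<in> W"
    proof
      fix P assume P: "P \<in> W"
      then have "r P \<in> U" using U(2) by blast
      then obtain B where B: "\<forall>i\<in>{..<d}. openin padic_int_topology (B i)" "r P \<in> Pi\<^sub>E {..<d} B" "Pi\<^sub>E {..<d} B \<subseteq> U"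
        using U(1) unfolding TP_def openin_product_topology_alt by meson
      have "\<exists>n. {y. padic_p ^ n dvd y - coeff P i} \<subseteq> B i" if "i < d" for i
      proof -
        have "coeff P i \<in> B i" using B(2) that by (auto simp: r_def PiE_def Pi_def)
        then show ?thesis using B(1) that unfolding openin_padic_int_topology by blast
      qed
      then obtain n where n: "\<And>i. i < d \<Longrightarrow> {y. padic_p ^ n i dvd y - coeff P i} \<subseteq> B i" by metis
      define k where "k = Max (insert 0 (n ` {..<d}))"
      have k: "n i \<le> k" if "i < d" for i using that by (auto simp: k_def)
      have "P' \<in> W" if P': "P' \<in> PS" "poly_cong k P P'" for P'
      proof -
        have "coeff P' i \<in> B i" if "i < d" for i
        proof -
          have "padic_p ^ k dvd coeff P' i - coeff P i"
            using poly_cong_sym[OF P'(2)] by (simp add: poly_cong_def const_poly_dvd_iff)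
          then have "padic_p ^ n i dvd coeff P' i - coeff P i" by (rule dvd_trans[OF le_imp_power_dvd[OF k[OF that]]])
          then show ?thesis using n[OF that] by blast
        qed
        then have "r P' \<in> Pi\<^sub>E {..<d} B" unfolding r_def by (intro restrict_PiE_iff[THEN iffD2]) simp
        then have "r P' \<in> U" using B(3) by blast
        moreover have "P' \<in> A" using P' P W by (auto simp: A_def poly_cong_def)
        ultimately show ?thesis using U(2) by blast
      qed
      then show "\<exists>k. \<forall>P'\<in>PS. poly_cong k P P' \<longrightarrow> P' \<in> W" by blast
    qed
  next
    assume W': "\<forall>P\<in>W. \<exists>k. \<forall>P'\<in>PS. poly_cong k P P' \<longrightarrow> P' \<in> W"
    have "\<exists>V. openin (degree_component F S d) V \<and> P \<in> V \<and> V \<subseteq> W" if P: "P \<in> W" for P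
    proof -
      obtain k where k: "\<forall>P'\<in>PS. poly_cong k P P' \<longrightarrow> P' \<in> W" using W' P by blast
      define U where "U = Pi\<^sub>E {..<d} (\<lambda>i. {y. padic_p ^ k dvd y - coeff P i})"
      have "openin TP U" unfolding TP_def U_def
        by (rule openin_PiE[THEN iffD2]) (auto intro: openin_padic_int_ball)
      then have "openin (degree_component F S d) (r -` U \<inter> A)" using comp by blast
      moreover have "P \<in> r -` U \<inter> A" using P W by (auto simp: r_def U_def A_def)
      moreover have "P' \<in> W" if "P' \<in> r -` U \<inter> A" for P'
      proof -
        have P': "P' \<in> PS" "degree P' = d" "\<And>i. i < d \<Longrightarrow> padic_p ^ k dvd coeff P' i - coeff P i"
          using that by (auto simp: A_def r_def U_def PiE_def Pi_def)
        have Pd: "degree P = d" "lead_coeff P = 1" using P W poly_space_monic by auto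
        \<comment> \<open>The topology controls the coefficients below d; at d both polynomials have
          coefficient 1, above d both have 0.\<close>
        have "padic_p ^ k dvd coeff P' i - coeff P i" for i
        proof (cases i d rule: linorder_cases)
          case equal
          then show ?thesis using Pd poly_space_monic[OF P'(1)] P'(2) by auto
        qed (use P' Pd in \<open>auto simp: coeff_eq_0\<close>)
        then have "poly_cong k P' P" using P'(2) Pd by (simp add: poly_cong_def const_poly_dvd_iff)
        then show ?thesis using k P'(1) poly_cong_sym by blast
      qed
      ultimately show ?thesis by blast
    qed
    then show "openin (degree_component F S d) W" by (subst openin_subopen) blast
  qed
qed

lemma openin_poly_topology_cong:
  "openin (poly_topology F S) V \<longleftrightarrow> V \<subseteq> PS \<and> (\<forall>P\<in>V. \<exists>k. \<forall>P'\<in>PS. poly_cong k P P' \<longrightarrow> P' \<in> V)"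
proof (cases "V \<subseteq> PS")
  case True
  then have "openin (poly_topology F S) V \<longleftrightarrow>
    (\<forall>d. \<forall>P\<in>{P \<in> V. degree P = d}. \<exists>k. \<forall>P'\<in>PS. poly_cong k P P' \<longrightarrow> P' \<in> {P \<in> V. degree P = d})"
    unfolding openin_poly_topology using openin_degree_component by (simp add: subset_iff)
  also have "\<dots> \<longleftrightarrow> (\<forall>P\<in>V. \<exists>k. \<forall>P'\<in>PS. poly_cong k P P' \<longrightarrow> P' \<in> V)"
    by (fastforce simp: poly_cong_def)
  finally show ?thesis using True by blast
qed (simp add: openin_poly_topology)

text \<open>Up to degree D, a class is determined by the degree and by D + 1 residues modulo p^k;
  one polynomial is picked for each code that occurs.\<close>

lemma poly_space_finite_classes:
  "\<exists>Q. finite Q \<and> Q \<subseteq> PS \<and> (\<forall>P\<in>PS. degree P \<le> D \<longrightarrow> (\<exists>q\<in>Q. poly_cong k q P))"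
proof -
  define code where "code P = (degree P, restrict (\<lambda>i. Rep_padic_int (coeff P i) k) {..D})"
    for P :: "'p padic_int poly"
  define PD where "PD = {P \<in> PS. degree P \<le> D}"
  have "code ` PD \<subseteq> {..D} \<times> Pi\<^sub>E {..D} (\<lambda>_. {0..<int CARD('p) ^ k})"
  proof
    fix c assume "c \<in> code ` PD"
    then obtain P where P: "P \<in> PD" "c = code P" by blast
    show "c \<in> {..D} \<times> Pi\<^sub>E {..D} (\<lambda>_. {0..<int CARD('p) ^ k})"
      unfolding P(2) code_def
    proof (rule SigmaI)
      show "degree P \<in> {..D}" using P(1) by (simp add: PD_def)
      show "restrict (\<lambda>i. Rep_padic_int (coeff P i) k) {..D} \<in> Pi\<^sub>E {..D} (\<lambda>_. {0..<int CARD('p) ^ k})"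
        by (intro restrict_PiE_iff[THEN iffD2] ballI) (simp add: digit_bounds)
    qed
  qed
  then have fin: "finite (code ` PD)" by (rule finite_subset) (intro finite_cartesian_product finite_PiE; simp)
  have cong: "poly_cong k P Q" if "code P = code Q" "degree P \<le> D" for P Q
  proof -
    have "Rep_padic_int (coeff P i) k = Rep_padic_int (coeff Q i) k" if "i \<le> D" for i
      using fun_cong[OF arg_cong[OF \<open>code P = code Q\<close>, of snd], of i] \<open>i \<le> D\<close> by (simp add: code_def)
    then show ?thesis using that by (auto simp: poly_cong_digits code_def)
  qed
  show ?thesis
  proof (intro exI[of _ "inv_into PD code ` code ` PD"] conjI ballI impI)
    show "inv_into PD code ` code ` PD \<subseteq> PS" using inv_into_into[of _ code PD] by (auto simp: PD_def)
    fix P assume "P \<in> PS" "degree P \<le> D"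
    then have P: "P \<in> PD" by (simp add: PD_def)
    then have "code (inv_into PD code (code P)) = code P" by (intro f_inv_into_f) blast
    then have "poly_cong k P (inv_into PD code (code P))" using cong[of P] P by (simp add: PD_def)
    then show "\<exists>q\<in>inv_into PD code ` code ` PD. poly_cong k q P" using P poly_cong_sym by blast
  qed (use fin in simp)
qed

lemma poly_space_complete:
  assumes s: "\<And>k. s k \<in> PS" "\<And>k. poly_cong k (s k) (s (Suc k))"
  shows "\<exists>P\<in>PS. \<forall>k. poly_cong k (s k) P"
proof -
  define d where "d = degree (s 0)"
  have deg: "degree (s k) = d" for k
    by (induction k) (use s(2) in \<open>auto simp: d_def poly_cong_def\<close>)
  obtain P where P: "\<And>k. [:padic_p ^ k:] dvd P - s k" "\<And>i. i \<ge> Suc d \<Longrightarrow> coeff P i = 0"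
    by (rule padic_poly_complete[of s "Suc d"])
      (use poly_cong_sym[OF s(2)] deg in \<open>auto simp: poly_cong_def coeff_eq_0\<close>)
  have "coeff P d - 1 = 0"
  proof (rule p_power_dvd_all_imp_0)
    show "padic_p ^ k dvd coeff P d - 1" for k
      using P(1)[of k] poly_space_monic[OF s(1)[of k]] deg[of k] unfolding const_poly_dvd_iff by (metis coeff_diff)
  qed
  then have c: "coeff P d = 1" by simp
  have dP: "degree P = d"
  proof (rule antisym)
    show "degree P \<le> d" using P(2) by (intro degree_le) auto
    show "d \<le> degree P" using c by (intro le_degree) auto
  qed
  \<comment> \<open>The index 1 gives congruence modulo p, which decides membership.\<close>
  then have "P \<in> PS" using poly_space_cong[OF s(1)[of 1], of P] P(1)[of 1] c by simp
  moreover have "poly_cong k (s k) P" for k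
    using P(1)[of k] deg dP by (intro poly_cong_sym[of k P]) (simp add: poly_cong_def)
  ultimately show ?thesis by blast
qed

sublocale norm_family PS degree poly_cong "poly_topology F S" PS res_norm "1 / real CARD('p)"
proof
  fix k D :: nat and P Q R Z :: "'p padic_int poly"
  show "poly_cong k P P" by (simp add: poly_cong_def)
  show "poly_cong k P Q \<Longrightarrow> poly_cong k Q P" by (rule poly_cong_sym)
  show "poly_cong k P Q \<Longrightarrow> poly_cong k Q R \<Longrightarrow> poly_cong k P R" by (rule poly_cong_trans)
  show "poly_cong (Suc k) P Q \<Longrightarrow> poly_cong k P Q" by (rule poly_cong_Suc)
  show "poly_cong k P Q \<Longrightarrow> degree P = degree Q" by (simp add: poly_cong_def)
  show "\<exists>Q. finite Q \<and> Q \<subseteq> PS \<and> (\<forall>P\<in>PS. degree P \<le> D \<longrightarrow> (\<exists>q\<in>Q. poly_cong k q P))"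
    by (rule poly_space_finite_classes)
  show "\<exists>x\<in>PS. \<forall>k. poly_cong k (s k) x"
    if "\<And>k. s k \<in> PS" "\<And>k. poly_cong k (s k) (s (Suc k))" for s
    using poly_space_complete that by blast
  show "openin (poly_topology F S) V \<longleftrightarrow> V \<subseteq> PS \<and> (\<forall>x\<in>V. \<exists>k. \<forall>y\<in>PS. poly_cong k x y \<longrightarrow> y \<in> V)" for V
    by (rule openin_poly_topology_cong)
  show "0 < 1 / real CARD('p)" "1 / real CARD('p) < 1" using real_card_gt_1[where ?'p='p] by simp_all
  show "\<exists>i\<in>PS. \<forall>x\<in>PS. res_norm i x = 1" using poly_space_1 res_norm_1 by blast
  show "\<exists>l\<in>PS. \<forall>x\<in>PS. res_norm l x = res_norm P x * res_norm Q x" if "P \<in> PS" "Q \<in> PS"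
    using poly_space_mult[OF that] res_norm_mult that poly_space_monic by blast
  show "res_norm Z P = 0 \<or> (\<exists>k. res_norm Z P = (1 / real CARD('p)) ^ k)" if "Z \<in> PS" "P \<in> PS"
    using res_norm_values that poly_space_monic by blast
  show "\<bar>res_norm Z P - res_norm Z Q\<bar> \<le> (1 / real CARD('p)) ^ k"
    if "Z \<in> PS" "P \<in> PS" "Q \<in> PS" "poly_cong k P Q"
    using that(4) unfolding poly_cong_def
    by (intro res_norm_cong poly_space_monic[OF that(1)]) simp
  show "\<exists>i\<in>PS. res_norm i P \<noteq> res_norm i Q" if "P \<in> PS" "Q \<in> PS" "P \<noteq> Q"
    using separation[OF that] by blast
qed

end

section \<open>Transfer to random variables\<close>

lemma measurable_borel_ofI:
  assumes "\<And>x. x \<in> space M \<Longrightarrow> Y x \<in> topspace T" "\<And>V. openin T V \<Longrightarrow> Y -` V \<inter> space M \<in> sets M"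
  shows "Y \<in> measurable M (borel_of T)"
  unfolding borel_of_def using assms by (intro measurable_measure_of) (auto dest: openin_subset)

lemma norm_of_val_ereal_of_enat:
  assumes "p > 1"
  shows "norm_of_val p (ereal_of_enat (enat n)) = (1 / real p) ^ n" "norm_of_val p \<infinity> = 0"
  using assms by (simp_all add: norm_of_val_def powr_minus powr_realpow divide_inverse power_inverse)

lemma norm_of_val_inj:
  assumes p: "p > 1" and uv: "u \<in> range ereal_of_enat" "v \<in> range ereal_of_enat"
  shows "norm_of_val p u = norm_of_val p v \<longleftrightarrow> u = v"
proof -
  have inj: "(1 / real p) ^ m = (1 / real p) ^ n \<longleftrightarrow> m = n" for m n
    using p power_inject_exp'[of "1 / real p" m n] by simp
  have nz: "(1 / real p) ^ n \<noteq> 0" for n using p by simp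
  obtain a b where ab: "u = ereal_of_enat a" "v = ereal_of_enat b" using uv by blast
  note norm = norm_of_val_ereal_of_enat[OF p]
  show ?thesis
  proof (cases a)
    case (enat i)
    then have u: "norm_of_val p u = (1 / real p) ^ i" using ab norm(1) by simp
    show ?thesis
    proof (cases b)
      case (enat j)
      then have "norm_of_val p v = (1 / real p) ^ j" using ab norm(1) by simp
      then show ?thesis unfolding u using ab enat \<open>a = enat i\<close> inj by simp
    next
      case infinity
      then show ?thesis unfolding u using ab norm(2) nz \<open>a = enat i\<close> by simp
    qed
  next
    case infinity
    then have u: "norm_of_val p u = 0" using ab norm(2) by simp
    show ?thesis
    proof (cases b)
      case (enat j)
      then have "norm_of_val p v = (1 / real p) ^ j" using ab norm(1) by simp
      then show ?thesis unfolding u using ab enat infinity nz[of j] by simp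
    qed (use ab infinity in simp)
  qed
qed

text \<open>Only infinity is at issue, where p^(-n) tends to 0; finite points are isolated.\<close>

lemma norm_of_val_continuous:
  assumes p: "p > 1"
  shows "continuous_map nat_infinity_topology euclideanreal (norm_of_val p)"
    and "norm_of_val p ` topspace nat_infinity_topology \<subseteq> {0..1}"
proof -
  have top: "topspace nat_infinity_topology = range ereal_of_enat"
    by (simp add: nat_infinity_topology_def)
  have vals: "norm_of_val p v = 0 \<or> (\<exists>n. norm_of_val p v = (1 / real p) ^ n)" if "v \<in> range ereal_of_enat" for v
    using that norm_of_val_ereal_of_enat[OF p] by (metis enat.exhaust ereal_of_enat_simps(2) imageE)
  show "norm_of_val p ` topspace nat_infinity_topology \<subseteq> {0..1}"
  proof
    fix y assume "y \<in> norm_of_val p ` topspace nat_infinity_topology"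
    then obtain v where "v \<in> range ereal_of_enat" "y = norm_of_val p v" unfolding top by blast
    moreover have "(1 / real p) ^ n \<in> {0..1}" for n
      using p power_le_one[of "1 / real p" n] zero_le_power[of "1 / real p" n] by simp
    ultimately show "y \<in> {0..1}" using vals[of v] by auto
  qed
  show "continuous_map nat_infinity_topology euclideanreal (norm_of_val p)"
    unfolding continuous_map_def
  proof (intro conjI allI impI)
    fix U :: "real set" assume U: "openin euclideanreal U"
    show "openin nat_infinity_topology {v \<in> topspace nat_infinity_topology. norm_of_val p v \<in> U}"
      unfolding openin_nat_infinity_topology top
    proof (intro conjI impI)
      assume "\<infinity> \<in> {v \<in> range ereal_of_enat. norm_of_val p v \<in> U}"
      then have "0 \<in> U" using norm_of_val_ereal_of_enat[OF p] by simp
      then obtain e where e: "e > 0" "ball 0 e \<subseteq> U" using U by (auto simp: open_openin[symmetric] open_contains_ball)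
      obtain k where k: "(1 / real p) ^ k < e" using real_arch_pow_inv[OF e(1), of "1 / real p"] p by auto
      have "range ereal_of_enat - {v \<in> range ereal_of_enat. norm_of_val p v \<in> U} \<subseteq> (\<lambda>n. ereal_of_enat (enat n)) ` {..<k}"
      proof
        fix v assume v: "v \<in> range ereal_of_enat - {v \<in> range ereal_of_enat. norm_of_val p v \<in> U}"
        then obtain a where a: "v = ereal_of_enat a" "norm_of_val p v \<notin> U" by blast
        show "v \<in> (\<lambda>n. ereal_of_enat (enat n)) ` {..<k}"
        proof (cases a)
          case infinity
          then show ?thesis using a \<open>0 \<in> U\<close> norm_of_val_ereal_of_enat[OF p] by simp
        next
          case (enat n)
          have "n < k"
          proof (rule ccontr)
            assume "\<not> n < k"
            then have "(1 / real p) ^ n \<le> (1 / real p) ^ k" using p by (intro power_decreasing) auto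
            moreover have "0 \<le> (1 / real p) ^ n" by (rule zero_le_power) simp
            ultimately have "(1 / real p) ^ n \<in> ball 0 e" unfolding mem_ball dist_0_norm real_norm_def using k by linarith
            moreover have "norm_of_val p v = (1 / real p) ^ n"
              unfolding a(1) enat by (rule norm_of_val_ereal_of_enat(1)[OF p])
            ultimately show False using a(2) e(2) by (metis subsetD)
          qed
          then show ?thesis using a enat by blast
        qed
      qed
      then show "finite (range ereal_of_enat - {v \<in> range ereal_of_enat. norm_of_val p v \<in> U})"
        by (rule finite_subset) simp
    qed blast
  qed simp
qed

context poly_family
begin

text \<open>The values form a countable set on which v \<mapsto> p^(-v) is injective, so a preimage
  is a countable union of level sets of the continuous function \<open>res_norm Z\<close>.\<close>

lemma val_Res_measurable:
  assumes Z: "Z \<in> PS"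
  shows "(\<lambda>P. val_Res P Z) \<in> measurable (borel_of (poly_topology F S)) (borel_of nat_infinity_topology)"
proof (rule measurable_borel_ofI)
  have p: "CARD('p) > 1" using real_card_gt_1[where ?'p='p] by simp
  have Z1: "lead_coeff Z = 1" using poly_space_monic[OF Z] .
  have range: "val_Res P Z \<in> range ereal_of_enat" if "P \<in> PS" for P
    using val_Res_values[OF poly_space_monic[OF that] Z1] .
  show "val_Res P Z \<in> topspace nat_infinity_topology" if "P \<in> space (borel_of (poly_topology F S))" for P
    using range that by (simp add: space_borel_of topspace_T nat_infinity_topology_def)
  fix V assume V: "openin nat_infinity_topology V"
  then have VR: "V \<subseteq> range ereal_of_enat" unfolding openin_nat_infinity_topology by blast
  then have cV: "countable V" by (rule countable_subset) simp
  have eq: "(\<lambda>P. val_Res P Z) -` V \<inter> space (borel_of (poly_topology F S)) =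
      (\<Union>v\<in>V. res_norm Z -` {norm_of_val CARD('p) v} \<inter> space (borel_of (poly_topology F S)))"
  proof (intro equalityI subsetI)
    fix P assume "P \<in> (\<lambda>P. val_Res P Z) -` V \<inter> space (borel_of (poly_topology F S))"
    then show "P \<in> (\<Union>v\<in>V. res_norm Z -` {norm_of_val CARD('p) v} \<inter> space (borel_of (poly_topology F S)))"
      using res_norm_val_Res[OF poly_space_monic Z1, of P] by (auto simp: space_borel_of topspace_T)
  next
    fix P assume "P \<in> (\<Union>v\<in>V. res_norm Z -` {norm_of_val CARD('p) v} \<inter> space (borel_of (poly_topology F S)))"
    then obtain v where v: "v \<in> V" "res_norm Z P = norm_of_val CARD('p) v" "P \<in> PS"
      by (auto simp: space_borel_of topspace_T)
    then have "norm_of_val CARD('p) (val_Res P Z) = norm_of_val CARD('p) v"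
      using res_norm_val_Res[OF poly_space_monic[OF v(3)] Z1] by simp
    then have "val_Res P Z = v" using norm_of_val_inj[OF p range[OF v(3)]] VR v(1) by blast
    then show "P \<in> (\<lambda>P. val_Res P Z) -` V \<inter> space (borel_of (poly_topology F S))"
      using v by (simp add: space_borel_of topspace_T)
  qed
  have "res_norm Z \<in> borel_measurable (borel_of (poly_topology F S))"
    using f_continuous[OF Z] by (rule continuous_map_borel_measurable)
  then show "(\<lambda>P. val_Res P Z) -` V \<inter> space (borel_of (poly_topology F S)) \<in> sets (borel_of (poly_topology F S))"
    unfolding eq by (intro sets.countable_UN'[OF cV] measurable_sets) auto
qed

section \<open>Laws of random polynomials\<close>

lemma law_on_law:
  assumes "random_element M (poly_topology F S) P"
  shows "law_on (law M (poly_topology F S) P)"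
  using assms unfolding random_element_def law_def law_on_def
  by (auto intro: prob_space.prob_space_distr)

lemma random_element_PS: "random_element M (poly_topology F S) P \<Longrightarrow> \<omega> \<in> space M \<Longrightarrow> P \<omega> \<in> PS"
  using measurable_space[of P M "borel_of (poly_topology F S)" \<omega>]
  by (simp add: random_element_def space_borel_of topspace_T)

lemma integral_law:
  assumes "random_element M (poly_topology F S) P" "g \<in> borel_measurable (borel_of (poly_topology F S))"
  shows "(\<integral>x. g x \<partial>law M (poly_topology F S) P) = (\<integral>\<omega>. (g (P \<omega>) :: real) \<partial>M)"
  using assms unfolding random_element_def law_def by (intro integral_distr) auto

lemma nn_integral_law:
  assumes "random_element M (poly_topology F S) P" "g \<in> borel_measurable (borel_of (poly_topology F S))"
  shows "(\<integral>\<^sup>+x. g x \<partial>law M (poly_topology F S) P) = (\<integral>\<^sup>+\<omega>. g (P \<omega>) \<partial>M)"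
  using assms unfolding random_element_def law_def by (intro nn_integral_distr) auto

lemma integral_res_norm_law:
  assumes "random_element M (poly_topology F S) P" "Z \<in> PS"
  shows "(\<integral>x. res_norm Z x \<partial>law M (poly_topology F S) P) = (\<integral>\<omega>. norm_of_val CARD('p) (val_Res (P \<omega>) Z) \<partial>M)"
  unfolding integral_law[OF assms(1) continuous_map_borel_measurable[OF f_continuous[OF assms(2)]]]
  by (intro Bochner_Integration.integral_cong refl
    res_norm_val_Res[OF poly_space_monic[OF random_element_PS[OF assms(1)]] poly_space_monic[OF assms(2)]])

theorem law_determined:
  assumes P: "random_element M1 (poly_topology F S) P1" "random_element M2 (poly_topology F S) P2"
    and eq: "\<And>Z. Z \<in> PS \<Longrightarrow> law M1 nat_infinity_topology (\<lambda>\<omega>. val_Res (P1 \<omega>) Z) =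
      law M2 nat_infinity_topology (\<lambda>\<omega>. val_Res (P2 \<omega>) Z)"
  shows "law M1 (poly_topology F S) P1 = law M2 (poly_topology F S) P2"
proof (rule law_eqI[OF law_on_law[OF P(1)] law_on_law[OF P(2)]])
  fix Z assume Z: "Z \<in> PS"
  have p: "CARD('p) > 1" using real_card_gt_1[where ?'p='p] by simp
  have g: "norm_of_val CARD('p) \<in> borel_measurable (borel_of nat_infinity_topology)"
    by (intro continuous_map_borel_measurable norm_of_val_continuous p)
  have *: "(\<integral>x. res_norm Z x \<partial>law M (poly_topology F S) P) =
      (\<integral>v. norm_of_val CARD('p) v \<partial>law M nat_infinity_topology (\<lambda>\<omega>. val_Res (P \<omega>) Z))"
    if P: "random_element M (poly_topology F S) P" for M :: "'w measure" and P
  proof -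
    have "(\<lambda>\<omega>. val_Res (P \<omega>) Z) \<in> measurable M (borel_of nat_infinity_topology)"
      using P by (intro measurable_compose[OF _ val_Res_measurable[OF Z]]) (simp add: random_element_def)
    from integral_distr[OF this g] show ?thesis
      by (simp add: integral_res_norm_law[OF P Z] law_def[of M nat_infinity_topology])
  qed
  show "(\<integral>x. res_norm Z x \<partial>law M1 (poly_topology F S) P1) = (\<integral>x. res_norm Z x \<partial>law M2 (poly_topology F S) P2)"
    unfolding *[OF P(1)] *[OF P(2)] eq[OF Z] ..
qed

lemma tight_law:
  assumes P: "\<And>n. random_element (M n) (poly_topology F S) (P n)"
    and lim: "(\<lambda>D::nat. SUP n. \<P>(\<omega> in M n. degree (P n \<omega>) > D)) \<longlonglongrightarrow> 0"
  shows "tight (\<lambda>n. law (M n) (poly_topology F S) (P n))"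
  unfolding tight_def
proof (intro allI impI)
  fix e :: real assume "e > 0"
  then have "\<forall>\<^sub>F D in sequentially. (SUP n. \<P>(\<omega> in M n. degree (P n \<omega>) > D)) < e"
    using lim by (intro order_tendstoD) auto
  then obtain D where D: "(SUP n. \<P>(\<omega> in M n. degree (P n \<omega>) > D)) < e" by (auto simp: eventually_sequentially)
  have "measure (law (M n) (poly_topology F S) (P n)) (tail D) \<le> e" for n
  proof -
    have pr: "prob_space (M n)" for n using P by (simp add: random_element_def)
    have "measure (law (M n) (poly_topology F S) (P n)) (tail D) = measure (M n) (P n -` tail D \<inter> space (M n))"
      using P[of n] clp_sets[OF clp_tail] unfolding random_element_def law_def by (intro measure_distr) auto
    also have "P n -` tail D \<inter> space (M n) = {\<omega> \<in> space (M n). degree (P n \<omega>) > D}"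
      using random_element_PS[OF P] by (auto simp: tail_def)
    also have "measure (M n) \<dots> \<le> (SUP n. \<P>(\<omega> in M n. degree (P n \<omega>) > D))"
      by (intro cSUP_upper) (auto intro!: bdd_aboveI[of _ 1] prob_space.prob_le_1 pr)
    finally show ?thesis using D by simp
  qed
  then show "\<exists>D. \<forall>n. measure (law (M n) (poly_topology F S) (P n)) (tail D) \<le> e" by blast
qed

theorem limit_exists:
  assumes P: "\<And>n. random_element (M n) (poly_topology F S) (P n)"
    and conv: "\<And>Z. Z \<in> PS \<Longrightarrow> \<exists>(N :: ereal measure) V.
      converges_in_distribution nat_infinity_topology M (\<lambda>n \<omega>. val_Res (P n \<omega>) Z) N V"
    and lim: "(\<lambda>D::nat. SUP n. \<P>(\<omega> in M n. degree (P n \<omega>) > D)) \<longlonglongrightarrow> 0"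
  shows "\<exists>(N :: 'p padic_int poly measure) Pinf. converges_in_distribution (poly_topology F S) M P N Pinf"
proof -
  define \<nu> where "\<nu> n = law (M n) (poly_topology F S) (P n)" for n
  have law: "law_on (\<nu> n)" for n unfolding \<nu>_def using law_on_law[OF P] .
  have tight: "tight \<nu>" unfolding \<nu>_def by (rule tight_law[OF P lim])
  have p: "CARD('p) > 1" using real_card_gt_1[where ?'p='p] by simp
  \<comment> \<open>\<open>norm_of_val\<close> is a bounded continuous function on the compactified
    naturals, so the assumed convergence in distribution applies to it.\<close>
  have conv_f: "convergent (\<lambda>n. \<integral>x. res_norm Z x \<partial>\<nu> n)" if Z: "Z \<in> PS" for Z
  proof -
    obtain N :: "ereal measure" and V where
      "converges_in_distribution nat_infinity_topology M (\<lambda>n \<omega>. val_Res (P n \<omega>) Z) N V" using conv[OF Z] by blast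
    moreover have "bounded (norm_of_val CARD('p) ` topspace nat_infinity_topology)"
      using norm_of_val_continuous(2)[OF p] by (rule bounded_subset[rotated]) simp
    ultimately have "(\<lambda>n. \<integral>\<omega>. norm_of_val CARD('p) (val_Res (P n \<omega>) Z) \<partial>M n)
        \<longlonglongrightarrow> (\<integral>\<omega>. norm_of_val CARD('p) (V \<omega>) \<partial>N)"
      using norm_of_val_continuous(1)[OF p] unfolding converges_in_distribution_def by blast
    then show ?thesis unfolding \<nu>_def integral_res_norm_law[OF P Z] convergent_def by blast
  qed
  interpret nc: norm_convergence PS degree poly_cong "poly_topology F S" PS res_norm "1 / real CARD('p)" \<nu>
    by unfold_locales (use law tight conv_f in auto)
  obtain \<mu> where \<mu>: "law_on \<mu>" "\<And>A. clp A \<Longrightarrow> (\<lambda>n. measure (\<nu> n) A) \<longlonglongrightarrow> measure \<mu> A"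
    using limit_law_exists[OF law tight nc.convergent_measure_clp] by blast
  \<comment> \<open>The limit law serves as its own probability space, with the identity as the
    random polynomial.\<close>
  have "converges_in_distribution (poly_topology F S) M P \<mu> (\<lambda>x. x)"
    unfolding converges_in_distribution_def
  proof (intro conjI allI impI)
    show "random_element (M n) (poly_topology F S) (P n)" for n by (rule P)
    show "random_element \<mu> (poly_topology F S) (\<lambda>x. x)"
      using \<mu>(1) unfolding random_element_def law_on_def by (auto intro: measurable_ident_sets)
    fix g :: "'p padic_int poly \<Rightarrow> real"
    assume g: "continuous_map (poly_topology F S) euclideanreal g \<and> bounded (g ` topspace (poly_topology F S))"
    then have "(\<lambda>n. \<integral>x. g x \<partial>\<nu> n) \<longlonglongrightarrow> (\<integral>x. g x \<partial>\<mu>)"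
      by (intro weak_convergence[OF law \<mu>(1) tight \<mu>(2)]) (auto simp: topspace_T)
    moreover have gm: "g \<in> borel_measurable (borel_of (poly_topology F S))"
      using g by (intro continuous_map_borel_measurable) simp
    ultimately show "(\<lambda>n. \<integral>\<omega>. g (P n \<omega>) \<partial>M n) \<longlonglongrightarrow> (\<integral>x. g x \<partial>\<mu>)"
      unfolding \<nu>_def integral_law[OF P gm] by simp
  qed
  then show ?thesis by blast
qed

end

section \<open>Counting tuples of roots\<close>

locale root_count = poly_family F S
  for F :: "nat \<Rightarrow> 'p::prime_card mod_ring poly" and S :: "nat set" +
  fixes m :: nat and K :: "nat \<Rightarrow> 'p padic_closure set" and U :: "(nat \<Rightarrow> 'p padic_closure) set"
  assumes U_open: "openin (product_topology
      (\<lambda>i. subtopology padic_closure_topology (new_integers (K i))) {..<m}) U"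
    and U_closed: "closedin (product_topology
      (\<lambda>i. subtopology padic_closure_topology (new_integers (K i))) {..<m}) U"
begin

lemma count_stable:
  assumes P: "P \<in> PS"
  shows "\<exists>k. \<forall>P'\<in>PS. poly_cong k P P' \<longrightarrow> card (root_set P) \<le> card (root_set P') \<and>
      (card (root_set P') = card (root_set P) \<longrightarrow> root_tuple_count m U P' = root_tuple_count m U P)"
proof -
  obtain k where "\<And>P'. lead_coeff P' = 1 \<Longrightarrow> degree P' = degree P \<Longrightarrow> [:padic_p ^ k:] dvd P' - P \<Longrightarrow>
      card (root_set P) \<le> card (root_set P') \<and>
      (card (root_set P') = card (root_set P) \<longrightarrow> root_tuple_count m U P' = root_tuple_count m U P)"
    using root_tuple_count_stable[OF poly_space_monic[OF P] U_open U_closed] by blast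
  then show ?thesis using poly_space_monic poly_cong_sym[of k P] unfolding poly_cong_def by (intro exI[of _ k]) blast
qed

text \<open>The strata are given by the number of distinct roots, which can only grow nearby; on
  each of them the count is locally constant.\<close>

lemma count_measurable:
  "root_tuple_count m U \<in> measurable (borel_of (poly_topology F S)) (count_space UNIV)"
  by (rule stratified_measurable[where r = "\<lambda>P. card (root_set P)"]) (use count_stable in blast)

text \<open>At a squarefree P the number of roots equals the degree. A congruent polynomial has the
  same degree, hence no more roots, and nearby it has no fewer.\<close>

lemma count_locally_constant:
  assumes P: "P \<in> PS" "rsquarefree (lift_poly P)"
  shows "\<exists>k. \<forall>P'\<in>PS. poly_cong k P P' \<longrightarrow> root_tuple_count m U P' = root_tuple_count m U P"
proof -
  obtain k where k: "\<forall>P'\<in>PS. poly_cong k P P' \<longrightarrow> card (root_set P) \<le> card (root_set P') \<and>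
      (card (root_set P') = card (root_set P) \<longrightarrow> root_tuple_count m U P' = root_tuple_count m U P)"
    using count_stable[OF P(1)] by blast
  have "card (root_set P') = card (root_set P)" if "P' \<in> PS" "poly_cong k P P'" for P'
    using k that rsquarefree_card_root_set(1)[OF poly_space_monic[OF that(1)]]
      rsquarefree_card_root_set(2)[OF poly_space_monic[OF P(1)] P(2)] by (fastforce simp: poly_cong_def)
  then show ?thesis using k by blast
qed

lemma sets_borel_of_nat: "sets (borel_of (euclidean :: nat topology)) = UNIV"
proof (rule UNIV_eq_I[symmetric])
  fix A :: "nat set"
  have "openin euclidean A" unfolding open_openin[symmetric] by (rule Topological_Spaces.open_discrete)
  then show "A \<in> sets (borel_of euclidean)" by (rule openin_sets_borel_of)
qed

lemma measurable_borel_of_nat: "measurable M (borel_of (euclidean :: nat topology)) = measurable M (count_space UNIV)"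
  by (rule measurable_cong_sets) (simp_all add: sets_borel_of_nat)

theorem count_convergence:
  assumes conv: "converges_in_distribution (poly_topology F S) M P N Pinf"
    and sf: "AE \<omega> in N. rsquarefree (lift_poly (Pinf \<omega>))"
  shows "converges_in_distribution (euclidean :: nat topology) M
      (\<lambda>n \<omega>. root_tuple_count m U (P n \<omega>)) N (\<lambda>\<omega>. root_tuple_count m U (Pinf \<omega>))"
    and "(\<lambda>D::nat. SUP n. \<integral>\<^sup>+\<omega>. of_nat (degree (P n \<omega>) ^ m)
        * indicator {\<omega>. degree (P n \<omega>) > D} \<omega> \<partial>M n) \<longlonglongrightarrow> 0 \<Longrightarrow>
      (\<lambda>n. \<integral>\<^sup>+\<omega>. of_nat (root_tuple_count m U (P n \<omega>)) \<partial>M n)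
        \<longlonglongrightarrow> (\<integral>\<^sup>+\<omega>. of_nat (root_tuple_count m U (Pinf \<omega>)) \<partial>N)"
proof -
  let ?T = "poly_topology F S"
  let ?h = "root_tuple_count m U"
  have P: "random_element (M n) ?T (P n)" for n using conv by (simp add: converges_in_distribution_def)
  have Pinf: "random_element N ?T Pinf" using conv by (simp add: converges_in_distribution_def)
  define \<nu> where "\<nu> n = law (M n) ?T (P n)" for n
  define \<mu> where "\<mu> = law N ?T Pinf"
  have \<nu>: "law_on (\<nu> n)" for n unfolding \<nu>_def using law_on_law[OF P] .
  have \<mu>: "law_on \<mu>" unfolding \<mu>_def using law_on_law[OF Pinf] .
  have meas: "P n \<in> measurable (M n) (borel_of ?T)" for n using P by (simp add: random_element_def)
  have meas_inf: "Pinf \<in> measurable N (borel_of ?T)" using Pinf by (simp add: random_element_def)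
  have weak: "(\<lambda>n. \<integral>x. g x \<partial>\<nu> n) \<longlonglongrightarrow> (\<integral>x. g x \<partial>\<mu>)"
    if g: "continuous_map ?T euclideanreal g" "bounded (g ` PS)" for g
  proof -
    have "(\<lambda>n. \<integral>\<omega>. g (P n \<omega>) \<partial>M n) \<longlonglongrightarrow> (\<integral>\<omega>. g (Pinf \<omega>) \<partial>N)"
      using conv g unfolding converges_in_distribution_def topspace_T by blast
    then show ?thesis unfolding \<nu>_def \<mu>_def
      integral_law[OF P continuous_map_borel_measurable[OF g(1)]]
      integral_law[OF Pinf continuous_map_borel_measurable[OF g(1)]] .
  qed
  have loc: "AE x in \<mu>. \<exists>k. \<forall>y\<in>PS. poly_cong k x y \<longrightarrow> ?h y = ?h x"
    unfolding \<mu>_def law_def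
  proof (subst AE_distr_iff[OF meas_inf])
    show "{x \<in> space (borel_of ?T). \<exists>k. \<forall>y\<in>PS. poly_cong k x y \<longrightarrow> ?h y = ?h x} \<in> sets (borel_of ?T)"
      using openin_sets_borel_of[OF locally_constant_open[of ?h]] by (simp add: space_borel_of topspace_T)
    show "AE \<omega> in N. \<exists>k. \<forall>y\<in>PS. poly_cong k (Pinf \<omega>) y \<longrightarrow> ?h y = ?h (Pinf \<omega>)"
      using sf AE_space
    proof eventually_elim
      case (elim \<omega>)
      then show ?case using count_locally_constant random_element_PS[OF Pinf] by blast
    qed
  qed
  show "converges_in_distribution (euclidean :: nat topology) M (\<lambda>n \<omega>. ?h (P n \<omega>)) N (\<lambda>\<omega>. ?h (Pinf \<omega>))"
    unfolding converges_in_distribution_def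
  proof (intro conjI allI impI)
    show "random_element (M n) euclidean (\<lambda>\<omega>. ?h (P n \<omega>))" for n
      using P[of n] measurable_compose[OF meas count_measurable] by (simp add: random_element_def measurable_borel_of_nat)
    show "random_element N euclidean (\<lambda>\<omega>. ?h (Pinf \<omega>))"
      using Pinf measurable_compose[OF meas_inf count_measurable] by (simp add: random_element_def measurable_borel_of_nat)
    fix g :: "nat \<Rightarrow> real"
    assume g: "continuous_map euclidean euclideanreal g \<and> bounded (g ` topspace euclidean)"
    have gm: "(\<lambda>x. g (?h x)) \<in> borel_measurable (borel_of ?T)"
      using count_measurable by (rule measurable_compose) simp
    have "(\<lambda>n. \<integral>x. g (?h x) \<partial>\<nu> n) \<longlonglongrightarrow> (\<integral>x. g (?h x) \<partial>\<mu>)"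
    proof (rule continuous_mapping[OF \<nu> \<mu> weak])
      show "bounded_meas (\<lambda>x. g (?h x))"
        using gm g by (auto simp: bounded_meas_def bounded_iff)
      show "AE x in \<mu>. \<exists>k. \<forall>y\<in>PS. poly_cong k x y \<longrightarrow> g (?h y) = g (?h x)"
        using loc by eventually_elim metis
    qed
    then show "(\<lambda>n. \<integral>\<omega>. g (?h (P n \<omega>)) \<partial>M n) \<longlonglongrightarrow> (\<integral>\<omega>. g (?h (Pinf \<omega>)) \<partial>N)"
      unfolding \<nu>_def \<mu>_def integral_law[OF P gm] integral_law[OF Pinf gm] .
  qed
  assume ui: "(\<lambda>D::nat. SUP n. \<integral>\<^sup>+\<omega>. of_nat (degree (P n \<omega>) ^ m)
        * indicator {\<omega>. degree (P n \<omega>) > D} \<omega> \<partial>M n) \<longlonglongrightarrow> 0"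
  have hm: "(\<lambda>x. of_nat (?h x) :: ennreal) \<in> borel_measurable (borel_of ?T)"
    using count_measurable by (rule measurable_compose) simp
  have dm: "(\<lambda>x. of_nat (degree x ^ m) * indicator (tail D) x :: ennreal) \<in> borel_measurable (borel_of ?T)" for D
    using measurable_compose[OF rk_measurable, of "\<lambda>k. of_nat (k ^ m) :: ennreal" borel] clp_sets[OF clp_tail]
    by (intro borel_measurable_times_ennreal borel_measurable_indicator) auto
  have "(\<lambda>n. \<integral>\<^sup>+x. of_nat (?h x) \<partial>\<nu> n) \<longlonglongrightarrow> (\<integral>\<^sup>+x. of_nat (?h x) \<partial>\<mu>)"
  proof (rule moment_convergence[OF \<nu> \<mu> weak count_measurable _ loc])
    show "?h x \<le> degree x ^ m" if "x \<in> PS" for x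
      using root_tuple_count_le[OF poly_space_monic[OF that] U_open] .
    have "(\<integral>\<^sup>+x. of_nat (degree x ^ m) * indicator (tail D) x \<partial>\<nu> n) =
        (\<integral>\<^sup>+\<omega>. of_nat (degree (P n \<omega>) ^ m) * indicator {\<omega>. degree (P n \<omega>) > D} \<omega> \<partial>M n)" for D n
      unfolding \<nu>_def nn_integral_law[OF P dm]
      using random_element_PS[OF P] by (intro nn_integral_cong) (auto simp: tail_def indicator_def)
    then show "(\<lambda>D. SUP n. \<integral>\<^sup>+x. of_nat (degree x ^ m) * indicator (tail D) x \<partial>\<nu> n) \<longlonglongrightarrow> 0"
      using ui by simp
  qed
  then show "(\<lambda>n. \<integral>\<^sup>+\<omega>. of_nat (?h (P n \<omega>)) \<partial>M n) \<longlonglongrightarrow> (\<integral>\<^sup>+\<omega>. of_nat (?h (Pinf \<omega>)) \<partial>N)"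
    unfolding \<nu>_def \<mu>_def nn_integral_law[OF P hm] nn_integral_law[OF Pinf hm] .
qed

end

text \<open>The third part holds for every limit in distribution, whatever its probability space,
  and so in particular for the limit that the second part constructs.\<close>

theorem theorem1p5:
  fixes F :: "nat \<Rightarrow> 'p::prime_card mod_ring poly" and S :: "nat set"
  assumes enumeration: "bij_betw F {1..}
      {f. Polynomial.lead_coeff f = 1 \<and> Factorial_Ring.irreducible f}"
    and F1: "F 1 = [:0, 1:]"
    and S: "finite S" "S \<subseteq> {1..}"
  shows
    "(\<forall>(M1 :: 'a measure) P1 (M2 :: 'b measure) P2.
        random_element M1 (poly_topology F S) P1 \<and> random_element M2 (poly_topology F S) P2 \<and>
        (\<forall>Z\<in>poly_space F S.
           law M1 nat_infinity_topology (\<lambda>\<omega>. val_Res (P1 \<omega>) Z) =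
           law M2 nat_infinity_topology (\<lambda>\<omega>. val_Res (P2 \<omega>) Z)) \<longrightarrow>
        law M1 (poly_topology F S) P1 = law M2 (poly_topology F S) P2)
     \<and>
     (\<forall>(M :: nat \<Rightarrow> 'c measure) P.
        (\<forall>n. random_element (M n) (poly_topology F S) (P n)) \<and>
        (\<forall>Z\<in>poly_space F S. \<exists>(N :: ereal measure) V.
           converges_in_distribution nat_infinity_topology M (\<lambda>n \<omega>. val_Res (P n \<omega>) Z) N V) \<and>
        (\<lambda>D::nat. SUP n. \<P>(\<omega> in M n. Polynomial.degree (P n \<omega>) > D)) \<longlonglongrightarrow> 0 \<longrightarrow>
        (\<exists>(N :: 'p padic_int poly measure) Pinf.
           converges_in_distribution (poly_topology F S) M P N Pinf) \<and>
        (\<forall>(N :: 'd measure) Pinf m (K :: nat \<Rightarrow> 'p padic_closure set) U.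
           converges_in_distribution (poly_topology F S) M P N Pinf \<and>
           m \<ge> 1 \<and> (\<forall>i<m. finite_extension (K i)) \<and>
           openin (product_topology
             (\<lambda>i. subtopology padic_closure_topology (new_integers (K i))) {..<m}) U \<and>
           closedin (product_topology
             (\<lambda>i. subtopology padic_closure_topology (new_integers (K i))) {..<m}) U \<and>
           (AE \<omega> in N. rsquarefree (lift_poly (Pinf \<omega>))) \<longrightarrow>
           converges_in_distribution (euclidean :: nat topology) M
             (\<lambda>n \<omega>. root_tuple_count m U (P n \<omega>)) N (\<lambda>\<omega>. root_tuple_count m U (Pinf \<omega>)) \<and>
           ((\<lambda>D::nat. SUP n. \<integral>\<^sup>+\<omega>. of_nat (Polynomial.degree (P n \<omega>) ^ m)
                * indicator {\<omega>. Polynomial.degree (P n \<omega>) > D} \<omega> \<partial>M n) \<longlonglongrightarrow> 0 \<longrightarrow>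
            (\<lambda>n. \<integral>\<^sup>+\<omega>. of_nat (root_tuple_count m U (P n \<omega>)) \<partial>M n)
              \<longlonglongrightarrow> (\<integral>\<^sup>+\<omega>. of_nat (root_tuple_count m U (Pinf \<omega>)) \<partial>N))))"
proof -
  have F: "lead_coeff (F i) = 1 \<and> Factorial_Ring.irreducible (F i)" if "i \<in> S" for i
    using bij_betwE[OF enumeration] S(2) that by blast
  interpret poly_family F S by unfold_locales (use F S in auto)
  show ?thesis
  proof (intro conjI allI impI; elim conjE)
    fix M1 :: "'a measure" and P1 and M2 :: "'b measure" and P2
    assume "random_element M1 (poly_topology F S) P1" "random_element M2 (poly_topology F S) P2"
      "\<forall>Z\<in>PS. law M1 nat_infinity_topology (\<lambda>\<omega>. val_Res (P1 \<omega>) Z) =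
        law M2 nat_infinity_topology (\<lambda>\<omega>. val_Res (P2 \<omega>) Z)"
    then show "law M1 (poly_topology F S) P1 = law M2 (poly_topology F S) P2"
      by (intro law_determined) auto
  next
    fix M :: "nat \<Rightarrow> 'c measure" and P
    assume "\<forall>n. random_element (M n) (poly_topology F S) (P n)"
      "\<forall>Z\<in>PS. \<exists>(N :: ereal measure) V.
        converges_in_distribution nat_infinity_topology M (\<lambda>n \<omega>. val_Res (P n \<omega>) Z) N V"
      "(\<lambda>D::nat. SUP n. \<P>(\<omega> in M n. Polynomial.degree (P n \<omega>) > D)) \<longlonglongrightarrow> 0"
    then show "\<exists>(N :: 'p padic_int poly measure) Pinf. converges_in_distribution (poly_topology F S) M P N Pinf"
      by (intro limit_exists) auto
  next
    fix M :: "nat \<Rightarrow> 'c measure" and P and N :: "'d measure" and Pinf m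
      and K :: "nat \<Rightarrow> 'p padic_closure set" and U
    assume U: "openin (product_topology
        (\<lambda>i. subtopology padic_closure_topology (new_integers (K i))) {..<m}) U"
      "closedin (product_topology
        (\<lambda>i. subtopology padic_closure_topology (new_integers (K i))) {..<m}) U"
    interpret root_count F S m K U by unfold_locales (rule U)+
    assume c: "converges_in_distribution (poly_topology F S) M P N Pinf"
      "AE \<omega> in N. rsquarefree (lift_poly (Pinf \<omega>))"
    show "converges_in_distribution (euclidean :: nat topology) M
        (\<lambda>n \<omega>. root_tuple_count m U (P n \<omega>)) N (\<lambda>\<omega>. root_tuple_count m U (Pinf \<omega>))"
      by (rule count_convergence(1)[OF c])
    assume "(\<lambda>D::nat. SUP n. \<integral>\<^sup>+\<omega>. of_nat (Polynomial.degree (P n \<omega>) ^ m)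
        * indicator {\<omega>. Polynomial.degree (P n \<omega>) > D} \<omega> \<partial>M n) \<longlonglongrightarrow> 0"
    then show "(\<lambda>n. \<integral>\<^sup>+\<omega>. of_nat (root_tuple_count m U (P n \<omega>)) \<partial>M n)
        \<longlonglongrightarrow> (\<integral>\<^sup>+\<omega>. of_nat (root_tuple_count m U (Pinf \<omega>)) \<partial>N)"
      by (rule count_convergence(2)[OF c])
  qed
qed

end
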